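(* Fix $k=2$ or $k=3$. For $\chi>0$ let $\{p_n\}$, $\{s_n\}=\{s_n(\cdot;\chi)\}$ be the monic Legendre and monic Sobolev-Legendre orthogonal polynomials of the family $k$; let $f_{n+1}(x)=-\int_{SG}G(x,y)p_n(y)\,d\mu(y)$ for $n\ge0$, and let $$a_n=\frac{\langle f_{n+1},s_n\rangle_S}{\|s_n\|_S^2},\qquad \tilde b_n=\frac{\langle f_{n+1},s_{n-1}\rangle_S}{\|s_{n-1}\|_S^2},$$ the coefficients in the recurrence $s_{n+1}+a_ns_n+\tilde b_ns_{n-1}=f_{n+1}$. Then for $n\ge1$ the following estimates hold: (i) $\|p_n\|_2\le\|s_n\|_2\le\|G\|_2\|p_{n-1}\|_2$; (ii) $(1+\chi\|G\|_2^{-2})\|p_n\|_2^2\le\|s_n\|_S^2\le(\|G\|_2^2+\chi)\|p_{n-1}\|_2^2$; (iii) $|a_n|\le\min\{\|G\|_2,\ \chi^{-1}\|G\|_2^3\}$; (iv) $0<\tilde b_n\le\min\{\|G\|_2^2,\ \chi^{-1}\|G\|_2^4\}$. In particular, it follows that $\|s_n\|_S^2=O(\chi)$, $a_n=O(\chi^{-1})$ and $\tilde b_n=O(\chi^{-1})$. Furthermore, $$\lim_{\chi\to\infty}\chi\tilde b_n=\frac{\|p_n\|_2^2}{\|p_{n-2}\|_2^2},\qquad \lim_{\chi\to\infty}\chi a_n=\frac{\langle f_{n+1},f_n\rangle_2}{\|p_{n-1}\|_2^2},\qquad \lim_{\chi\to\infty}\|\Delta s_n\|_2=\|p_{n-1}\|_2$$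 uniformly in $n$.
   Context: Sierpinski gasket: let $q_0=(\tfrac12,\tfrac{\sqrt3}{2})$, $q_1=(0,0)$, $q_2=(1,0)$, $V_0=\{q_0,q_1,q_2\}$, $F_i(x)=\tfrac12(x-q_i)+q_i$, and let $SG\subset\mathbb R^2$ be the unique nonempty compact set with $SG=\bigcup_{i=0}^2F_i(SG)$. For a word $w=(w_1,\dots,w_m)\in\{0,1,2\}^m$, $|w|=m$, put $F_w=F_{w_1}\circ\cdots\circ F_{w_m}$; $F_w(SG)$ is called an $m$-cell; $V_m=\bigcup_{|w|=m}F_w(V_0)$; distinct $x,y\in V_m$ satisfy $x\sim_m y$ if they lie in a common $m$-cell. $\mu$ is the self-similar Borel probability measure with $\mu(F_w(SG))=3^{-|w|}$. All functions are real-valued. Energy and Laplacian: $\mathscr E(u,v)=\lim_{m\to\infty}(3/5)^{-m}\sum_{x\sim_m y}(u(x)-u(y))(v(x)-v(y))$ (sum over unordered pairs), and $u\in\operatorname{dom}\mathscr E$ if $\mathscr E(u,u)$ exists and is finite. For $u\in\operatorname{dom}\mathscr E$ and $f$ continuous, $\Delta u=f$ means $\mathscr E(u,v)=-\int_{SG}fv\,d\mu$ for all $v\in\operatorname{dom}\mathscr E$ vanishing on $V_0$. Indices of $q_i$ are mod 3. Normal derivative: $\partial_nu(q_i)=\lim_m(5/3)^m(2u(q_i)-u(F_i^mq_{i+1})-u(F_i^mq_{i-1}))$. Tangential derivative: $\partial_Tu(q_i)=\lim_m5^m(u(F_i^mq_{i+1})-u(F_i^mq_{i-1}))$. Green's function: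 $G(x,y)$ is the (continuous, symmetric) Green's function of the Dirichlet problem: for $f$ continuous, $-\Delta u=f$ and $u|_{V_0}=0$ iff $u(x)=\int_{SG}G(x,y)f(y)\,d\mu(y)$. $\|G\|_2$ is the norm of $G$ in $L^2(SG\times SG,\mu\times\mu)$. Monomials: for $j\ge0$, $k\in\{1,2,3\}$, $P_{j,k}$ is the unique function with $\Delta^{j+1}P_{j,k}=0$ such that for all $0\le n\le j$: $\Delta^nP_{j,k}(q_0)=\delta_{nj}\delta_{k1}$, $\partial_n\Delta^nP_{j,k}(q_0)=\delta_{nj}\delta_{k2}$, $\partial_T\Delta^nP_{j,k}(q_0)=\delta_{nj}\delta_{k3}$. In particular $\Delta P_{j,k}=P_{j-1,k}$ with $P_{-1,k}=0$. Inner products: $\langle f,g\rangle_2=\int_{SG}fg\,d\mu$ with norm $\|\cdot\|_2$; $\langle f,g\rangle_S=\int_{SG}fg\,d\mu+\chi\int_{SG}\Delta f\,\Delta g\,d\mu$ with norm $\|\cdot\|_S$. For fixed $k$, $\{p_{n}\}$ (monic Legendre) and $\{s_{n}\}$ (monic Sobolev-Legendre) are obtained from $P_{0,k},P_{1,k},\dots$ by Gram-Schmidt without normalization with respect to $\langle\cdot,\cdot\rangle_2$ and $\langle\cdot,\cdot\rangle_S$ respectively; i.e. each of $p_{n}$, $s_{n}$ equals $P_{n,k}$ plus a linear combination of $P_{0,k},\dots,P_{n-1,k}$ and is orthogonal to $P_{0,k},\dots,P_{n-1,k}$. By convention $s_{-1}=p_{-1}=0$.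
   Formalization: At n=1 the bound b̃_n ≤ χ^{-1}‖G‖_2^4 and b̃_n=O(χ^{-1}) are dropped (b̃_1=‖p_1‖²/‖p_0‖² is independent of χ; b̃_1 ≤ ‖G‖_2² is kept); the limits of χb̃_n and χa_n are for n≥2, as p_{-1}=0 and χa_1 has a different limit. *)

theory Defs
  imports "HOL-Probability.Probability" "HOL-Library.Landau_Symbols"
begin

text \<open>
  Functions on the gasket are total functions on the plane of which only the values on the
  gasket matter. Vertex and map indices live in the type \<open>3\<close> of integers modulo 3.
\<close>

type_synonym point = "real ^ 2"

subsection \<open>The Sierpinski gasket\<close>

definition sg_vertex :: "3 \<Rightarrow> point" where
  "sg_vertex i = (if i = 0 then vector [1/2, sqrt 3 / 2]
                  else if i = 1 then vector [0, 0] else vector [1, 0])"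

definition sg_V0 :: "point set" where
  "sg_V0 = range sg_vertex"

definition sg_map :: "3 \<Rightarrow> point \<Rightarrow> point" where
  "sg_map i x = (1/2) *\<^sub>R (x - sg_vertex i) + sg_vertex i"

definition SG :: "point set" where
  "SG = (THE K. K \<noteq> {} \<and> compact K \<and> K = (\<Union>i. sg_map i ` K))"

definition sg_word :: "3 list \<Rightarrow> point \<Rightarrow> point" where
  "sg_word w x = foldr sg_map w x"

definition sg_cell :: "3 list \<Rightarrow> point set" where
  "sg_cell w = sg_word w ` SG"

definition sg_V :: "nat \<Rightarrow> point set" where
  "sg_V m = (\<Union>w\<in>{w. length w = m}. sg_word w ` sg_V0)"

definition sg_adj :: "nat \<Rightarrow> point \<Rightarrow> point \<Rightarrow> bool" where
  "sg_adj m x y \<longleftrightarrow> x \<in> sg_V m \<and> y \<in> sg_V m \<and> x \<noteq> y \<and>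
     (\<exists>w. length w = m \<and> x \<in> sg_cell w \<and> y \<in> sg_cell w)"

text \<open>
  The measure lives on the Borel sets of the plane; the empty word gives \<open>SG\<close> full measure.
\<close>

definition sg_measure :: "point measure \<Rightarrow> bool" where
  "sg_measure \<mu> \<longleftrightarrow> sets \<mu> = sets borel \<and> prob_space \<mu> \<and>
     (\<forall>w. measure \<mu> (sg_cell w) = (1/3) ^ length w)"

subsection \<open>Energy and Laplacian\<close>

text \<open>The sum runs over ordered pairs, so every edge is counted twice; hence the division by 2.\<close>

definition sg_energy_level :: "nat \<Rightarrow> (point \<Rightarrow> real) \<Rightarrow> (point \<Rightarrow> real) \<Rightarrow> real" where
  "sg_energy_level m u v =
     inverse ((3/5) ^ m) * ((\<Sum>(x, y)\<in>{(x, y). sg_adj m x y}. (u x - u y) * (v x - v y)) / 2)"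

definition sg_energy :: "(point \<Rightarrow> real) \<Rightarrow> (point \<Rightarrow> real) \<Rightarrow> real" where
  "sg_energy u v = lim (\<lambda>m. sg_energy_level m u v)"

text \<open>
  The energy only sees the values on the countable set of vertices. A function of finite energy on
  the vertices has a unique continuous extension to the gasket, and the elements of the domain
  are these extensions; so continuity is part of the definition.
\<close>

definition sg_dom_energy :: "(point \<Rightarrow> real) set" where
  "sg_dom_energy = {u. continuous_on SG u \<and> convergent (\<lambda>m. sg_energy_level m u u)}"

definition sg_has_laplacian :: "point measure \<Rightarrow> (point \<Rightarrow> real) \<Rightarrow> (point \<Rightarrow> real) \<Rightarrow> bool" where
  "sg_has_laplacian \<mu> u f \<longleftrightarrow> u \<in> sg_dom_energy \<and> continuous_on SG f \<and>
     (\<forall>v\<in>sg_dom_energy. (\<forall>x\<in>sg_V0. v x = 0) \<longrightarrow>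
        sg_energy u v = - (LINT x:SG|\<mu>. f x * v x))"

text \<open>The choice is unique on \<open>SG\<close>, when there is one.\<close>

definition sg_laplacian :: "point measure \<Rightarrow> (point \<Rightarrow> real) \<Rightarrow> point \<Rightarrow> real" where
  "sg_laplacian \<mu> u = (SOME f. sg_has_laplacian \<mu> u f)"

definition sg_has_normal_deriv :: "(point \<Rightarrow> real) \<Rightarrow> 3 \<Rightarrow> real \<Rightarrow> bool" where
  "sg_has_normal_deriv u i d \<longleftrightarrow>
     (\<lambda>m. (5/3) ^ m * (2 * u (sg_vertex i) - u ((sg_map i ^^ m) (sg_vertex (i + 1)))
                                          - u ((sg_map i ^^ m) (sg_vertex (i - 1)))))
       \<longlonglongrightarrow> d"

definition sg_has_tangential_deriv :: "(point \<Rightarrow> real) \<Rightarrow> 3 \<Rightarrow> real \<Rightarrow> bool" where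
  "sg_has_tangential_deriv u i d \<longleftrightarrow>
     (\<lambda>m. 5 ^ m * (u ((sg_map i ^^ m) (sg_vertex (i + 1)))
                 - u ((sg_map i ^^ m) (sg_vertex (i - 1)))))
       \<longlonglongrightarrow> d"

subsection \<open>Green's function\<close>

definition sg_green :: "point measure \<Rightarrow> (point \<Rightarrow> point \<Rightarrow> real) \<Rightarrow> bool" where
  "sg_green \<mu> G \<longleftrightarrow>
     continuous_on (SG \<times> SG) (\<lambda>(x, y). G x y) \<and>
     (\<forall>x\<in>SG. \<forall>y\<in>SG. G x y = G y x) \<and>
     (\<forall>f u. continuous_on SG f \<longrightarrow>
        ((sg_has_laplacian \<mu> u (\<lambda>x. - f x) \<and> (\<forall>x\<in>sg_V0. u x = 0)) \<longleftrightarrow>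
        (\<forall>x\<in>SG. u x = (LINT y:SG|\<mu>. G x y * f y))))"

definition sg_green_norm2 :: "point measure \<Rightarrow> (point \<Rightarrow> point \<Rightarrow> real) \<Rightarrow> real" where
  "sg_green_norm2 \<mu> G = sqrt (LINT z:SG \<times> SG|\<mu> \<Otimes>\<^sub>M \<mu>. (G (fst z) (snd z))\<^sup>2)"

subsection \<open>Monomials\<close>

text \<open>\<open>D n\<close> is the \<open>n\<close>-th iterated Laplacian of \<open>u\<close>, for \<open>n \<le> j + 1\<close>.\<close>

definition sg_monomial :: "point measure \<Rightarrow> nat \<Rightarrow> nat \<Rightarrow> (point \<Rightarrow> real) \<Rightarrow> bool" where
  "sg_monomial \<mu> j k u \<longleftrightarrow>
     (\<exists>D. D 0 = u \<and>
        (\<forall>n\<le>j. sg_has_laplacian \<mu> (D n) (D (Suc n))) \<and>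
        (\<forall>x\<in>SG. D (Suc j) x = 0) \<and>
        (\<forall>n\<le>j. D n (sg_vertex 0) = (if n = j \<and> k = 1 then 1 else 0) \<and>
               sg_has_normal_deriv (D n) 0 (if n = j \<and> k = 2 then 1 else 0) \<and>
               sg_has_tangential_deriv (D n) 0 (if n = j \<and> k = 3 then 1 else 0)))"

subsection \<open>Inner products and orthogonal polynomials\<close>

definition sg_inner2 :: "point measure \<Rightarrow> (point \<Rightarrow> real) \<Rightarrow> (point \<Rightarrow> real) \<Rightarrow> real" where
  "sg_inner2 \<mu> f g = (LINT x:SG|\<mu>. f x * g x)"

definition sg_norm2 :: "point measure \<Rightarrow> (point \<Rightarrow> real) \<Rightarrow> real" where
  "sg_norm2 \<mu> f = sqrt (sg_inner2 \<mu> f f)"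

definition sg_innerS ::
  "point measure \<Rightarrow> real \<Rightarrow> (point \<Rightarrow> real) \<Rightarrow> (point \<Rightarrow> real) \<Rightarrow> real" where
  "sg_innerS \<mu> chi f g =
     (LINT x:SG|\<mu>. f x * g x) + chi * (LINT x:SG|\<mu>. sg_laplacian \<mu> f x * sg_laplacian \<mu> g x)"

definition sg_normS :: "point measure \<Rightarrow> real \<Rightarrow> (point \<Rightarrow> real) \<Rightarrow> real" where
  "sg_normS \<mu> chi f = sqrt (sg_innerS \<mu> chi f f)"

text \<open>Gram-Schmidt without normalization.\<close>

fun gram_schmidt ::
  "(('a \<Rightarrow> real) \<Rightarrow> ('a \<Rightarrow> real) \<Rightarrow> real) \<Rightarrow> (nat \<Rightarrow> 'a \<Rightarrow> real) \<Rightarrow> nat \<Rightarrow> 'a \<Rightarrow> real" where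
  "gram_schmidt ip P n =
     (\<lambda>x. P n x - (\<Sum>i<n. ip (P n) (gram_schmidt ip P i)
                         / ip (gram_schmidt ip P i) (gram_schmidt ip P i)
                         * gram_schmidt ip P i x))"

declare gram_schmidt.simps [simp del]

definition sg_legendre :: "point measure \<Rightarrow> (nat \<Rightarrow> point \<Rightarrow> real) \<Rightarrow> nat \<Rightarrow> point \<Rightarrow> real" where
  "sg_legendre \<mu> P = gram_schmidt (sg_inner2 \<mu>) P"

definition sg_sobolev_legendre ::
  "point measure \<Rightarrow> real \<Rightarrow> (nat \<Rightarrow> point \<Rightarrow> real) \<Rightarrow> nat \<Rightarrow> point \<Rightarrow> real" where
  "sg_sobolev_legendre \<mu> chi P = gram_schmidt (sg_innerS \<mu> chi) P"

text \<open>Meaningful for \<open>n \<ge> 1\<close> only.\<close>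

definition sg_green_legendre ::
  "point measure \<Rightarrow> (point \<Rightarrow> point \<Rightarrow> real) \<Rightarrow> (nat \<Rightarrow> point \<Rightarrow> real) \<Rightarrow> nat \<Rightarrow> point \<Rightarrow> real" where
  "sg_green_legendre \<mu> G P n x = - (LINT y:SG|\<mu>. G x y * sg_legendre \<mu> P (n - 1) y)"

end

theory Submission
  imports Defs "HOL-Computational_Algebra.Polynomial"
begin

text \<open>
  Identify a real polynomial \<open>q\<close> with the function \<open>\<Sum>i. coeff q i * P i\<close>. The Laplacian then drops the
  constant coefficient and shifts the others down, and minus the Green operator \<open>G\<close> shifts them up
  and inserts a new constant coefficient: \<open>- G P\<^sub>j - P\<^sub>j\<^sub>+\<^sub>1\<close> is harmonic, vanishes
  at \<open>q\<^sub>0\<close> and has the parity of the family under the reflection that swaps \<open>q\<^sub>1\<close> and \<open>q\<^sub>2\<close>,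
  so it is a multiple of \<open>P\<^sub>0\<close>. The estimates follow by comparing the minimizers \<open>p n\<close> and \<open>s n\<close> of
  the two norms among monic polynomials with the competitor \<open>f n = - G (p (n - 1))\<close>. Uniformity in \<open>n\<close>
  of the last limit needs the norms of the \<open>p n\<close> to be bounded; this holds because \<open>G\<close> is a
  contraction of \<open>L\<^sup>2\<close>, by a Poincare inequality with constant 1.

  Uniqueness of the Laplacian, of the monomials and of harmonic functions with given Cauchy data at \<open>q\<^sub>0\<close>
  all reduce to explicit harmonic functions, constructed from the \<open>1/5\<close>--\<open>2/5\<close> rule.
\<close>

subsection \<open>Geometry of the gasket\<close>

text \<open>Both \<open>s n\<close> and its Laplacian are monic, so \<open>p n\<close> and
  \<open>p (n - 1)\<close> bound them from below, while the competitor \<open>f n\<close> bounds the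
  Sobolev norm of \<open>s n\<close> from above. This traps the squared Sobolev norm between
  \<open>chi\<close> and \<open>N\<^sup>2 + chi\<close> times the squared norm of
  \<open>p (n - 1)\<close>, and the limits are read off from this narrow gap. The first two are
  uniform because their errors are relative to norms that also stand in the denominators; the third
  is not normalized. The limits of \<open>chi * b chi n\<close> and \<open>chi * a chi n\<close>
  start at \<open>n = 2\<close> for a reason: \<open>s 0\<close> is harmonic, so its Sobolev norm
  does not grow with \<open>chi\<close> and \<open>b chi 1\<close> is constant in
  \<open>chi\<close>; and \<open>f 2\<close> is not orthogonal to \<open>P 0\<close>, their inner
  product being the squared norm of \<open>p 1\<close>. Two features shape the groundwork: only the
  masses of cells are known about \<mu>, so integrals are handled as limits of vertex averages; and
  the Laplacian is weak, so test functions have to be built by pasting harmonic pieces.\<close>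

lemma UNIV_3_from_0: "(UNIV :: 3 set) = {0, 1, 2}"
  using UNIV_3 by auto

lemma forall_3_from_0: "(\<forall>i::3. Q i) \<longleftrightarrow> Q 0 \<and> Q 1 \<and> Q 2"
  using UNIV_3_from_0 by (metis UNIV_I insertE singletonD)

lemma neq_3: "(0::3) \<noteq> 1" "(0::3) \<noteq> 2" "(1::3) \<noteq> 2" "(1::3) \<noteq> 0" "(2::3) \<noteq> 0" "(2::3) \<noteq> 1"
  by simp_all

lemma sum_3_from_0: "sum g (UNIV :: 3 set) = g 0 + g 1 + g 2" for g :: "3 \<Rightarrow> real"
  unfolding UNIV_3_from_0 by (simp add: neq_3)

lemma uminus_3: "- (1::3) = 2" "- (2::3) = 1"
  by simp_all

text \<open>Barycentric coordinates with respect to the three vertices. In them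
  \<open>sg_map i\<close> halves everything and adds 1/2 to coordinate \<open>i\<close>, so
  questions about cells become linear arithmetic without \<open>sqrt 3\<close>.\<close>

definition bary :: "3 \<Rightarrow> point \<Rightarrow> real" where
  "bary j x = (if j = 0 then 2 * x$2 / sqrt 3 else if j = 1 then 1 - x$1 - x$2 / sqrt 3
               else x$1 - x$2 / sqrt 3)"

lemma bary_sg_vertex: "bary j (sg_vertex i) = of_bool (i = j)"
proof -
  have "\<forall>i j. bary j (sg_vertex i) = of_bool (i = j)"
    unfolding forall_3_from_0 by (simp add: bary_def sg_vertex_def)
  then show ?thesis by blast
qed

lemma bary_sg_map: "bary j (sg_map i x) = bary j x / 2 + of_bool (i = j) / 2"
proof -
  have "\<forall>i j. bary j (sg_map i x) = bary j x / 2 + of_bool (i = j) / 2"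
    unfolding forall_3_from_0
    by (simp add: bary_def sg_map_def sg_vertex_def diff_divide_distrib add_divide_distrib)
  then show ?thesis by blast
qed

lemma bary_eqI:
  assumes "\<And>j. bary j x = bary j y" shows "x = y"
proof -
  have *: "x $ 2 = y $ 2" using assms[of 0] by (simp add: bary_def)
  then have "x $ 1 = y $ 1" using assms[of 1] by (simp add: bary_def)
  with * show ?thesis by (simp add: vec_eq_iff forall_2)
qed

lemma sum_bary: "bary 0 x + bary 1 x + bary 2 x = 1"
  by (simp add: bary_def)

lemma continuous_on_bary: "continuous_on S (bary j)"
proof -
  have "bary j = (if j = 0 then (\<lambda>x. 2 * x$2 / sqrt 3) else if j = 1 then (\<lambda>x. 1 - x$1 - x$2 / sqrt 3)
               else (\<lambda>x. x$1 - x$2 / sqrt 3))"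
    by (simp add: bary_def fun_eq_iff)
  moreover have "continuous_on S (\<lambda>x::point. 2 * x$2 / sqrt 3)"
    "continuous_on S (\<lambda>x::point. 1 - x$1 - x$2 / sqrt 3)"
    "continuous_on S (\<lambda>x::point. x$1 - x$2 / sqrt 3)"
    by (intro continuous_intros; simp)+
  ultimately show ?thesis by presburger
qed

lemma sg_vertex_inj: "sg_vertex i = sg_vertex j \<longleftrightarrow> i = j"
  by (metis bary_sg_vertex of_bool_eq_iff)

lemma sg_map_inj: "sg_map i x = sg_map i y \<longleftrightarrow> x = y"
  by (simp add: sg_map_def)

lemma sg_map_sg_vertex_self [simp]: "sg_map i (sg_vertex i) = sg_vertex i"
  by (simp add: sg_map_def)

lemma sg_map_sg_vertex_commute: "sg_map i (sg_vertex j) = sg_map j (sg_vertex i)"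
  by (rule bary_eqI) (simp add: bary_sg_map bary_sg_vertex)

lemma continuous_on_sg_map [continuous_intros]: "continuous_on S (sg_map i)"
  unfolding sg_map_def[abs_def] by (intro continuous_intros)

lemma dist_sg_map: "dist (sg_map i x) (sg_map i y) = dist x y / 2"
proof -
  have "sg_map i x - sg_map i y = (1/2) *\<^sub>R (x - y)"
    by (simp add: sg_map_def scaleR_diff_right)
  then show ?thesis by (simp add: dist_norm)
qed

lemma sg_word_simps [simp]: "sg_word [] x = x" "sg_word (i # w) x = sg_map i (sg_word w x)"
  by (simp_all add: sg_word_def)

lemma length_Suc_words: "{w. length w = Suc m} = (\<Union>i. (#) i ` {w. length w = m})"
  by (force simp: length_Suc_conv)

lemma sg_V_0 [simp]: "sg_V 0 = sg_V0"
  by (simp add: sg_V_def)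

lemma sg_V_Suc: "sg_V (Suc m) = (\<Union>i. sg_map i ` sg_V m)"
  unfolding sg_V_def length_Suc_words by (auto simp: image_UN image_image)

lemma sg_vertex_in_V: "sg_vertex i \<in> sg_V m"
proof (induction m)
  case (Suc m)
  then show ?case unfolding sg_V_Suc by (metis UNIV_I UN_I image_eqI sg_map_sg_vertex_self)
qed (simp add: sg_V0_def)

lemma finite_sg_V: "finite (sg_V m)"
  by (induction m) (auto simp: sg_V_Suc sg_V0_def)

lemma bary_nonneg_sg_V: "x \<in> sg_V m \<Longrightarrow> 0 \<le> bary j x"
  by (induction m arbitrary: x) (auto simp: sg_V_Suc sg_V0_def bary_sg_map bary_sg_vertex)

subsection \<open>The attractor\<close>

text \<open>Each point of \<open>K\<close> is an image of a point of \<open>K\<close>, and each map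
  halves distances while preserving \<open>L\<close>; so any bound for \<open>infdist x L\<close> on
  \<open>K\<close> can be halved again and again. Used in both directions this is uniqueness of the
  attractor, and later it gives the mirror symmetry of \<open>SG\<close>.\<close>

lemma gasket_subset:
  assumes K: "compact K" "K = (\<Union>i. sg_map i ` K)"
    and L: "compact L" "L \<noteq> {}" "L = (\<Union>i. sg_map i ` L)"
  shows "K \<subseteq> L"
proof
  obtain B where B: "infdist x L \<le> B" if "x \<in> K" for x
  proof -
    have "bounded ((\<lambda>x. infdist x L) ` K)"
      by (intro compact_imp_bounded compact_continuous_image continuous_intros K)
    then obtain B where "\<forall>x\<in>K. \<bar>infdist x L\<bar> \<le> B" by (auto simp: bounded_iff)
    then have "infdist x L \<le> B" if "x \<in> K" for x using that by force
    then show thesis by (rule that)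
  qed
  have *: "infdist x L \<le> B / 2 ^ n" if "x \<in> K" for x n
    using that
  proof (induction n arbitrary: x)
    case (Suc n)
    from K(2) Suc.prems obtain i y where y: "y \<in> K" "x = sg_map i y" by blast
    obtain z where z: "z \<in> L" "infdist y L = dist y z"
      using infdist_attains_inf[OF compact_imp_closed[OF L(1)] L(2)] by metis
    have "sg_map i z \<in> L" using z L(3) by blast
    then have "infdist x L \<le> dist x (sg_map i z)" by (rule infdist_le)
    also have "\<dots> = infdist y L / 2" by (simp add: y z dist_sg_map)
    also have "\<dots> \<le> B / 2 ^ n / 2" using Suc.IH[OF y(1)] by simp
    finally show ?case by simp
  qed (use B in simp)
  fix x assume x: "x \<in> K"
  have "(\<lambda>n. B * (1/2) ^ n) \<longlonglongrightarrow> B * 0"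
    by (intro tendsto_intros LIMSEQ_power_zero) simp
  then have "(\<lambda>n. B / 2 ^ n) \<longlonglongrightarrow> 0" by (simp add: field_simps power_one_over)
  then have "infdist x L \<le> 0"
    by (rule LIMSEQ_le_const) (use * x in blast)
  then show "x \<in> L"
    using in_closed_iff_infdist_zero[OF compact_imp_closed[OF L(1)] L(2)] infdist_nonneg[of x L]
    by simp
qed

lemma compact_bary_nonneg: "compact {x. \<forall>j. 0 \<le> bary j x}"
proof (rule compact_eq_bounded_closed[THEN iffD2], rule conjI)
  have "norm x \<le> 4" if "\<forall>j. 0 \<le> bary j x" for x
  proof -
    from that have b: "0 \<le> bary 0 x" "0 \<le> bary 1 x" "0 \<le> bary 2 x" by auto
    have y: "0 \<le> x$2" using b(1) by (simp add: bary_def zero_le_divide_iff)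
    have q: "0 \<le> x$2 / sqrt 3" using y by simp
    have x1: "0 \<le> x$1" "x$1 \<le> 1" "x$2 / sqrt 3 \<le> 1"
      using b q unfolding bary_def by (simp_all del: divide_le_eq_1_pos)
    have "sqrt 3 \<le> 2" by (rule real_le_lsqrt) auto
    with x1(3) have "x$2 \<le> 2" by (simp add: divide_le_eq)
    then have "\<bar>x$1\<bar> + \<bar>x$2\<bar> \<le> 4" using x1 y by simp
    moreover have "norm x \<le> (\<Sum>i\<in>UNIV. \<bar>x$i\<bar>)" by (rule norm_le_l1_cart)
    ultimately show ?thesis by (simp add: sum_2)
  qed
  then show "bounded {x. \<forall>j. 0 \<le> bary j x}" by (auto simp: bounded_iff)
  have "{x. \<forall>j. 0 \<le> bary j x} = (\<Inter>j. {x. 0 \<le> bary j x})" by auto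
  also have "closed \<dots>"
    by (intro closed_INT ballI closed_Collect_le continuous_on_bary continuous_intros)
  finally show "closed {x. \<forall>j. 0 \<le> bary j x}" .
qed

text \<open>The \<open>THE\<close> in the definition of \<open>SG\<close> becomes usable only once
  an invariant compact set is exhibited. The closure of all vertices is one: closure commutes with
  the maps, by compactness, and with the finite union.\<close>

lemma SG_eq_closure: "SG = closure (\<Union>m. sg_V m)"
  and SG_fixpoint: "SG = (\<Union>i. sg_map i ` SG)"
  and compact_SG: "compact SG"
  and SG_nonempty: "SG \<noteq> {}"
proof -
  define W where "W = (\<Union>m. sg_V m)"
  define K where "K = closure W"
  have "W \<subseteq> {x. \<forall>j. 0 \<le> bary j x}" by (auto simp: W_def bary_nonneg_sg_V)
  then have K1: "compact K"
    unfolding K_def compact_closure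
    by (rule bounded_subset[OF compact_imp_bounded[OF compact_bary_nonneg]])
  have ne: "K \<noteq> {}" using sg_vertex_in_V unfolding K_def W_def closure_eq_empty by blast
  \<comment> \<open>The maps reach only the levels from 1 on; level 0 is recovered because each
    vertex is a fixed point of its own map.\<close>
  have W: "W = (\<Union>i. sg_map i ` W)"
  proof -
    have "W = sg_V 0 \<union> (\<Union>m. sg_V (Suc m))" unfolding W_def
      by (auto simp del: sg_V_0) (metis not0_implies_Suc)
    also have "sg_V 0 \<subseteq> (\<Union>m. sg_V (Suc m))" using sg_vertex_in_V by (force simp: sg_V0_def)
    then have "sg_V 0 \<union> (\<Union>m. sg_V (Suc m)) = (\<Union>m. sg_V (Suc m))" by blast
    also have "\<dots> = (\<Union>i. sg_map i ` W)" unfolding W_def sg_V_Suc by blast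
    finally show ?thesis .
  qed
  have "sg_map i ` K = closure (sg_map i ` W)" for i
  proof
    show "sg_map i ` K \<subseteq> closure (sg_map i ` W)" unfolding K_def
      by (rule image_closure_subset) (auto intro: continuous_intros closure_subset[THEN subsetD])
    have "closed (sg_map i ` K)"
      by (intro compact_imp_closed compact_continuous_image K1 continuous_intros)
    then show "closure (sg_map i ` W) \<subseteq> sg_map i ` K"
      by (intro closure_minimal image_mono) (auto simp: K_def closure_subset)
  qed
  moreover have "K = closure (\<Union>i. sg_map i ` W)" using W K_def by metis
  then have "K = (\<Union>i. closure (sg_map i ` W))" unfolding UNIV_3_from_0 by simp
  ultimately have K2: "K = (\<Union>i. sg_map i ` K)" by simp
  have "SG = K" unfolding SG_def
  proof (rule the_equality)
    fix L assume "L \<noteq> {} \<and> compact L \<and> L = (\<Union>i. sg_map i ` L)"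
    then show "L = K" using gasket_subset K1 K2 ne by (metis subset_antisym)
  qed (use ne K1 K2 in blast)
  then show "SG = closure (\<Union>m. sg_V m)" "SG = (\<Union>i. sg_map i ` SG)" "compact SG" "SG \<noteq> {}"
    using K1 K2 ne by (simp_all add: K_def W_def)
qed

lemma sg_map_in_SG [intro]: "x \<in> SG \<Longrightarrow> sg_map i x \<in> SG"
  by (subst SG_fixpoint) blast

lemma sg_V_subset_SG: "sg_V m \<subseteq> SG"
  unfolding SG_eq_closure by (rule order_trans[OF _ closure_subset]) blast

lemma sg_vertex_in_SG [simp, intro]: "sg_vertex i \<in> SG"
  using sg_vertex_in_V sg_V_subset_SG by (rule subsetD[rotated])

lemma sg_word_in_SG: "x \<in> SG \<Longrightarrow> sg_word w x \<in> SG"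
  by (induction w) auto

lemma bary_nonneg_SG: "x \<in> SG \<Longrightarrow> 0 \<le> bary j x"
proof -
  have "closure (\<Union>m. sg_V m) \<subseteq> {x. \<forall>j. 0 \<le> bary j x}"
    by (intro closure_minimal compact_imp_closed compact_bary_nonneg) (auto simp: bary_nonneg_sg_V)
  then show "x \<in> SG \<Longrightarrow> 0 \<le> bary j x" by (auto simp: SG_eq_closure)
qed

lemma bary_add_le_1:
  assumes "x \<in> SG" "j \<noteq> k" shows "bary j x + bary k x \<le> 1"
proof -
  have "bary j x + bary k x = (\<Sum>l\<in>{j, k}. bary l x)" using assms(2) by simp
  also have "\<dots> \<le> (\<Sum>l\<in>UNIV. bary l x)" using assms(1) by (intro sum_mono2) (auto simp: bary_nonneg_SG)
  also have "\<dots> = 1" using sum_bary by (simp add: sum_3_from_0)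
  finally show ?thesis .
qed

text \<open>Coordinate \<open>j\<close> of \<open>sg_map j y\<close> is at least 1/2, while that of
  \<open>sg_map i x\<close> is half of \<open>bary j x\<close>. So \<open>bary j x\<close> has to
  reach 1: two cells meet in a single junction point.\<close>

lemma sg_map_eq_imp:
  assumes "x \<in> SG" "y \<in> SG" "sg_map i x = sg_map j y" "i \<noteq> j"
  shows "x = sg_vertex j"
proof (rule bary_eqI)
  have "bary j x \<ge> 1"
    using arg_cong[OF assms(3), of "bary j"] bary_nonneg_SG[OF assms(2), of j] assms(4)
    by (simp add: bary_sg_map)
  then have *: "bary k x = 0" if "k \<noteq> j" for k
    using bary_add_le_1[OF assms(1), of j k] bary_nonneg_SG[OF assms(1), of k] that by force
  have "(\<Sum>k\<in>UNIV. bary k x) = 1" using sum_bary by (simp add: sum_3_from_0)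
  moreover have "(\<Sum>k\<in>UNIV. bary k x) = (\<Sum>k\<in>{j}. bary k x)"
    by (rule sum.mono_neutral_right) (use * in auto)
  ultimately have "bary j x = 1" by simp
  with * show "bary k x = bary k (sg_vertex j)" for k
    by (cases "j = k") (auto simp: bary_sg_vertex)
qed

text \<open>A vertex seen in cell \<open>i\<close> may have been generated from another cell
  \<open>j\<close>. Then it is a junction point, and its preimage is an original vertex, which
  belongs to every level.\<close>

lemma sg_V_Suc_Int_cell:
  assumes "x \<in> SG" "sg_map i x \<in> sg_V (Suc m)" shows "x \<in> sg_V m"
proof -
  from assms(2) obtain j y where y: "y \<in> sg_V m" "sg_map i x = sg_map j y"
    by (auto simp: sg_V_Suc)
  show ?thesis
  proof (cases "i = j")
    case True
    then show ?thesis using y by (simp add: sg_map_inj)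
  next
    case False
    then have "x = sg_vertex j" using sg_map_eq_imp assms(1) y sg_V_subset_SG by blast
    then show ?thesis by (simp add: sg_vertex_in_V)
  qed
qed

lemma sg_cell_simps: "sg_cell [] = SG" "sg_cell (i # w) = sg_map i ` sg_cell w"
  by (simp_all add: sg_cell_def image_image)

lemma sg_cell_subset_SG: "sg_cell w \<subseteq> SG"
  by (auto simp: sg_cell_def sg_word_in_SG)

lemma sg_adj_0: "sg_adj 0 x y \<longleftrightarrow> x \<in> sg_V0 \<and> y \<in> sg_V0 \<and> x \<noteq> y"
  by (auto simp: sg_adj_def sg_cell_simps sg_V0_def)

lemma sg_adj_Suc:
  "sg_adj (Suc m) x y \<longleftrightarrow> (\<exists>i x' y'. x = sg_map i x' \<and> y = sg_map i y' \<and> sg_adj m x' y')"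
proof
  assume "sg_adj (Suc m) x y"
  then obtain w where w: "length w = Suc m" "x \<in> sg_cell w" "y \<in> sg_cell w"
    and xy: "x \<in> sg_V (Suc m)" "y \<in> sg_V (Suc m)" "x \<noteq> y" by (auto simp: sg_adj_def)
  then obtain i w' where i: "w = i # w'" "length w' = m" by (auto simp: length_Suc_conv)
  with w obtain x' y' where x': "x = sg_map i x'" "x' \<in> sg_cell w'"
    and y': "y = sg_map i y'" "y' \<in> sg_cell w'" by (auto simp: sg_cell_simps)
  have "x' \<in> sg_V m" "y' \<in> sg_V m"
    using x' y' xy sg_V_Suc_Int_cell sg_cell_subset_SG by blast+
  with x' y' xy i show "\<exists>i x' y'. x = sg_map i x' \<and> y = sg_map i y' \<and> sg_adj m x' y'"
    by (auto simp: sg_adj_def)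
next
  assume "\<exists>i x' y'. x = sg_map i x' \<and> y = sg_map i y' \<and> sg_adj m x' y'"
  then obtain i x' y' w where *: "x = sg_map i x'" "y = sg_map i y'" "x' \<in> sg_V m" "y' \<in> sg_V m"
    "x' \<noteq> y'" "length w = m" "x' \<in> sg_cell w" "y' \<in> sg_cell w"
    by (auto simp: sg_adj_def)
  then have "x \<in> sg_cell (i # w)" "y \<in> sg_cell (i # w)" "length (i # w) = Suc m"
    by (auto simp: sg_cell_simps)
  then have "\<exists>w. length w = Suc m \<and> x \<in> sg_cell w \<and> y \<in> sg_cell w" by blast
  moreover have "x \<in> sg_V (Suc m)" "y \<in> sg_V (Suc m)" "x \<noteq> y"
    using * by (auto simp: sg_V_Suc sg_map_inj)
  ultimately show "sg_adj (Suc m) x y" unfolding sg_adj_def by blast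
qed

lemma finite_sg_adj: "finite {(x, y). sg_adj m x y}"
  by (rule finite_subset[of _ "sg_V m \<times> sg_V m"]) (auto simp: sg_adj_def finite_sg_V)

lemma sg_energy_level_0:
  "sg_energy_level 0 u v =
     (u (sg_vertex 0) - u (sg_vertex 1)) * (v (sg_vertex 0) - v (sg_vertex 1)) +
     (u (sg_vertex 0) - u (sg_vertex 2)) * (v (sg_vertex 0) - v (sg_vertex 2)) +
     (u (sg_vertex 1) - u (sg_vertex 2)) * (v (sg_vertex 1) - v (sg_vertex 2))"
proof -
  let ?q = sg_vertex
  have "{(x, y). sg_adj 0 x y} = {(?q 0, ?q 1), (?q 1, ?q 0), (?q 0, ?q 2), (?q 2, ?q 0),
      (?q 1, ?q 2), (?q 2, ?q 1)}"
    unfolding sg_adj_0 sg_V0_def UNIV_3_from_0 image_insert image_empty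
    using sg_vertex_inj neq_3 by blast
  then show ?thesis
    unfolding sg_energy_level_def by (simp add: sg_vertex_inj field_simps)
qed

text \<open>Every edge lies in exactly one of the three cells, since its ends are distinct and two
  cells share at most one point. The factor is the ratio of the weights
  \<open>inverse ((3/5) ^ m)\<close> of consecutive levels.\<close>

lemma sg_energy_level_Suc:
  "sg_energy_level (Suc m) u v =
     5/3 * (\<Sum>i\<in>UNIV. sg_energy_level m (u \<circ> sg_map i) (v \<circ> sg_map i))"
proof -
  let ?A = "{(x, y). sg_adj m x y}"
  let ?g = "\<lambda>(x, y). (u x - u y) * (v x - v y)"
  have eq: "{(x, y). sg_adj (Suc m) x y} = (\<Union>i. map_prod (sg_map i) (sg_map i) ` ?A)"
    by (auto simp: sg_adj_Suc)
  have disj: "map_prod (sg_map i) (sg_map i) ` ?A \<inter> map_prod (sg_map j) (sg_map j) ` ?A = {}"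
    if "i \<noteq> j" for i j
  proof -
    have False if "sg_map i x = sg_map j x'" "sg_map i y = sg_map j y'" "sg_adj m x y" "sg_adj m x' y'"
      for x y x' y'
    proof -
      have "x \<in> SG" "y \<in> SG" "x' \<in> SG" "y' \<in> SG" "x \<noteq> y"
        using that sg_V_subset_SG by (auto simp: sg_adj_def)
      then show False using sg_map_eq_imp that(1,2) \<open>i \<noteq> j\<close> by blast
    qed
    then show ?thesis by auto
  qed
  have inj: "inj_on (map_prod (sg_map i) (sg_map i)) ?A" for i
    by (auto simp: inj_on_def sg_map_inj)
  have "(\<Sum>z\<in>{(x, y). sg_adj (Suc m) x y}. ?g z) =
     (\<Sum>i\<in>UNIV. \<Sum>z\<in>map_prod (sg_map i) (sg_map i) ` ?A. ?g z)"
    unfolding eq by (rule sum.UNION_disjoint) (auto simp: finite_sg_adj disj)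
  also have "\<dots> = (\<Sum>i\<in>UNIV. \<Sum>(x, y)\<in>?A. ((u \<circ> sg_map i) x - (u \<circ> sg_map i) y) *
      ((v \<circ> sg_map i) x - (v \<circ> sg_map i) y))"
    by (rule sum.cong[OF refl], subst sum.reindex[OF inj])
      (auto intro!: sum.cong simp: case_prod_beta)
  finally show ?thesis
    unfolding sg_energy_level_def
    by (simp add: sum_distrib_left sum_divide_distrib field_simps)
qed

section \<open>Overlap and diameter of cells\<close>

lemma sg_cells_Int:
  assumes "length w = length w'" "w \<noteq> w'"
  shows "\<exists>p. sg_cell w \<inter> sg_cell w' \<subseteq> {p}"
  using assms
proof (induction w w' rule: list_induct2)
  case (Cons i w j w')
  show ?case
  proof (cases "i = j")
    case True
    with Cons obtain p where "sg_cell w \<inter> sg_cell w' \<subseteq> {p}" by auto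
    then have "sg_cell (i # w) \<inter> sg_cell (j # w') \<subseteq> {sg_map i p}"
      using True by (auto simp: sg_cell_simps sg_map_inj)
    then show ?thesis by blast
  next
    case False
    have "sg_cell (i # w) \<inter> sg_cell (j # w') \<subseteq> {sg_map i (sg_vertex j)}"
    proof
      fix z assume z: "z \<in> sg_cell (i # w) \<inter> sg_cell (j # w')"
      then obtain x y where "x \<in> sg_cell w" "y \<in> sg_cell w'" "z = sg_map i x" "z = sg_map j y"
        by (auto simp: sg_cell_simps)
      then show "z \<in> {sg_map i (sg_vertex j)}"
        using False sg_map_eq_imp[of x y i j] sg_cell_subset_SG by auto
    qed
    then show ?thesis by blast
  qed
qed simp

lemma SG_eq_UN_cells: "SG = (\<Union>w\<in>{w. length w = m}. sg_cell w)"
proof (induction m)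
  case (Suc m)
  have "(\<Union>w\<in>{w. length w = Suc m}. sg_cell w) = (\<Union>i. sg_map i ` (\<Union>w\<in>{w. length w = m}. sg_cell w))"
    unfolding length_Suc_words by (auto simp: sg_cell_simps)
  also have "\<dots> = SG" using SG_fixpoint Suc.IH by metis
  finally show ?case ..
qed (simp add: sg_cell_simps)

lemma dist_sg_word: "dist (sg_word w x) (sg_word w y) = dist x y / 2 ^ length w"
  by (induction w) (auto simp: dist_sg_map)

lemma small_cells:
  assumes "e > 0"
  obtains m0 where "\<And>w x y. m0 \<le> length w \<Longrightarrow> x \<in> sg_cell w \<Longrightarrow> y \<in> sg_cell w \<Longrightarrow> dist x y < e"
proof -
  obtain B where B: "B > 0" "\<And>x y. x \<in> SG \<Longrightarrow> y \<in> SG \<Longrightarrow> dist x y < B"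
  proof -
    obtain C where C: "\<And>x y. x \<in> SG \<Longrightarrow> y \<in> SG \<Longrightarrow> dist x y \<le> C"
      using compact_imp_bounded[OF compact_SG] bounded_two_points by metis
    show thesis by (rule that[of "\<bar>C\<bar> + 1"]) (auto dest: C)
  qed
  obtain m0 where m0: "B / e < 2 ^ m0" using real_arch_pow[of 2 "B/e"] by auto
  show thesis
  proof (rule that[of m0])
    fix w x y assume w: "m0 \<le> length w" "x \<in> sg_cell w" "y \<in> sg_cell w"
    then obtain x' y' where "x' \<in> SG" "y' \<in> SG" "x = sg_word w x'" "y = sg_word w y'"
      by (auto simp: sg_cell_def)
    then have "dist x y < B / 2 ^ length w" using B by (simp add: dist_sg_word divide_strict_right_mono)
    also have "\<dots> \<le> B / 2 ^ m0" using B w by (intro divide_left_mono power_increasing) auto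
    also have "\<dots> < e" using m0 assms by (simp add: field_simps)
    finally show "dist x y < e" .
  qed
qed

subsection \<open>Pasting functions along the three cells\<close>

text \<open>The argument passed to \<open>\<phi> i\<close> undoes \<open>sg_map i\<close>. At a
  junction point two cells compete for \<open>SOME\<close>; the choice is immaterial when
  \<open>\<phi> i (sg_vertex j) = \<phi> j (sg_vertex i)\<close>, the condition carried by the
  lemmas below.\<close>

definition glue :: "(3 \<Rightarrow> point \<Rightarrow> real) \<Rightarrow> point \<Rightarrow> real" where
  "glue \<phi> x = (let i = SOME i. x \<in> sg_map i ` SG in \<phi> i (2 *\<^sub>R x - sg_vertex i))"

lemma sg_map_left_inverse: "2 *\<^sub>R sg_map i x - sg_vertex i = x"
  by (simp add: sg_map_def scaleR_diff_right scaleR_2)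

lemma glue_sg_map:
  assumes "\<And>i j. \<phi> i (sg_vertex j) = \<phi> j (sg_vertex i)" "x \<in> SG"
  shows "glue \<phi> (sg_map i x) = \<phi> i x"
proof -
  define j where "j = (SOME j. sg_map i x \<in> sg_map j ` SG)"
  have "sg_map i x \<in> sg_map j ` SG"
    unfolding j_def by (rule someI[of _ i]) (use assms(2) in blast)
  then obtain y where y: "y \<in> SG" "sg_map i x = sg_map j y" by blast
  have "glue \<phi> (sg_map i x) = \<phi> j (2 *\<^sub>R sg_map i x - sg_vertex j)"
    by (simp add: glue_def j_def)
  also have "\<dots> = \<phi> j y" by (simp add: y(2) sg_map_left_inverse)
  also have "\<dots> = \<phi> i x"
  proof (cases "i = j")
    case True
    then show ?thesis using y(2) sg_map_inj by metis
  next
    case False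
    then have "x = sg_vertex j" "y = sg_vertex i"
      using sg_map_eq_imp[OF assms(2) y(1) y(2)] sg_map_eq_imp[OF y(1) assms(2) y(2)[symmetric]]
      by auto
    then show ?thesis using assms(1) by simp
  qed
  finally show ?thesis .
qed

lemma SG_cases [consumes 1]:
  assumes "x \<in> SG" obtains i y where "y \<in> SG" "x = sg_map i y"
proof -
  have "x \<in> (\<Union>i. sg_map i ` SG)" using assms SG_fixpoint by metis
  then show thesis using that by blast
qed

lemma continuous_on_glue:
  assumes "\<And>i j. \<phi> i (sg_vertex j) = \<phi> j (sg_vertex i)" "\<And>i. continuous_on SG (\<phi> i)"
  shows "continuous_on SG (glue \<phi>)"
proof -
  have "continuous_on (sg_map i ` SG) (glue \<phi>)" for i
  proof -
    have "continuous_on (sg_map i ` SG) (\<lambda>x. \<phi> i (2 *\<^sub>R x - sg_vertex i))"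
      by (rule continuous_on_compose2[OF assms(2)])
        (auto intro!: continuous_intros simp: sg_map_left_inverse)
    then show ?thesis
      by (rule continuous_on_eq) (auto simp: glue_sg_map[of \<phi>, OF assms(1)] sg_map_left_inverse)
  qed
  then have "continuous_on (\<Union>i. sg_map i ` SG) (glue \<phi>)"
    by (intro continuous_on_closed_Union)
      (auto intro!: compact_imp_closed compact_continuous_image continuous_intros compact_SG)
  then show ?thesis using SG_fixpoint by metis
qed

subsection \<open>Harmonic functions\<close>

text \<open>The \<open>1/5\<close>--\<open>2/5\<close> rule: boundary values on the cell \<open>i\<close> of the harmonic function with
  boundary values \<open>a\<close>.\<close>

definition harm_step :: "(3 \<Rightarrow> real) \<Rightarrow> 3 \<Rightarrow> 3 \<Rightarrow> real" where
  "harm_step a i j = (if j = i then a i else (a i + a j + (a 0 + a 1 + a 2)) / 5)"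

text \<open>Level \<open>n\<close> carries the harmonic values on the vertices of level
  \<open>n\<close> and interpolates them affinely in each cell. The recursion splits off the
  outermost map, which fits \<open>glue\<close> and the self-similar energy.\<close>

fun harm_approx :: "nat \<Rightarrow> (3 \<Rightarrow> real) \<Rightarrow> point \<Rightarrow> real" where
  "harm_approx 0 a = (\<lambda>x. \<Sum>i\<in>UNIV. a i * bary i x)"
| "harm_approx (Suc n) a = glue (\<lambda>i. harm_approx n (harm_step a i))"

lemma harm_step_commute: "harm_step a i j = harm_step a j i"
  by (simp add: harm_step_def add.commute)

lemma harm_approx_vertex: "harm_approx n a (sg_vertex j) = a j"
proof (induction n arbitrary: a j)
  case 0
  show ?case by (simp add: bary_sg_vertex of_bool_def if_distrib cong: if_cong)
next
  case (Suc n)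
  have "harm_approx (Suc n) a (sg_map j (sg_vertex j)) = harm_approx n (harm_step a j) (sg_vertex j)"
    unfolding harm_approx.simps by (rule glue_sg_map) (auto simp: Suc harm_step_commute)
  then show ?case by (simp add: Suc harm_step_def)
qed

lemma harm_approx_sg_map:
  "x \<in> SG \<Longrightarrow> harm_approx (Suc n) a (sg_map i x) = harm_approx n (harm_step a i) x"
  unfolding harm_approx.simps by (rule glue_sg_map) (auto simp: harm_approx_vertex harm_step_commute)

lemma continuous_on_harm_approx: "continuous_on SG (harm_approx n a)"
proof (induction n arbitrary: a)
  case 0
  show ?case by (auto intro!: continuous_intros continuous_on_bary)
next
  case (Suc n)
  show ?case unfolding harm_approx.simps
    by (rule continuous_on_glue) (auto simp: Suc harm_approx_vertex harm_step_commute)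
qed

text \<open>With \<open>l\<close> the third index, \<open>a i\<close> differs from the new value at
  \<open>k\<close> by \<open>(2 * (a i - a k) + (a i - a l)) / 5\<close>, and the two new values
  differ by a fifth of the old difference. This decay of the oscillation drives the geometric
  convergence below.\<close>

lemma harm_step_diff:
  assumes "\<And>j k. a j - a k \<le> d"
  shows "harm_step a i j - harm_step a i k \<le> d * (3/5)"
proof -
  have d: "0 \<le> d" using assms[of 0 0] by simp
  have "\<forall>i j k. harm_step a i j - harm_step a i k \<le> d * (3/5)"
    unfolding forall_3_from_0 harm_step_def
    using assms[of 0 1] assms[of 0 2] assms[of 1 0] assms[of 1 2] assms[of 2 0] assms[of 2 1] d
    by (simp add: field_simps)
  then show ?thesis by blast
qed

text \<open>Levels 0 and 1 are both affine on a cell of level 1, and at its vertices the midpoint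
  rule and the \<open>1/5\<close>--\<open>2/5\<close> rule differ by at most \<open>d\<close>. Each
  further level repeats this inside a cell whose oscillation has shrunk by 3/5.\<close>

lemma harm_approx_diff:
  assumes "\<And>j k. a j - a k \<le> d" "x \<in> SG"
  shows "\<bar>harm_approx (Suc n) a x - harm_approx n a x\<bar> \<le> d * (3/5) ^ n"
  using assms
proof (induction n arbitrary: a d x)
  case (0 a d x)
  from \<open>x \<in> SG\<close> obtain i y where y: "y \<in> SG" "x = sg_map i y" by (rule SG_cases)
  have d: "0 \<le> d" using 0(1)[of 0 0] by simp
  have "harm_approx (Suc 0) a x = (\<Sum>j\<in>UNIV. harm_step a i j * bary j y)"
    unfolding y(2) by (subst harm_approx_sg_map) (auto simp: y)
  moreover have "harm_approx 0 a x = (\<Sum>j\<in>UNIV. (a i + a j) / 2 * bary j y)"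
  proof -
    have "harm_approx 0 a x = (\<Sum>j\<in>UNIV. a j * bary j y / 2) + (\<Sum>j\<in>UNIV. a j * of_bool (i = j)) / 2"
      by (simp add: y bary_sg_map sum.distrib distrib_left flip: sum_divide_distrib)
    also have "(\<Sum>j\<in>UNIV. a j * of_bool (i = j)) = a i"
      by (simp add: of_bool_def if_distrib cong: if_cong)
    also have "a i / 2 = (\<Sum>j\<in>UNIV. a i / 2 * bary j y)"
      using sum_bary[of y] by (simp add: sum_3_from_0 flip: distrib_left)
    finally show ?thesis
      unfolding sum.distrib[symmetric] by (simp add: add_divide_distrib distrib_right add.commute)
  qed
  ultimately have "harm_approx (Suc 0) a x - harm_approx 0 a x =
      (\<Sum>j\<in>UNIV. (harm_step a i j - (a i + a j) / 2) * bary j y)"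
    by (simp add: sum_subtractf left_diff_distrib)
  also have "\<bar>\<dots>\<bar> \<le> (\<Sum>j\<in>UNIV. d * bary j y)"
  proof (rule order_trans[OF sum_abs sum_mono])
    fix j
    have "\<forall>i j. \<bar>harm_step a i j - (a i + a j) / 2\<bar> \<le> d"
      unfolding forall_3_from_0 harm_step_def
      using 0(1)[of 0 1] 0(1)[of 0 2] 0(1)[of 1 0] 0(1)[of 1 2] 0(1)[of 2 0] 0(1)[of 2 1] d
      by (simp add: abs_le_iff field_simps)
    then show "\<bar>(harm_step a i j - (a i + a j) / 2) * bary j y\<bar> \<le> d * bary j y"
      using bary_nonneg_SG[OF y(1)] by (simp add: abs_mult mult_right_mono)
  qed
  also have "\<dots> = d" using sum_bary[of y] by (simp add: sum_3_from_0 flip: distrib_left)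
  finally show ?case by simp
next
  case (Suc n a d x)
  from \<open>x \<in> SG\<close> obtain i y where y: "y \<in> SG" "x = sg_map i y" by (rule SG_cases)
  show ?case
    unfolding y(2) harm_approx_sg_map[OF y(1)]
    using Suc.IH[OF harm_step_diff[where i = i, OF Suc.prems(1)] y(1)] by (simp add: mult.assoc)
qed

text \<open>The limit of \<open>harm_approx n a\<close>, written as a telescoping series so that the
  M-test yields uniform convergence.\<close>

definition sg_harm :: "(3 \<Rightarrow> real) \<Rightarrow> point \<Rightarrow> real" where
  "sg_harm a x = harm_approx 0 a x + (\<Sum>n. harm_approx (Suc n) a x - harm_approx n a x)"

lemma uniform_limit_harm: "uniform_limit SG (\<lambda>n. harm_approx n a) (sg_harm a) sequentially"
proof -
  define d where "d = \<bar>a 0\<bar> + \<bar>a 1\<bar> + \<bar>a 2\<bar>"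
  have "\<forall>j k. a j - a k \<le> d" unfolding d_def forall_3_from_0 by auto
  then have "uniform_limit SG (\<lambda>n x. \<Sum>k<n. harm_approx (Suc k) a x - harm_approx k a x)
      (\<lambda>x. \<Sum>k. harm_approx (Suc k) a x - harm_approx k a x) sequentially"
    by (intro Weierstrass_m_test[where M = "\<lambda>n. d * (3/5) ^ n"] summable_mult summable_geometric)
      (use harm_approx_diff in auto)
  moreover have "(\<Sum>k<n. harm_approx (Suc k) a x - harm_approx k a x) =
      harm_approx n a x - harm_approx 0 a x" for n x by (rule sum_lessThan_telescope)
  ultimately have "uniform_limit SG (\<lambda>n x. harm_approx n a x - harm_approx 0 a x)
      (\<lambda>x. \<Sum>k. harm_approx (Suc k) a x - harm_approx k a x) sequentially" by simp
  then show ?thesis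
    unfolding uniform_limit_iff sg_harm_def by (simp add: dist_real_def algebra_simps)
qed

lemma continuous_on_harm: "continuous_on SG (sg_harm a)"
  by (rule uniform_limit_theorem[OF _ uniform_limit_harm]) (auto simp: continuous_on_harm_approx)

lemma harm_approx_tendsto: "x \<in> SG \<Longrightarrow> (\<lambda>n. harm_approx n a x) \<longlonglongrightarrow> sg_harm a x"
  by (rule tendsto_uniform_limitI[OF uniform_limit_harm])

lemma harm_vertex [simp]: "sg_harm a (sg_vertex j) = a j"
  using harm_approx_tendsto[of "sg_vertex j" a] by (simp add: harm_approx_vertex LIMSEQ_const_iff)

lemma harm_sg_map:
  assumes "x \<in> SG" shows "sg_harm a (sg_map i x) = sg_harm (harm_step a i) x"
proof (rule LIMSEQ_unique)
  show "(\<lambda>n. harm_approx (Suc n) a (sg_map i x)) \<longlonglongrightarrow> sg_harm a (sg_map i x)"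
    using assms by (intro LIMSEQ_Suc harm_approx_tendsto) auto
  show "(\<lambda>n. harm_approx (Suc n) a (sg_map i x)) \<longlonglongrightarrow> sg_harm (harm_step a i) x"
    unfolding harm_approx_sg_map[OF assms] using assms by (rule harm_approx_tendsto)
qed

subsection \<open>The energy form\<close>

lemma sg_energy_level_cong:
  assumes "\<And>x. x \<in> SG \<Longrightarrow> u x = u' x" "\<And>x. x \<in> SG \<Longrightarrow> v x = v' x"
  shows "sg_energy_level m u v = sg_energy_level m u' v'"
proof -
  have "x \<in> SG" "y \<in> SG" if "sg_adj m x y" for x y
    using that sg_V_subset_SG by (auto simp: sg_adj_def)
  then show ?thesis
    unfolding sg_energy_level_def using assms by (auto intro!: sum.cong)
qed

lemma sg_energy_level_add:
  "sg_energy_level m (\<lambda>x. u x + w x) v = sg_energy_level m u v + sg_energy_level m w v"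
  by (simp add: sg_energy_level_def case_prod_unfold algebra_simps sum.distrib sum_subtractf add_divide_distrib diff_divide_distrib)

lemma sg_energy_level_scale: "sg_energy_level m (\<lambda>x. c * u x) v = c * sg_energy_level m u v"
proof -
  have "(\<Sum>(x, y)\<in>{(x, y). sg_adj m x y}. (c * u x - c * u y) * (v x - v y)) =
     c * (\<Sum>(x, y)\<in>{(x, y). sg_adj m x y}. (u x - u y) * (v x - v y))"
    by (simp add: sum_distrib_left case_prod_unfold algebra_simps)
  then show ?thesis by (simp add: sg_energy_level_def)
qed

lemma sg_energy_level_commute: "sg_energy_level m u v = sg_energy_level m v u"
  by (simp add: sg_energy_level_def mult.commute)

lemma sg_energy_level_nonneg: "0 \<le> sg_energy_level m u u"
  unfolding sg_energy_level_def by (intro mult_nonneg_nonneg divide_nonneg_nonneg sum_nonneg) auto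

lemma sg_energy_level_glue:
  assumes "\<And>i j. \<phi> i (sg_vertex j) = \<phi> j (sg_vertex i)"
    "\<And>i j. \<psi> i (sg_vertex j) = \<psi> j (sg_vertex i)"
  shows "sg_energy_level (Suc m) (glue \<phi>) (glue \<psi>) = 5/3 * (\<Sum>i\<in>UNIV. sg_energy_level m (\<phi> i) (\<psi> i))"
  unfolding sg_energy_level_Suc
  by (intro arg_cong[where f = "\<lambda>t. 5/3 * t"] sum.cong refl sg_energy_level_cong)
    (auto simp: glue_sg_map[of \<phi>, OF assms(1)] glue_sg_map[of \<psi>, OF assms(2)])

text \<open>The \<open>1/5\<close>--\<open>2/5\<close> rule makes the graph Laplacian of level 1
  vanish at the junction points, so only the values of \<open>v\<close> on \<open>sg_V0\<close>
  survive; their coefficients shrink by 3/5, which the factor 5/3 compensates. Higher levels follow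
  cell by cell.\<close>

lemma sg_energy_level_harm: "sg_energy_level (Suc m) (sg_harm a) v = sg_energy_level m (sg_harm a) v"
proof (induction m arbitrary: a v)
  case 0
  have "sg_energy_level (Suc 0) (sg_harm a) v =
      5/3 * (\<Sum>i\<in>UNIV. sg_energy_level 0 (sg_harm (harm_step a i)) (v \<circ> sg_map i))"
    unfolding sg_energy_level_Suc
    by (intro arg_cong[where f = "\<lambda>t. 5/3 * t"] sum.cong refl sg_energy_level_cong)
      (auto simp: harm_sg_map)
  also have "\<dots> = sg_energy_level 0 (sg_harm a) v"
    unfolding sg_energy_level_0 sum_3_from_0
    by (simp add: harm_step_def sg_map_sg_vertex_commute[of 1 0] sg_map_sg_vertex_commute[of 2 0]
        sg_map_sg_vertex_commute[of 2 1] field_simps)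
  finally show ?case .
next
  case (Suc m)
  have *: "sg_energy_level k (sg_harm a \<circ> sg_map i) w = sg_energy_level k (sg_harm (harm_step a i)) w"
    for k i and w :: "point \<Rightarrow> real"
    by (rule sg_energy_level_cong) (auto simp: harm_sg_map)
  have "sg_energy_level (Suc (Suc m)) (sg_harm a) v =
      5/3 * (\<Sum>i\<in>UNIV. sg_energy_level (Suc m) (sg_harm (harm_step a i)) (v \<circ> sg_map i))"
    by (simp only: sg_energy_level_Suc[of "Suc m"] *)
  also have "\<dots> = 5/3 * (\<Sum>i\<in>UNIV. sg_energy_level m (sg_harm (harm_step a i)) (v \<circ> sg_map i))"
    by (simp only: Suc.IH)
  also have "\<dots> = sg_energy_level (Suc m) (sg_harm a) v"
    by (simp only: sg_energy_level_Suc[of m] *)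
  finally show ?case .
qed

lemma sg_energy_level_harm_eq:
  "sg_energy_level m (sg_harm a) v = sg_energy_level 0 (sg_harm a) v"
  by (induction m) (auto simp: sg_energy_level_harm)

lemma sg_energy_level_diff_self:
  "sg_energy_level m (\<lambda>x. u x - w x) (\<lambda>x. u x - w x) =
     sg_energy_level m u u - 2 * sg_energy_level m w u + sg_energy_level m w w"
proof -
  have diff: "sg_energy_level m (\<lambda>x. u x - w x) v = sg_energy_level m u v - sg_energy_level m w v" for v
    using sg_energy_level_add[of m u "\<lambda>x. - 1 * w x" v] sg_energy_level_scale[of m "-1" w v] by simp
  show ?thesis
    using diff[of u] diff[of w] diff[of "\<lambda>x. u x - w x"]
      sg_energy_level_commute[of m u "\<lambda>x. u x - w x"] sg_energy_level_commute[of m w "\<lambda>x. u x - w x"]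
      sg_energy_level_commute[of m u w]
    by simp
qed

text \<open>The harmonic function with the same boundary values minimizes the energy.\<close>

lemma sg_energy_level_mono_Suc: "sg_energy_level m u u \<le> sg_energy_level (Suc m) u u"
proof (induction m arbitrary: u)
  case 0
  define h where "h = sg_harm (\<lambda>j. u (sg_vertex j))"
  have "sg_energy_level 0 h u = sg_energy_level 0 u u" "sg_energy_level 0 h h = sg_energy_level 0 u u"
    by (simp_all add: sg_energy_level_0 h_def)
  then have "sg_energy_level (Suc 0) h u = sg_energy_level 0 u u"
    "sg_energy_level (Suc 0) h h = sg_energy_level 0 u u"
    unfolding h_def sg_energy_level_harm by simp_all
  \<comment> \<open>Both terms of level 1 that contain \<open>h\<close> equal the energy of
    \<open>u\<close> at level 0, so the energy of \<open>u - h\<close> at level 1 is exactly the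
    increase.\<close>
  then show ?case
    using sg_energy_level_diff_self[of "Suc 0" u h]
      sg_energy_level_nonneg[of "Suc 0" "\<lambda>x. u x - h x"] by simp
next
  case (Suc m)
  have "(\<Sum>i\<in>UNIV. sg_energy_level m (u \<circ> sg_map i) (u \<circ> sg_map i)) \<le>
      (\<Sum>i\<in>UNIV. sg_energy_level (Suc m) (u \<circ> sg_map i) (u \<circ> sg_map i))"
    by (intro sum_mono Suc.IH)
  then show ?case
    using sg_energy_level_Suc[of "Suc m" u u] sg_energy_level_Suc[of m u u] by linarith
qed

lemma sg_dom_energy_iff:
  "u \<in> sg_dom_energy \<longleftrightarrow> continuous_on SG u \<and> (\<exists>B. \<forall>m. sg_energy_level m u u \<le> B)"
proof -
  have inc: "incseq (\<lambda>m. sg_energy_level m u u)"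
    by (intro incseq_SucI sg_energy_level_mono_Suc)
  have "convergent (\<lambda>m. sg_energy_level m u u) \<longleftrightarrow> (\<exists>B. \<forall>m. sg_energy_level m u u \<le> B)"
  proof
    assume "convergent (\<lambda>m. sg_energy_level m u u)"
    then show "\<exists>B. \<forall>m. sg_energy_level m u u \<le> B"
      using incseq_le[OF inc] by (auto simp: convergent_def)
  next
    assume "\<exists>B. \<forall>m. sg_energy_level m u u \<le> B"
    then obtain B where "\<forall>m. sg_energy_level m u u \<le> B" by blast
    from incseq_convergent[OF inc this] show "convergent (\<lambda>m. sg_energy_level m u u)"
      unfolding convergent_def by metis
  qed
  then show ?thesis by (simp add: sg_dom_energy_def)
qed

lemma sg_dom_energy_continuous: "u \<in> sg_dom_energy \<Longrightarrow> continuous_on SG u"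
  by (simp add: sg_dom_energy_iff)

lemma sg_dom_energy_scale:
  assumes "u \<in> sg_dom_energy" shows "(\<lambda>x. c * u x) \<in> sg_dom_energy"
proof -
  obtain B where B: "\<And>m. sg_energy_level m u u \<le> B" using assms by (auto simp: sg_dom_energy_iff)
  have "sg_energy_level m (\<lambda>x. c * u x) (\<lambda>x. c * u x) \<le> c\<^sup>2 * B" for m
  proof -
    have "sg_energy_level m (\<lambda>x. c * u x) (\<lambda>x. c * u x) = c\<^sup>2 * sg_energy_level m u u"
      using sg_energy_level_scale[of m c u "\<lambda>x. c * u x"] sg_energy_level_scale[of m c u u]
        sg_energy_level_commute[of m u "\<lambda>x. c * u x"] by (simp add: power2_eq_square)
    then show ?thesis using B[of m] by (simp add: mult_left_mono)
  qed
  then show ?thesis using assms by (auto simp: sg_dom_energy_iff intro!: continuous_intros)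
qed

lemma sg_dom_energy_add:
  assumes "u \<in> sg_dom_energy" "v \<in> sg_dom_energy" shows "(\<lambda>x. u x + v x) \<in> sg_dom_energy"
proof -
  obtain B C where B: "\<And>m. sg_energy_level m u u \<le> B" and C: "\<And>m. sg_energy_level m v v \<le> C"
    using assms by (auto simp: sg_dom_energy_iff)
  have "sg_energy_level m (\<lambda>x. u x + v x) (\<lambda>x. u x + v x) \<le> 2 * B + 2 * C" for m
  proof -
    have "sg_energy_level m (\<lambda>x. u x + v x) (\<lambda>x. u x + v x) =
        sg_energy_level m u u + 2 * sg_energy_level m u v + sg_energy_level m v v"
      using sg_energy_level_add[of m u v "\<lambda>x. u x + v x"]
        sg_energy_level_add[of m u v u] sg_energy_level_add[of m u v v]
        sg_energy_level_commute[of m u "\<lambda>x. u x + v x"] sg_energy_level_commute[of m v "\<lambda>x. u x + v x"]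
        sg_energy_level_commute[of m u v] by simp
    then show ?thesis
      using sg_energy_level_diff_self[of m u v] sg_energy_level_nonneg[of m "\<lambda>x. u x - v x"]
        B[of m] C[of m] sg_energy_level_commute[of m u v] by simp
  qed
  then show ?thesis using assms by (auto simp: sg_dom_energy_iff intro!: continuous_intros)
qed

text \<open>\<open>sg_energy\<close> is a bare \<open>lim\<close>, informative only once convergence
  is known. Polarization writes the mixed form through three diagonal ones, which converge by
  membership in the domain.\<close>

lemma sg_energy_level_tendsto:
  assumes "u \<in> sg_dom_energy" "v \<in> sg_dom_energy"
  shows "(\<lambda>m. sg_energy_level m u v) \<longlonglongrightarrow> sg_energy u v"
proof -
  have conv: "convergent (\<lambda>m. sg_energy_level m w w)" if "w \<in> sg_dom_energy" for w
    using that by (simp add: sg_dom_energy_def)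
  have "(\<lambda>x. u x - v x) \<in> sg_dom_energy"
    using sg_dom_energy_add[OF assms(1) sg_dom_energy_scale[OF assms(2), of "-1"]] by simp
  then have "convergent (\<lambda>m. 1/2 * (sg_energy_level m u u + sg_energy_level m v v
      - sg_energy_level m (\<lambda>x. u x - v x) (\<lambda>x. u x - v x)))"
    using assms conv by (intro convergent_mult convergent_add convergent_diff convergent_const)
  moreover have "(\<lambda>m. 1/2 * (sg_energy_level m u u + sg_energy_level m v v
      - sg_energy_level m (\<lambda>x. u x - v x) (\<lambda>x. u x - v x))) = (\<lambda>m. sg_energy_level m u v)"
    by (simp add: sg_energy_level_diff_self sg_energy_level_commute[of _ v u])
  ultimately show ?thesis by (simp add: sg_energy_def convergent_LIMSEQ_iff)
qed

lemma sg_energy_level_le_energy: "u \<in> sg_dom_energy \<Longrightarrow> sg_energy_level m u u \<le> sg_energy u u"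
  by (rule incseq_le[OF incseq_SucI sg_energy_level_tendsto]) (auto simp: sg_energy_level_mono_Suc)

lemma sg_energy_add:
  assumes "u \<in> sg_dom_energy" "w \<in> sg_dom_energy" "v \<in> sg_dom_energy"
  shows "sg_energy (\<lambda>x. u x + w x) v = sg_energy u v + sg_energy w v"
  by (rule LIMSEQ_unique[OF sg_energy_level_tendsto])
    (auto simp: assms sg_dom_energy_add sg_energy_level_add intro!: tendsto_add sg_energy_level_tendsto)

lemma sg_energy_scale:
  assumes "u \<in> sg_dom_energy" "v \<in> sg_dom_energy"
  shows "sg_energy (\<lambda>x. c * u x) v = c * sg_energy u v"
  by (rule LIMSEQ_unique[OF sg_energy_level_tendsto])
    (auto simp: assms sg_dom_energy_scale sg_energy_level_scale
      intro!: tendsto_mult_left sg_energy_level_tendsto)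

lemma sg_energy_commute: "sg_energy u v = sg_energy v u"
  by (simp add: sg_energy_def sg_energy_level_commute)

lemma sg_energy_cong:
  assumes "\<And>x. x \<in> SG \<Longrightarrow> u x = u' x" "\<And>x. x \<in> SG \<Longrightarrow> v x = v' x"
  shows "sg_energy u v = sg_energy u' v'"
proof -
  have "sg_energy_level m u v = sg_energy_level m u' v'" for m
    by (rule sg_energy_level_cong[OF assms])
  then show ?thesis by (simp add: sg_energy_def)
qed

lemma sg_dom_energy_cong:
  assumes "\<And>x. x \<in> SG \<Longrightarrow> u x = u' x" shows "u \<in> sg_dom_energy \<longleftrightarrow> u' \<in> sg_dom_energy"
proof -
  have "sg_energy_level m u u = sg_energy_level m u' u'" for m
    by (rule sg_energy_level_cong[OF assms assms])
  moreover have "continuous_on SG u \<longleftrightarrow> continuous_on SG u'"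
    by (rule continuous_on_cong) (auto simp: assms)
  ultimately show ?thesis by (simp add: sg_dom_energy_def)
qed

lemma harm_dom_energy: "sg_harm a \<in> sg_dom_energy"
proof -
  have "\<forall>m. sg_energy_level m (sg_harm a) (sg_harm a) \<le> sg_energy_level 0 (sg_harm a) (sg_harm a)"
    by (metis order_refl sg_energy_level_harm_eq)
  then show ?thesis using continuous_on_harm unfolding sg_dom_energy_iff by blast
qed

lemma sg_energy_harm: "sg_energy (sg_harm a) v = sg_energy_level 0 (sg_harm a) v"
proof -
  have "(\<lambda>m. sg_energy_level m (sg_harm a) v) = (\<lambda>m. sg_energy_level 0 (sg_harm a) v)"
    using sg_energy_level_harm_eq by blast
  then show ?thesis by (simp add: sg_energy_def)
qed

subsection \<open>The reflection that fixes the vertex 0\<close>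

text \<open>Since \<open>- 1 = 2\<close> in the type \<open>3\<close>, this reflection acts as
  negation of the index on vertices, maps and barycentric coordinates alike.\<close>

definition sg_refl :: "point \<Rightarrow> point" where
  "sg_refl x = vector [1 - x$1, x$2]"

lemma bary_refl: "bary j (sg_refl x) = bary (- j) x"
proof -
  have "\<forall>j. bary j (sg_refl x) = bary (- j) x"
    unfolding forall_3_from_0 by (simp add: bary_def sg_refl_def)
  then show ?thesis by blast
qed

lemma refl_sg_vertex: "sg_refl (sg_vertex i) = sg_vertex (- i)"
  by (rule bary_eqI) (simp add: bary_refl bary_sg_vertex minus_equation_iff of_bool_def)

lemma refl_sg_map: "sg_refl (sg_map i x) = sg_map (- i) (sg_refl x)"
  by (rule bary_eqI) (simp add: bary_refl bary_sg_map minus_equation_iff of_bool_def)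

lemma continuous_on_refl: "continuous_on S sg_refl"
proof -
  have "sg_refl x = axis 1 1 - x + (2 * x$2) *\<^sub>R axis 2 1" for x
    by (simp add: sg_refl_def vec_eq_iff forall_2 axis_def)
  then have eq: "sg_refl = (\<lambda>x. axis 1 1 - x + (2 * x$2) *\<^sub>R axis 2 1)" by blast
  show ?thesis unfolding eq by (intro continuous_intros)
qed

text \<open>Reflection permutes the three maps, so the mirror image of \<open>SG\<close> is again
  compact and invariant, and \<open>gasket_subset\<close> applies.\<close>

lemma refl_in_SG: "x \<in> SG \<Longrightarrow> sg_refl x \<in> SG"
proof -
  have "(\<Union>i. sg_map i ` sg_refl ` SG) = (\<Union>i. sg_map (- i) ` sg_refl ` SG)"
    unfolding UNIV_3_from_0 UN_insert UN_empty uminus_3 minus_zero by blast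
  also have "\<dots> = sg_refl ` (\<Union>i. sg_map i ` SG)"
    by (simp only: image_UN image_image refl_sg_map)
  also have "\<dots> = sg_refl ` SG" using SG_fixpoint by metis
  finally have "sg_refl ` SG \<subseteq> SG"
    using gasket_subset[OF compact_continuous_image[OF continuous_on_refl compact_SG] _
        compact_SG SG_nonempty SG_fixpoint] by metis
  then show "x \<in> SG \<Longrightarrow> sg_refl x \<in> SG" by blast
qed

lemma sum_uminus_3: "(\<Sum>i\<in>UNIV. g (- i)) = (\<Sum>i\<in>UNIV. g i)" for g :: "3 \<Rightarrow> real"
  by (simp add: sum_3_from_0 uminus_3)

lemma sg_energy_level_refl:
  "sg_energy_level m (\<lambda>x. u (sg_refl x)) (\<lambda>x. v (sg_refl x)) = sg_energy_level m u v"
proof (induction m arbitrary: u v)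
  case 0
  show ?case by (simp add: sg_energy_level_0 refl_sg_vertex uminus_3 algebra_simps)
next
  case (Suc m)
  have "sg_energy_level m ((\<lambda>x. u (sg_refl x)) \<circ> sg_map i) ((\<lambda>x. v (sg_refl x)) \<circ> sg_map i) =
      sg_energy_level m (u \<circ> sg_map (- i)) (v \<circ> sg_map (- i))" for i
    using Suc[of "u \<circ> sg_map (- i)" "v \<circ> sg_map (- i)"] by (simp add: refl_sg_map comp_def)
  then show ?case
    unfolding sg_energy_level_Suc
    by (simp add: sum_uminus_3[of "\<lambda>i. sg_energy_level m (u \<circ> sg_map i) (v \<circ> sg_map i)"])
qed

lemma continuous_on_SG_refl: "continuous_on SG u \<Longrightarrow> continuous_on SG (\<lambda>x. u (sg_refl x))"
  by (rule continuous_on_compose2[OF _ continuous_on_refl]) (auto intro: refl_in_SG)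

lemma sg_dom_energy_refl: "u \<in> sg_dom_energy \<Longrightarrow> (\<lambda>x. u (sg_refl x)) \<in> sg_dom_energy"
  by (auto simp: sg_dom_energy_def sg_energy_level_refl continuous_on_SG_refl)

lemma sg_energy_refl: "sg_energy (\<lambda>x. u (sg_refl x)) (\<lambda>x. v (sg_refl x)) = sg_energy u v"
  by (simp add: sg_energy_def sg_energy_level_refl)

subsection \<open>Integration against the self-similar measure\<close>

text \<open>Riemann sums for the integral: the mean over the vertices of all cells of level
  \<open>m\<close>, a shared vertex being counted once per cell. Self-similarity, mirror symmetry
  and the means of harmonic functions are exact at every level and pass to the limit.\<close>

fun vertex_avg :: "nat \<Rightarrow> (point \<Rightarrow> real) \<Rightarrow> real" where
  "vertex_avg 0 f = (\<Sum>i\<in>UNIV. f (sg_vertex i)) / 3"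
| "vertex_avg (Suc m) f = (\<Sum>i\<in>UNIV. vertex_avg m (f \<circ> sg_map i)) / 3"

lemma finite_words: "finite {w :: 3 list. length w = m}"
  using finite_lists_length_eq[of "UNIV :: 3 set" m] by simp

lemma sum_words_Suc:
  "(\<Sum>w\<in>{w :: 3 list. length w = Suc m}. g w) = (\<Sum>i\<in>UNIV. \<Sum>w\<in>{w. length w = m}. g (i # w))"
proof -
  have "(\<Sum>w\<in>{w :: 3 list. length w = Suc m}. g w) = (\<Sum>i\<in>UNIV. \<Sum>w\<in>(#) i ` {w. length w = m}. g w)"
    unfolding length_Suc_words by (rule sum.UNION_disjoint) (auto simp: finite_words)
  also have "\<dots> = (\<Sum>i\<in>UNIV. \<Sum>w\<in>{w. length w = m}. g (i # w))"
    by (rule sum.cong[OF refl], subst sum.reindex) (auto simp: inj_on_def)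
  finally show ?thesis .
qed

lemma sum_words_const: "(\<Sum>w\<in>{w :: 3 list. length w = m}. (1/3 :: real) ^ m) = 1"
proof (induction m)
  case (Suc m)
  show ?case unfolding sum_words_Suc power_Suc sum_distrib_left[symmetric] Suc by simp
qed simp

lemma vertex_avg_words:
  "vertex_avg m f = (\<Sum>w\<in>{w. length w = m}. (1/3) ^ m * vertex_avg 0 (f \<circ> sg_word w))"
proof (induction m arbitrary: f)
  case 0
  show ?case by (simp add: comp_def)
next
  case (Suc m)
  have "f \<circ> sg_map i \<circ> sg_word w = f \<circ> sg_word (i # w)" for i w
    by (simp add: fun_eq_iff)
  then show ?case
    by (simp add: Suc sum_words_Suc sum_divide_distrib sum_distrib_left del: vertex_avg.simps(1))
qed

lemma continuous_on_SG_sg_map: "continuous_on SG f \<Longrightarrow> continuous_on SG (\<lambda>x. f (sg_map i x))"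
  by (rule continuous_on_compose2[OF _ continuous_on_sg_map]) auto

lemma continuous_on_SG_sg_word: "continuous_on SG f \<Longrightarrow> continuous_on SG (\<lambda>x. f (sg_word w x))"
proof (induction w arbitrary: f)
  case (Cons i w)
  then show ?case using continuous_on_SG_sg_map[of f i] by simp
qed simp

lemma compact_sg_cell: "compact (sg_cell w)"
  by (induction w)
    (auto simp: sg_cell_simps compact_SG intro!: compact_continuous_image continuous_intros)

lemma small_oscillation:
  assumes "continuous_on SG f" "e > (0::real)"
  obtains m0 where
    "\<And>w x y. m0 \<le> length w \<Longrightarrow> x \<in> sg_cell w \<Longrightarrow> y \<in> sg_cell w \<Longrightarrow> \<bar>f x - f y\<bar> < e"
proof -
  have "uniformly_continuous_on SG f"
    by (rule compact_uniformly_continuous[OF assms(1) compact_SG])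
  then obtain d where d: "d > 0" "\<And>x y. x \<in> SG \<Longrightarrow> y \<in> SG \<Longrightarrow> dist y x < d \<Longrightarrow> dist (f y) (f x) < e"
    using assms(2) unfolding uniformly_continuous_on_def by metis
  obtain m0 where m0: "\<And>w x y. m0 \<le> length w \<Longrightarrow> x \<in> sg_cell w \<Longrightarrow> y \<in> sg_cell w \<Longrightarrow> dist x y < d"
    using small_cells[OF d(1)] by metis
  show thesis
  proof (rule that[of m0])
    fix w x y assume *: "m0 \<le> length w" "x \<in> sg_cell w" "y \<in> sg_cell w"
    then have "x \<in> SG" "y \<in> SG" using sg_cell_subset_SG by auto
    then show "\<bar>f x - f y\<bar> < e" using d(2)[of y x] m0[OF *] by (simp add: dist_real_def)
  qed
qed

locale sg_measure_space =
  fixes \<mu> :: "point measure"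
  assumes sg_measure: "sg_measure \<mu>"
begin

lemma sets_mu: "sets \<mu> = sets borel"
  and prob_space_mu: "prob_space \<mu>"
  and measure_sg_cell: "measure \<mu> (sg_cell w) = (1/3) ^ length w"
  using sg_measure by (auto simp: sg_measure_def)

sublocale prob_space \<mu> by (rule prob_space_mu)

lemma compact_in_sets: "compact A \<Longrightarrow> A \<in> sets \<mu>"
  unfolding sets_mu by (simp add: borel_compact)

lemma set_integrable_continuous:
  assumes "compact A" "continuous_on A (f :: point \<Rightarrow> real)"
  shows "set_integrable \<mu> A f"
proof -
  obtain B where B: "\<And>x. x \<in> A \<Longrightarrow> \<bar>f x\<bar> \<le> B"
    using compact_imp_bounded[OF compact_continuous_image[OF assms(2,1)]]
    by (auto simp: bounded_iff)
  have "(\<lambda>x. indicat_real A x *\<^sub>R f x) \<in> borel_measurable borel"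
    by (rule borel_measurable_continuous_on_indicator) (use assms in \<open>auto simp: borel_compact\<close>)
  then have "(\<lambda>x. indicat_real A x *\<^sub>R f x) \<in> borel_measurable \<mu>"
    using measurable_cong_sets[OF sets_mu refl] by blast
  then show ?thesis unfolding set_integrable_def
    by (rule integrable_const_bound[where B = "\<bar>B\<bar>", rotated]) (use B in \<open>force simp: indicator_def\<close>)
qed

definition I :: "(point \<Rightarrow> real) \<Rightarrow> real" where
  "I f = (LINT x:SG|\<mu>. f x)"

lemma set_integrable_SG: "continuous_on SG f \<Longrightarrow> set_integrable \<mu> SG f" for f :: "point \<Rightarrow> real"
  by (rule set_integrable_continuous[OF compact_SG])

lemma I_cong: "(\<And>x. x \<in> SG \<Longrightarrow> f x = g x) \<Longrightarrow> I f = I g"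
  unfolding I_def by (rule set_lebesgue_integral_cong) (auto intro: compact_in_sets compact_SG)

lemma I_add: "continuous_on SG f \<Longrightarrow> continuous_on SG g \<Longrightarrow> I (\<lambda>x. f x + g x) = I f + I g"
  unfolding I_def by (rule set_integral_add) (auto intro: set_integrable_SG)

lemma I_scale: "I (\<lambda>x. c * f x) = c * I f"
  unfolding I_def by simp

lemma I_diff: "continuous_on SG f \<Longrightarrow> continuous_on SG g \<Longrightarrow> I (\<lambda>x. f x - g x) = I f - I g"
  unfolding I_def by (rule set_integral_diff) (auto intro: set_integrable_SG)

lemma I_mono:
  "continuous_on SG f \<Longrightarrow> continuous_on SG g \<Longrightarrow> (\<And>x. x \<in> SG \<Longrightarrow> f x \<le> g x) \<Longrightarrow> I f \<le> I g"
  unfolding I_def by (rule set_integral_mono) (auto intro: set_integrable_SG)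

lemma I_const: "I (\<lambda>x. c) = c"
proof -
  have "measure \<mu> SG = 1" using measure_sg_cell[of "[]"] by (simp add: sg_cell_simps)
  then show ?thesis unfolding I_def
    by (simp add: set_integral_const emeasure_eq_measure compact_in_sets compact_SG)
qed

lemma I_nonneg: "continuous_on SG f \<Longrightarrow> (\<And>x. x \<in> SG \<Longrightarrow> 0 \<le> f x) \<Longrightarrow> 0 \<le> I f"
  using I_mono[of "\<lambda>x. 0" f] I_const[of 0] by auto

lemma I_abs_le: "continuous_on SG f \<Longrightarrow> \<bar>I f\<bar> \<le> I (\<lambda>x. \<bar>f x\<bar>)"
proof -
  assume f: "continuous_on SG f"
  have "continuous_on SG (\<lambda>x. - f x)" "continuous_on SG (\<lambda>x. \<bar>f x\<bar>)"
    using f by (auto intro!: continuous_intros)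
  then have "I f \<le> I (\<lambda>x. \<bar>f x\<bar>)" "I (\<lambda>x. - f x) \<le> I (\<lambda>x. \<bar>f x\<bar>)"
    using f by (auto intro!: I_mono)
  then show ?thesis using I_scale[of "-1" f] by simp
qed

text \<open>\<open>sg_measure\<close> prescribes the masses of cells only. The one possible common
  point lies in some cell of every level \<open>n\<close>, so its mass is at most
  \<open>(1/3) ^ n\<close>.\<close>

lemma measure_cells_Int:
  assumes "length w = length w'" "w \<noteq> w'"
  shows "measure \<mu> (sg_cell w \<inter> sg_cell w') = 0"
proof -
  obtain p where p: "sg_cell w \<inter> sg_cell w' \<subseteq> {p}" using sg_cells_Int[OF assms] by blast
  have "measure \<mu> (sg_cell w \<inter> sg_cell w') \<le> (1/3) ^ n" for n
  proof (cases "sg_cell w \<inter> sg_cell w' = {}")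
    case False
    then have eq: "sg_cell w \<inter> sg_cell w' = {p}" using p by blast
    then have "p \<in> SG" using sg_cell_subset_SG by blast
    then obtain v where v: "length v = n" "p \<in> sg_cell v" using SG_eq_UN_cells[of n] by blast
    have "measure \<mu> {p} \<le> measure \<mu> (sg_cell v)"
      by (rule finite_measure_mono) (use v in \<open>auto intro: compact_in_sets compact_sg_cell\<close>)
    then show ?thesis by (simp add: eq measure_sg_cell v)
  qed simp
  moreover have "(\<lambda>n. (1/3 :: real) ^ n) \<longlonglongrightarrow> 0" by (rule LIMSEQ_power_zero) simp
  ultimately have "measure \<mu> (sg_cell w \<inter> sg_cell w') \<le> 0"
    by (intro LIMSEQ_le_const) auto
  then show ?thesis by (simp add: measure_le_0_iff)
qed

lemma I_words:
  assumes "continuous_on SG f"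
  shows "I f = (\<Sum>w\<in>{w. length w = m}. LINT x:sg_cell w|\<mu>. f x)"
proof -
  have "I f = (LINT x:(\<Union>w\<in>{w. length w = m}. sg_cell w)|\<mu>. f x)"
    unfolding I_def using SG_eq_UN_cells[of m] by simp
  also have "\<dots> = (\<Sum>w\<in>{w. length w = m}. LINT x:sg_cell w|\<mu>. f x)"
  proof (rule set_integral_finite_UN_AE)
    fix v w :: "3 list" assume vw: "v \<in> {w. length w = m}" "w \<in> {w. length w = m}"
    show "AE x in \<mu>. (x \<in> sg_cell v \<and> x \<in> sg_cell w) \<longrightarrow> v = w"
    proof (cases "v = w")
      case False
      then have "sg_cell v \<inter> sg_cell w \<in> null_sets \<mu>"
        using measure_cells_Int[of v w] vw
        by (auto simp: null_sets_def emeasure_eq_measure compact_in_sets compact_Int compact_sg_cell)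
      then show ?thesis by (rule AE_I'[of _ _]) auto
    qed simp
  qed (auto simp: finite_words compact_sg_cell
      intro!: compact_in_sets set_integrable_continuous continuous_on_subset[OF assms] sg_cell_subset_SG)
  finally show ?thesis .
qed

text \<open>On a small cell \<open>f\<close> stays within \<open>e/2\<close> of the mean over the
  three vertices, and the cells carry total mass 1 with null overlaps. So the cell masses alone
  determine integrals of continuous functions.\<close>

lemma vertex_avg_tendsto:
  assumes "continuous_on SG f"
  shows "(\<lambda>m. vertex_avg m f) \<longlonglongrightarrow> I f"
proof (rule LIMSEQ_I)
  fix e :: real assume e: "e > 0"
  obtain m0 where m0: "\<And>w x y. m0 \<le> length w \<Longrightarrow> x \<in> sg_cell w \<Longrightarrow> y \<in> sg_cell w \<Longrightarrow> \<bar>f x - f y\<bar> < e/2"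
    using small_oscillation[OF assms, of "e/2"] e by auto
  have "norm (vertex_avg m f - I f) < e" if "m0 \<le> m" for m
  proof -
    have cell: "\<bar>(1/3) ^ m * vertex_avg 0 (f \<circ> sg_word w) - (LINT x:sg_cell w|\<mu>. f x)\<bar> \<le> (1/3) ^ m * (e/2)"
      if w: "length w = m" for w
    proof -
      define c where "c = vertex_avg 0 (f \<circ> sg_word w)"
      have vc: "sg_word w (sg_vertex i) \<in> sg_cell w" for i by (auto simp: sg_cell_def)
      have c: "\<bar>f x - c\<bar> \<le> e/2" if "x \<in> sg_cell w" for x
        using m0[OF _ that vc[of 0]] m0[OF _ that vc[of 1]] m0[OF _ that vc[of 2]] w \<open>m0 \<le> m\<close>
        by (simp add: c_def sum_3_from_0 abs_if field_simps split: if_splits)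
      have meas: "sg_cell w \<in> sets \<mu>" by (intro compact_in_sets compact_sg_cell)
      have int: "set_integrable \<mu> (sg_cell w) f"
        by (intro set_integrable_continuous compact_sg_cell continuous_on_subset[OF assms] sg_cell_subset_SG)
      have cint: "(LINT x:sg_cell w|\<mu>. d) = d * (1/3) ^ m" for d :: real
        using meas by (simp add: set_integral_const emeasure_eq_measure measure_sg_cell w)
      have inti: "set_integrable \<mu> (sg_cell w) (\<lambda>x. d)" for d :: real
        by (intro set_integrable_continuous compact_sg_cell continuous_intros)
      have bounds: "f x \<le> c + e/2" "c - e/2 \<le> f x" if "x \<in> sg_cell w" for x
        using c[OF that] by linarith+
      have "(LINT x:sg_cell w|\<mu>. f x) \<le> (LINT x:sg_cell w|\<mu>. c + e/2)"
        by (rule set_integral_mono[OF int inti bounds(1)])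
      moreover have "(LINT x:sg_cell w|\<mu>. c - e/2) \<le> (LINT x:sg_cell w|\<mu>. f x)"
        by (rule set_integral_mono[OF inti int bounds(2)])
      ultimately show ?thesis
        unfolding cint c_def[symmetric] left_diff_distrib distrib_right
        by (simp only: abs_le_iff mult.commute) linarith
    qed
    have "norm (vertex_avg m f - I f) =
      \<bar>\<Sum>w\<in>{w. length w = m}. (1/3) ^ m * vertex_avg 0 (f \<circ> sg_word w) - (LINT x:sg_cell w|\<mu>. f x)\<bar>"
      unfolding vertex_avg_words[of m] I_words[OF assms, of m] by (simp add: sum_subtractf del: vertex_avg.simps)
    also have "\<dots> \<le> (\<Sum>w\<in>{w :: 3 list. length w = m}. (1/3) ^ m * (e/2))"
      by (rule order_trans[OF sum_abs sum_mono]) (use cell in auto)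
    also have "\<dots> = e/2" using sum_words_const[of m] by (simp only: sum_distrib_right[symmetric])
    finally show ?thesis using e by simp
  qed
  then show "\<exists>m0. \<forall>m\<ge>m0. norm (vertex_avg m f - I f) < e" by blast
qed

lemma I_self_similar:
  assumes "continuous_on SG f"
  shows "I f = (\<Sum>i\<in>UNIV. I (\<lambda>x. f (sg_map i x))) / 3"
proof (rule LIMSEQ_unique)
  show "(\<lambda>m. vertex_avg (Suc m) f) \<longlonglongrightarrow> I f"
    by (rule LIMSEQ_Suc[OF vertex_avg_tendsto[OF assms]])
  show "(\<lambda>m. vertex_avg (Suc m) f) \<longlonglongrightarrow> (\<Sum>i\<in>UNIV. I (\<lambda>x. f (sg_map i x))) / 3"
    unfolding vertex_avg.simps comp_def
    by (intro tendsto_intros vertex_avg_tendsto continuous_on_SG_sg_map assms) simp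
qed

lemma I_refl:
  assumes "continuous_on SG f"
  shows "I (\<lambda>x. f (sg_refl x)) = I f"
proof (rule LIMSEQ_unique)
  have "vertex_avg m (\<lambda>x. f (sg_refl x)) = vertex_avg m f" for m
  proof (induction m arbitrary: f)
    case 0
    show ?case by (simp add: refl_sg_vertex sum_uminus_3[of "\<lambda>i. f (sg_vertex i)"])
  next
    case (Suc m)
    show ?case
      using Suc[of "f \<circ> sg_map (- i)" for i]
      by (simp add: comp_def refl_sg_map sum_uminus_3[of "\<lambda>i. vertex_avg m (\<lambda>x. f (sg_map i x))"])
  qed
  then show "(\<lambda>m. vertex_avg m f) \<longlonglongrightarrow> I (\<lambda>x. f (sg_refl x))"
    using vertex_avg_tendsto[OF continuous_on_SG_refl[OF assms]] by simp
qed (rule vertex_avg_tendsto[OF assms])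

text \<open>As the cell \<open>w\<close> shrinks to a point, \<open>h \<circ> sg_word w\<close> tends uniformly to the value of \<open>h\<close> there.\<close>

lemma localize_zero:
  assumes \<psi>: "continuous_on SG \<psi>" "I \<psi> \<noteq> 0" and h: "continuous_on SG h"
    and zero: "\<And>w. I (\<lambda>x. h (sg_word w x) * \<psi> x) = 0" and x: "x \<in> SG"
  shows "h x = 0"
proof -
  define B where "B = I (\<lambda>x. \<bar>\<psi> x\<bar>)"
  have B: "0 < B" using I_abs_le[OF \<psi>(1)] \<psi>(2) unfolding B_def by linarith
  have "\<bar>h x * I \<psi>\<bar> \<le> 0 + e" if e: "e > 0" for e
  proof -
    have eB: "e / B > 0" using e B by simp
    obtain m where m: "\<And>w x y. m \<le> length w \<Longrightarrow> x \<in> sg_cell w \<Longrightarrow> y \<in> sg_cell w \<Longrightarrow> \<bar>h x - h y\<bar> < e / B"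
      using small_oscillation[OF h eB] by metis
    obtain w where w: "length w = m" "x \<in> sg_cell w" using x SG_eq_UN_cells[of m] by blast
    note cont = \<psi>(1) continuous_on_SG_sg_word[OF h, of w]
    have "h x * I \<psi> = I (\<lambda>y. h x * \<psi> y) - I (\<lambda>y. h (sg_word w y) * \<psi> y)"
      by (simp add: zero I_scale)
    also have "\<dots> = I (\<lambda>y. h x * \<psi> y - h (sg_word w y) * \<psi> y)"
      by (rule I_diff[symmetric]) (intro continuous_intros cont)+
    also have "\<bar>\<dots>\<bar> \<le> I (\<lambda>y. \<bar>h x * \<psi> y - h (sg_word w y) * \<psi> y\<bar>)"
      by (rule I_abs_le) (intro continuous_intros cont)
    also have "\<dots> \<le> I (\<lambda>y. e / B * \<bar>\<psi> y\<bar>)"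
    proof (rule I_mono)
      fix y assume "y \<in> SG"
      then have "\<bar>h x - h (sg_word w y)\<bar> \<le> e / B"
        using m[of w x "sg_word w y"] w by (force simp: sg_cell_def)
      then show "\<bar>h x * \<psi> y - h (sg_word w y) * \<psi> y\<bar> \<le> e / B * \<bar>\<psi> y\<bar>"
        unfolding left_diff_distrib[symmetric] abs_mult by (rule mult_right_mono) simp
    qed (intro continuous_intros cont)+
    also have "\<dots> = e / B * B" by (simp only: I_scale B_def)
    also have "\<dots> = e" using B by simp
    finally show ?thesis by simp
  qed
  then have "\<bar>h x * I \<psi>\<bar> \<le> 0" by (rule field_le_epsilon)
  then show ?thesis using \<psi>(2) by simp
qed

text \<open>By self-similarity the three nonnegative cell integrals add up to 0, so each vanishes,
  and inductively those over all smaller cells. Localization with weight 1 then applies; in effect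
  \<mu> has full support.\<close>

lemma I_eq_0_imp:
  assumes "continuous_on SG f" "\<And>x. x \<in> SG \<Longrightarrow> 0 \<le> f x" "I f = 0" "x \<in> SG"
  shows "f x = 0"
proof (rule localize_zero[where \<psi> = "\<lambda>x. 1" and h = f])
  fix w
  have "continuous_on SG f \<Longrightarrow> (\<And>x. x \<in> SG \<Longrightarrow> 0 \<le> f x) \<Longrightarrow> I f = 0 \<Longrightarrow> I (\<lambda>x. f (sg_word w x)) = 0" for f
  proof (induction w arbitrary: f)
    case (Cons i w)
    have "0 \<le> I (\<lambda>x. f (sg_map j x))" for j
      by (rule I_nonneg[OF continuous_on_SG_sg_map[OF Cons.prems(1)]]) (auto intro: Cons.prems(2))
    moreover have "(\<Sum>j\<in>UNIV. I (\<lambda>x. f (sg_map j x))) = 0"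
      using I_self_similar[OF Cons.prems(1)] Cons.prems(3) by simp
    ultimately have "I (\<lambda>x. f (sg_map i x)) = 0"
      using sum_nonneg_eq_0_iff[of "UNIV :: 3 set" "\<lambda>j. I (\<lambda>x. f (sg_map j x))"] by auto
    with Cons.IH[OF continuous_on_SG_sg_map[OF Cons.prems(1)]] show ?case
      using Cons.prems(2) by auto
  qed simp
  then show "I (\<lambda>x. f (sg_word w x) * 1) = 0" using assms by simp
qed (use assms I_const in auto)

text \<open>The nine numbers \<open>harm_step a i j\<close> add up to three times the sum of the
  boundary values, so all vertex averages equal that of level 0.\<close>

lemma I_harm: "I (sg_harm a) = (a 0 + a 1 + a 2) / 3"
proof (rule LIMSEQ_unique[OF vertex_avg_tendsto[OF continuous_on_harm]])
  have cong: "vertex_avg m f = vertex_avg m g" if "\<And>x. x \<in> SG \<Longrightarrow> f x = g x" for m f g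
    using that
  proof (induction m arbitrary: f g)
    case (Suc m)
    have "vertex_avg m (f \<circ> sg_map i) = vertex_avg m (g \<circ> sg_map i)" for i
      by (rule Suc.IH) (auto intro: Suc.prems)
    then show ?case by simp
  qed simp
  have "vertex_avg m (sg_harm a) = (a 0 + a 1 + a 2) / 3" for m
  proof (induction m arbitrary: a)
    case (Suc m)
    have "vertex_avg m (sg_harm a \<circ> sg_map i) = vertex_avg m (sg_harm (harm_step a i))" for i
      by (rule cong) (simp add: harm_sg_map)
    then show ?case by (simp add: Suc sum_3_from_0 harm_step_def field_simps)
  qed (simp add: sum_3_from_0)
  then show "(\<lambda>m. vertex_avg m (sg_harm a)) \<longlonglongrightarrow> (a 0 + a 1 + a 2) / 3"
    by (simp only: tendsto_const)
qed

subsection \<open>A Poincare inequality with constant 1\<close>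

lemma young_square: "t > 0 \<Longrightarrow> x\<^sup>2 \<le> (1 + t) * y\<^sup>2 + (1 + 1/t) * (x - y)\<^sup>2" for x y t :: real
proof -
  assume t: "t > 0"
  have "0 \<le> (t * y - (x - y))\<^sup>2 / t" using t by simp
  also have "\<dots> = (1 + t) * y\<^sup>2 + (1 + 1/t) * (x - y)\<^sup>2 - x\<^sup>2"
    using t by (simp add: field_simps power2_eq_square)
  finally show ?thesis by simp
qed

text \<open>Couple a random vertex of a random cell of level \<open>m + 1\<close> with the vertex of the
  surrounding cell of level \<open>m\<close> that carries the same index as the smaller cell.\<close>

lemma vertex_avg_square_Suc:
  assumes t: "t > 0"
  shows "vertex_avg (Suc m) (\<lambda>x. (u x)\<^sup>2) \<le> (1 + t) * vertex_avg m (\<lambda>x. (u x)\<^sup>2)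
           + (1 + 1/t) * ((1/5) ^ m / 15 * sg_energy_level (Suc m) u u)"
proof (induction m arbitrary: u)
  case 0
  let ?q = sg_vertex
  \<comment> \<open>For fixed \<open>i\<close> the sum consists of the two edges of cell
    \<open>i\<close> at its fixed vertex and a zero term; the cell energy has the third edge as
    well. Nine pairs \<open>(i, j)\<close> and the factor 3/5 give the constant 1/15.\<close>
  have E: "(\<Sum>j\<in>UNIV. (u (sg_map i (?q j)) - u (?q i))\<^sup>2) \<le> sg_energy_level 0 (u \<circ> sg_map i) (u \<circ> sg_map i)" for i
  proof -
    have sq: "2 * (x * y) \<le> x * x + y * y" for x y :: real
      using sum_squares_bound[of x y] by (simp add: power2_eq_square mult.assoc)
    have "\<forall>i. (\<Sum>j\<in>UNIV. (u (sg_map i (?q j)) - u (sg_map i (?q i)))\<^sup>2) \<le> sg_energy_level 0 (u \<circ> sg_map i) (u \<circ> sg_map i)"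
      unfolding forall_3_from_0 sum_3_from_0 sg_energy_level_0 comp_def
      by (simp add: power2_eq_square algebra_simps sq del: sg_map_sg_vertex_self)
    then show ?thesis by simp
  qed
  have "9 * vertex_avg (Suc 0) (\<lambda>x. (u x)\<^sup>2) = (\<Sum>i\<in>UNIV. \<Sum>j\<in>UNIV. (u (sg_map i (?q j)))\<^sup>2)"
    by (simp add: sum_divide_distrib[symmetric])
  also have "\<dots> \<le> (\<Sum>i\<in>UNIV. \<Sum>j\<in>UNIV. (1 + t) * (u (?q i))\<^sup>2 + (1 + 1/t) * (u (sg_map i (?q j)) - u (?q i))\<^sup>2)"
    by (intro sum_mono young_square t)
  also have "\<dots> = 9 * ((1 + t) * vertex_avg 0 (\<lambda>x. (u x)\<^sup>2)) +
      (1 + 1/t) * (\<Sum>i\<in>UNIV. \<Sum>j\<in>UNIV. (u (sg_map i (?q j)) - u (?q i))\<^sup>2)"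
    by (simp add: sum.distrib flip: sum_distrib_left)
  also have "\<dots> \<le> 9 * ((1 + t) * vertex_avg 0 (\<lambda>x. (u x)\<^sup>2)) +
      (1 + 1/t) * (\<Sum>i\<in>UNIV. sg_energy_level 0 (u \<circ> sg_map i) (u \<circ> sg_map i))"
    using t by (intro add_left_mono mult_left_mono sum_mono E) auto
  also have "(\<Sum>i\<in>UNIV. sg_energy_level 0 (u \<circ> sg_map i) (u \<circ> sg_map i)) = 3/5 * sg_energy_level (Suc 0) u u"
    by (simp add: sg_energy_level_Suc)
  also have "(1 + 1/t) * (3/5 * sg_energy_level (Suc 0) u u) =
      9 * ((1 + 1/t) * ((1/5) ^ 0 / 15 * sg_energy_level (Suc 0) u u))"
    by simp
  finally show ?case by linarith
next
  case (Suc m)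
  let ?d = "\<lambda>i. u \<circ> sg_map i"
  have "vertex_avg (Suc (Suc m)) (\<lambda>x. (u x)\<^sup>2) = (\<Sum>i\<in>UNIV. vertex_avg (Suc m) (\<lambda>x. (?d i x)\<^sup>2)) / 3"
    by (simp only: vertex_avg.simps(2)[of "Suc m"] comp_def)
  also have "\<dots> \<le> (\<Sum>i\<in>UNIV. (1 + t) * vertex_avg m (\<lambda>x. (?d i x)\<^sup>2)
           + (1 + 1/t) * ((1/5) ^ m / 15 * sg_energy_level (Suc m) (?d i) (?d i))) / 3"
    by (intro divide_right_mono sum_mono Suc) auto
  also have "\<dots> = (1 + t) * ((\<Sum>i\<in>UNIV. vertex_avg m (\<lambda>x. (?d i x)\<^sup>2)) / 3) +
      (1 + 1/t) * ((1/5) ^ m / 15 * ((\<Sum>i\<in>UNIV. sg_energy_level (Suc m) (?d i) (?d i)) / 3))"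
    by (simp only: sum.distrib sum_distrib_left[symmetric] add_divide_distrib times_divide_eq_right)
  also have "(\<Sum>i\<in>UNIV. vertex_avg m (\<lambda>x. (?d i x)\<^sup>2)) / 3 = vertex_avg (Suc m) (\<lambda>x. (u x)\<^sup>2)"
    by (simp only: vertex_avg.simps(2)[of m] comp_def)
  \<comment> \<open>Averaging contributes 1/3 and the energy scaling 3/5: this is the source of
    \<open>(1/5) ^ m\<close>.\<close>
  also have "(\<Sum>i\<in>UNIV. sg_energy_level (Suc m) (?d i) (?d i)) / 3 = sg_energy_level (Suc (Suc m)) u u / 5"
    by (simp add: sg_energy_level_Suc[of "Suc m" u u])
  finally show ?case by simp
qed

text \<open>In effect the triangle inequality for root mean squares: going from level
  \<open>m\<close> to \<open>m + 1\<close> adds at most \<open>(1/2) ^ Suc m * sqrt e\<close>,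
  starting from 0 because \<open>u\<close> vanishes on the boundary, and these increments sum to 1.
  The powers of 1/2 are a generous replacement for the actual increments, with explicit partial
  sums.\<close>

lemma poincare:
  assumes u: "u \<in> sg_dom_energy" and u0: "\<And>i. u (sg_vertex i) = 0"
  shows "I (\<lambda>x. (u x)\<^sup>2) \<le> sg_energy u u"
proof -
  define e where "e = sg_energy u u"
  have e: "0 \<le> e" unfolding e_def
    using sg_energy_level_nonneg[of 0 u] sg_energy_level_le_energy[OF u, of 0] by linarith
  have step: "vertex_avg (Suc m) (\<lambda>x. (u x)\<^sup>2) \<le> (1 + t) * vertex_avg m (\<lambda>x. (u x)\<^sup>2)
           + (1 + 1/t) * ((1/2) ^ Suc m)\<^sup>2 * e" if "t > 0" for t m
  proof -
    have "(1/5 :: real) ^ m \<le> (1/4) ^ m" by (rule power_mono) auto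
    moreover have "0 \<le> (1/4 :: real) ^ m" by simp
    moreover have "((1/2 :: real) ^ Suc m)\<^sup>2 = (1/4) ^ m / 4"
      by (simp add: power2_eq_square flip: power_mult_distrib)
    ultimately have "(1/5) ^ m / 15 \<le> ((1/2 :: real) ^ Suc m)\<^sup>2" by linarith
    then have "(1/5) ^ m / 15 * sg_energy_level (Suc m) u u \<le> ((1/2) ^ Suc m)\<^sup>2 * e"
      using sg_energy_level_le_energy[OF u, of "Suc m"] sg_energy_level_nonneg[of "Suc m" u]
      unfolding e_def by (intro mult_mono) auto
    then have "(1 + 1/t) * ((1/5) ^ m / 15 * sg_energy_level (Suc m) u u) \<le> (1 + 1/t) * (((1/2) ^ Suc m)\<^sup>2 * e)"
      using that by (intro mult_left_mono) auto
    then show ?thesis using vertex_avg_square_Suc[OF that, of m u] unfolding mult.assoc by linarith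
  qed
  have "vertex_avg m (\<lambda>x. (u x)\<^sup>2) \<le> (1 - (1/2) ^ m)\<^sup>2 * e" for m
  proof (induction m)
    case 0
    show ?case by (simp add: u0)
  next
    case (Suc m)
    show ?case
    proof (cases m)
      case 0
      have "vertex_avg 1 (\<lambda>x. (u x)\<^sup>2) \<le> (2 / 15) * sg_energy_level 1 u u"
        using vertex_avg_square_Suc[of 1 0 u] by (simp add: u0)
      then show ?thesis
        using e sg_energy_level_le_energy[OF u, of 1] unfolding 0 e_def[symmetric]
        by (simp add: power2_eq_square del: vertex_avg.simps)
    next
      case (Suc k)
      define a where "a = 1 - (1/2 :: real) ^ m"
      define b where "b = (1/2 :: real) ^ Suc m"
      have "(1/2 :: real) ^ m < 1" unfolding Suc by (rule power_Suc_less_one) auto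
      then have a: "0 < a" by (simp add: a_def)
      have b: "0 < b" by (simp add: b_def)
      \<comment> \<open>\<open>t = b/a\<close> minimizes the right-hand side and turns it into
        \<open>(a + b)\<^sup>2 * e\<close>. For \<open>m = 0\<close> the value of \<open>a\<close>
        would be 0, which is why that case was settled separately with \<open>t = 1\<close>.\<close>
      have "vertex_avg (Suc m) (\<lambda>x. (u x)\<^sup>2) \<le> (1 + b/a) * vertex_avg m (\<lambda>x. (u x)\<^sup>2) + (1 + 1/(b/a)) * b\<^sup>2 * e"
        using step[of "b/a" m] a b unfolding b_def by simp
      also have "\<dots> \<le> (1 + b/a) * (a\<^sup>2 * e) + (1 + 1/(b/a)) * b\<^sup>2 * e"
        using a b Suc.IH unfolding a_def by (intro add_right_mono mult_left_mono) auto
      also have "\<dots> = (a + b)\<^sup>2 * e" using a b by (simp add: field_simps power2_eq_square)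
      also have "a + b = 1 - (1/2) ^ Suc m" by (simp add: a_def b_def)
      finally show ?thesis .
    qed
  qed
  moreover have "(1 - (1/2) ^ m)\<^sup>2 * e \<le> e" for m
  proof -
    have "(1 - (1/2 :: real) ^ m)\<^sup>2 \<le> 1" by (rule power_le_one) (auto simp: power_le_one)
    then show ?thesis using e by (simp add: mult_left_le_one_le)
  qed
  ultimately have le: "vertex_avg m (\<lambda>x. (u x)\<^sup>2) \<le> e" for m by (meson order_trans)
  show ?thesis unfolding e_def[symmetric]
    by (rule LIMSEQ_le_const2[OF vertex_avg_tendsto])
      (use le sg_dom_energy_continuous[OF u] in \<open>auto intro!: continuous_intros\<close>)
qed

subsection \<open>The Laplacian\<close>

text \<open>A test function transplanted into one cell and extended by 0 is again admissible, so the
  annihilation property passes from \<open>h\<close> to every \<open>h \<circ> sg_word w\<close>.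
  After that, one fixed test function with nonzero integral suffices to localize.\<close>

lemma test_function_zero:
  assumes h: "continuous_on SG h"
    and zero: "\<And>v. v \<in> sg_dom_energy \<Longrightarrow> (\<And>i. v (sg_vertex i) = 0) \<Longrightarrow> I (\<lambda>x. h x * v x) = 0"
    and x: "x \<in> SG"
  shows "h x = 0"
proof -
  define Z where "Z h \<longleftrightarrow> continuous_on SG h \<and>
    (\<forall>v\<in>sg_dom_energy. (\<forall>i. v (sg_vertex i) = 0) \<longrightarrow> I (\<lambda>x. h x * v x) = 0)" for h
  have Z_map: "Z (\<lambda>x. h (sg_map i x))" if "Z h" for h i
    unfolding Z_def
  proof (intro conjI ballI impI)
    show "continuous_on SG (\<lambda>x. h (sg_map i x))" using that by (auto simp: Z_def continuous_on_SG_sg_map)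
    fix v assume v: "v \<in> sg_dom_energy" "\<forall>i. v (sg_vertex i) = 0"
    define \<phi> where "\<phi> j = (if j = i then v else (\<lambda>x. 0))" for j
    have compat: "\<phi> j (sg_vertex k) = \<phi> k (sg_vertex j)" for j k by (simp add: \<phi>_def v)
    have map: "glue \<phi> (sg_map j x) = \<phi> j x" if "x \<in> SG" for j x
      using compat that by (rule glue_sg_map)
    obtain B where B: "\<And>m. sg_energy_level m v v \<le> B" using v(1) by (auto simp: sg_dom_energy_iff)
    have bound: "sg_energy_level m (\<phi> j) (\<phi> j) \<le> \<bar>B\<bar>" for m j
      using B[of m] by (cases "j = i") (auto simp: \<phi>_def sg_energy_level_def)
    have cont: "continuous_on SG (glue \<phi>)"
      by (rule continuous_on_glue[of \<phi>, OF compat]) (auto simp: \<phi>_def sg_dom_energy_continuous v)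
    have "sg_energy_level m (glue \<phi>) (glue \<phi>) \<le> 5 * \<bar>B\<bar>" for m
    proof -
      have "sg_energy_level m (glue \<phi>) (glue \<phi>) \<le> sg_energy_level (Suc m) (glue \<phi>) (glue \<phi>)"
        by (rule sg_energy_level_mono_Suc)
      also have "\<dots> = 5/3 * (\<Sum>j\<in>UNIV. sg_energy_level m (\<phi> j) (\<phi> j))"
        by (rule sg_energy_level_glue[of \<phi> \<phi>, OF compat compat])
      also have "\<dots> \<le> 5/3 * (\<Sum>j\<in>(UNIV :: 3 set). \<bar>B\<bar>)"
        by (intro mult_left_mono sum_mono bound) auto
      finally show ?thesis by simp
    qed
    then have dom: "glue \<phi> \<in> sg_dom_energy" using cont by (auto simp: sg_dom_energy_iff)
    have "glue \<phi> (sg_vertex k) = 0" for k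
      using map[of "sg_vertex k" k] by (simp add: \<phi>_def v)
    then have "0 = I (\<lambda>x. h x * glue \<phi> x)" using dom that by (simp add: Z_def)
    also have "\<dots> = (\<Sum>j\<in>UNIV. I (\<lambda>x. h (sg_map j x) * glue \<phi> (sg_map j x))) / 3"
      by (rule I_self_similar) (use that cont in \<open>auto simp: Z_def intro!: continuous_intros\<close>)
    also have "(\<Sum>j\<in>UNIV. I (\<lambda>x. h (sg_map j x) * glue \<phi> (sg_map j x))) =
        (\<Sum>j\<in>UNIV. if j = i then I (\<lambda>x. h (sg_map i x) * v x) else 0)"
    proof (rule sum.cong[OF refl])
      fix j
      have "I (\<lambda>x. h (sg_map j x) * glue \<phi> (sg_map j x)) = I (\<lambda>x. h (sg_map j x) * \<phi> j x)"
        by (rule I_cong) (simp add: map)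
      then show "I (\<lambda>x. h (sg_map j x) * glue \<phi> (sg_map j x)) =
          (if j = i then I (\<lambda>x. h (sg_map i x) * v x) else 0)"
        using I_const[of 0] by (simp add: \<phi>_def)
    qed
    finally show "I (\<lambda>x. h (sg_map i x) * v x) = 0" by simp
  qed
  have Z_word: "Z h \<Longrightarrow> Z (\<lambda>x. h (sg_word w x))" for h w
    by (induction w arbitrary: h) (use Z_map in auto)
  \<comment> \<open>\<open>\<psi>\<close> is piecewise harmonic with value 1 at the three junction
    points and 0 at the outer vertices; its mean on each cell is 2/3.\<close>
  define a where "a i = (\<lambda>j. if j = i then 0 else 1 :: real)" for i :: 3
  define \<psi> where "\<psi> = glue (\<lambda>i. sg_harm (a i))"
  have compat: "sg_harm (a i) (sg_vertex j) = sg_harm (a j) (sg_vertex i)" for i j by (simp add: a_def)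
  have map: "\<psi> (sg_map j x) = sg_harm (a j) x" if "x \<in> SG" for j x
    unfolding \<psi>_def by (rule glue_sg_map[of "\<lambda>i. sg_harm (a i)", OF compat that])
  have cont: "continuous_on SG \<psi>"
    unfolding \<psi>_def by (rule continuous_on_glue[of "\<lambda>i. sg_harm (a i)", OF compat continuous_on_harm])
  have "sg_energy_level m \<psi> \<psi> \<le> 5/3 * (\<Sum>i\<in>UNIV. sg_energy_level 0 (sg_harm (a i)) (sg_harm (a i)))" for m
  proof -
    have "sg_energy_level m \<psi> \<psi> \<le> sg_energy_level (Suc m) \<psi> \<psi>" by (rule sg_energy_level_mono_Suc)
    also have "\<dots> = 5/3 * (\<Sum>i\<in>UNIV. sg_energy_level m (sg_harm (a i)) (sg_harm (a i)))"
      unfolding \<psi>_def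
      by (rule sg_energy_level_glue[of "\<lambda>i. sg_harm (a i)" "\<lambda>i. sg_harm (a i)", OF compat compat])
    finally show ?thesis by (simp only: sg_energy_level_harm_eq[of m])
  qed
  then have dom: "\<psi> \<in> sg_dom_energy" using cont unfolding sg_dom_energy_iff by blast
  have van: "\<psi> (sg_vertex k) = 0" for k using map[of "sg_vertex k" k] by (simp add: a_def)
  have "I \<psi> = (\<Sum>j\<in>UNIV. I (sg_harm (a j))) / 3"
    unfolding I_self_similar[OF cont]
    by (intro arg_cong[where f = "\<lambda>t. t / 3"] sum.cong refl I_cong map)
  also have "\<dots> = 2/3" by (simp add: I_harm sum_3_from_0 a_def)
  finally have "I \<psi> \<noteq> 0" by simp
  moreover have "Z h" using h zero by (auto simp: Z_def)
  then have "I (\<lambda>x. h (sg_word w x) * \<psi> x) = 0" for w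
    using Z_word[of h w] dom van by (auto simp: Z_def)
  ultimately show ?thesis using localize_zero[OF cont _ h _ x] by blast
qed

lemma has_laplacian_iff:
  "sg_has_laplacian \<mu> u f \<longleftrightarrow> u \<in> sg_dom_energy \<and> continuous_on SG f \<and>
     (\<forall>v\<in>sg_dom_energy. (\<forall>i. v (sg_vertex i) = 0) \<longrightarrow> sg_energy u v = - I (\<lambda>x. f x * v x))"
  by (simp add: sg_has_laplacian_def I_def sg_V0_def)

lemma has_laplacianD:
  assumes "sg_has_laplacian \<mu> u f"
  shows "u \<in> sg_dom_energy" "continuous_on SG u" "continuous_on SG f"
    "\<And>v. v \<in> sg_dom_energy \<Longrightarrow> (\<And>i. v (sg_vertex i) = 0) \<Longrightarrow> sg_energy u v = - I (\<lambda>x. f x * v x)"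
  using assms by (auto simp: has_laplacian_iff sg_dom_energy_continuous)

lemma has_laplacian_unique:
  assumes "sg_has_laplacian \<mu> u f" "sg_has_laplacian \<mu> u g" "x \<in> SG"
  shows "f x = g x"
proof -
  note f = has_laplacianD[OF assms(1)] and g = has_laplacianD[OF assms(2)]
  have "f x - g x = 0"
  proof (rule test_function_zero[OF _ _ assms(3)])
    fix v assume v: "v \<in> sg_dom_energy" "\<And>i. v (sg_vertex i) = 0"
    have "I (\<lambda>x. (f x - g x) * v x) = I (\<lambda>x. f x * v x) - I (\<lambda>x. g x * v x)"
      unfolding left_diff_distrib
      by (rule I_diff) (intro continuous_intros f(3) g(3) sg_dom_energy_continuous v)+
    also have "\<dots> = 0" using f(4)[OF v] g(4)[OF v] by simp
    finally show "I (\<lambda>x. (f x - g x) * v x) = 0" .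
  qed (intro continuous_intros f g)
  then show ?thesis by simp
qed

lemma has_laplacian_cong:
  assumes "sg_has_laplacian \<mu> u f" "\<And>x. x \<in> SG \<Longrightarrow> u x = u' x" "\<And>x. x \<in> SG \<Longrightarrow> f x = f' x"
  shows "sg_has_laplacian \<mu> u' f'"
proof -
  have "u' \<in> sg_dom_energy" using sg_dom_energy_cong[of u u'] assms has_laplacianD(1) by blast
  moreover have "continuous_on SG f'"
    using continuous_on_eq[OF has_laplacianD(3)[OF assms(1)]] assms(3) by blast
  moreover have "sg_energy u' v = - I (\<lambda>x. f' x * v x)"
    if "v \<in> sg_dom_energy" "\<forall>i. v (sg_vertex i) = 0" for v
  proof -
    have "sg_energy u' v = sg_energy u v" by (rule sg_energy_cong) (auto simp: assms)
    also have "\<dots> = - I (\<lambda>x. f x * v x)" using has_laplacianD(4)[OF assms(1)] that by blast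
    also have "I (\<lambda>x. f x * v x) = I (\<lambda>x. f' x * v x)" by (rule I_cong) (simp add: assms)
    finally show ?thesis .
  qed
  ultimately show ?thesis by (simp add: has_laplacian_iff)
qed

lemma sg_laplacian_eq:
  assumes "sg_has_laplacian \<mu> u f" "x \<in> SG"
  shows "sg_laplacian \<mu> u x = f x"
  using has_laplacian_unique[OF _ assms] someI[of "sg_has_laplacian \<mu> u", OF assms(1)]
  by (simp add: sg_laplacian_def)

lemma has_laplacian_scale:
  assumes "sg_has_laplacian \<mu> u f"
  shows "sg_has_laplacian \<mu> (\<lambda>x. c * u x) (\<lambda>x. c * f x)"
proof -
  note u = has_laplacianD[OF assms]
  have "sg_energy (\<lambda>x. c * u x) v = - I (\<lambda>x. c * f x * v x)"
    if "v \<in> sg_dom_energy" "\<forall>i. v (sg_vertex i) = 0" for v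
    using sg_energy_scale[OF u(1) that(1), of c] u(4)[OF that(1)] that(2)
      I_scale[of c "\<lambda>x. f x * v x"] by (simp add: mult.assoc)
  then show ?thesis
    using u by (auto simp: has_laplacian_iff sg_dom_energy_scale intro!: continuous_intros)
qed

lemma has_laplacian_add:
  assumes "sg_has_laplacian \<mu> u f" "sg_has_laplacian \<mu> w g"
  shows "sg_has_laplacian \<mu> (\<lambda>x. u x + w x) (\<lambda>x. f x + g x)"
proof -
  note u = has_laplacianD[OF assms(1)] and w = has_laplacianD[OF assms(2)]
  have "sg_energy (\<lambda>x. u x + w x) v = - I (\<lambda>x. (f x + g x) * v x)"
    if v: "v \<in> sg_dom_energy" "\<forall>i. v (sg_vertex i) = 0" for v
  proof -
    have "I (\<lambda>x. (f x + g x) * v x) = I (\<lambda>x. f x * v x) + I (\<lambda>x. g x * v x)"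
      unfolding distrib_right
      by (rule I_add) (intro continuous_intros u(3) w(3) sg_dom_energy_continuous v)+
    then show ?thesis
      using sg_energy_add[OF u(1) w(1) v(1)] u(4)[OF v(1)] w(4)[OF v(1)] v(2) by simp
  qed
  then show ?thesis
    using u w by (auto simp: has_laplacian_iff sg_dom_energy_add intro!: continuous_intros)
qed

lemma has_laplacian_diff:
  assumes "sg_has_laplacian \<mu> u f" "sg_has_laplacian \<mu> w g"
  shows "sg_has_laplacian \<mu> (\<lambda>x. u x - w x) (\<lambda>x. f x - g x)"
  using has_laplacian_add[OF assms(1) has_laplacian_scale[OF assms(2), of "-1"]] by simp

text \<open>The energy of a harmonic function against \<open>v\<close> collapses to level 0, where
  it sees only the vanishing boundary values of \<open>v\<close>.\<close>

lemma has_laplacian_harm: "sg_has_laplacian \<mu> (sg_harm a) (\<lambda>x. 0)"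
  using I_const[of 0] by (simp add: has_laplacian_iff harm_dom_energy sg_energy_harm sg_energy_level_0)

lemma has_laplacian_refl:
  assumes "sg_has_laplacian \<mu> u f"
  shows "sg_has_laplacian \<mu> (\<lambda>x. u (sg_refl x)) (\<lambda>x. f (sg_refl x))"
proof -
  note u = has_laplacianD[OF assms]
  have inv: "sg_refl (sg_refl x) = x" for x
    by (simp add: sg_refl_def vec_eq_iff forall_2)
  have "sg_energy (\<lambda>x. u (sg_refl x)) v = - I (\<lambda>x. f (sg_refl x) * v x)"
    if v: "v \<in> sg_dom_energy" "\<forall>i. v (sg_vertex i) = 0" for v
  proof -
    define v' where "v' x = v (sg_refl x)" for x
    have v': "v' \<in> sg_dom_energy" "\<And>i. v' (sg_vertex i) = 0" "v = (\<lambda>x. v' (sg_refl x))"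
      using v by (auto simp: v'_def[abs_def] sg_dom_energy_refl refl_sg_vertex inv)
    have "sg_energy (\<lambda>x. u (sg_refl x)) v = sg_energy u v'"
      unfolding v'(3) by (rule sg_energy_refl)
    also have "\<dots> = - I (\<lambda>x. f x * v' x)" using u(4) v' by blast
    also have "I (\<lambda>x. f x * v' x) = I (\<lambda>x. f (sg_refl x) * v' (sg_refl x))"
      by (rule I_refl[symmetric]) (intro continuous_intros u sg_dom_energy_continuous v')
    finally show ?thesis by (simp add: v'(3))
  qed
  then show ?thesis using u by (auto simp: has_laplacian_iff sg_dom_energy_refl continuous_on_SG_refl)
qed

end

section \<open>Normal and tangential derivatives at the vertex 0\<close>

lemma sg_map_funpow_in_SG: "x \<in> SG \<Longrightarrow> (sg_map i ^^ m) x \<in> SG"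
  by (induction m) auto

lemma refl_sg_map_funpow: "sg_refl ((sg_map 0 ^^ m) x) = (sg_map 0 ^^ m) (sg_refl x)"
  by (induction m) (simp_all add: refl_sg_map)

lemma sg_has_normal_deriv_0:
  "sg_has_normal_deriv u 0 d \<longleftrightarrow>
     (\<lambda>m. (5/3) ^ m * (2 * u (sg_vertex 0) - u ((sg_map 0 ^^ m) (sg_vertex 1))
                                          - u ((sg_map 0 ^^ m) (sg_vertex 2)))) \<longlonglongrightarrow> d"
proof -
  have "(0 :: 3) - 1 = 2" by simp
  then show ?thesis unfolding sg_has_normal_deriv_def by (simp only: add_0)
qed

lemma sg_has_tangential_deriv_0:
  "sg_has_tangential_deriv u 0 d \<longleftrightarrow>
     (\<lambda>m. 5 ^ m * (u ((sg_map 0 ^^ m) (sg_vertex 1)) - u ((sg_map 0 ^^ m) (sg_vertex 2)))) \<longlonglongrightarrow> d"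
proof -
  have "(0 :: 3) - 1 = 2" by simp
  then show ?thesis unfolding sg_has_tangential_deriv_def by (simp only: add_0)
qed

lemma sg_deriv_cong:
  assumes "\<And>x. x \<in> SG \<Longrightarrow> u x = v x"
  shows "sg_has_normal_deriv u i d \<longleftrightarrow> sg_has_normal_deriv v i d"
    "sg_has_tangential_deriv u i d \<longleftrightarrow> sg_has_tangential_deriv v i d"
  by (simp_all add: sg_has_normal_deriv_def sg_has_tangential_deriv_def assms sg_map_funpow_in_SG)

lemma sg_deriv_unique:
  "sg_has_normal_deriv u i d \<Longrightarrow> sg_has_normal_deriv u i d' \<Longrightarrow> d = d'"
  "sg_has_tangential_deriv u i d \<Longrightarrow> sg_has_tangential_deriv u i d' \<Longrightarrow> d = d'"
  unfolding sg_has_normal_deriv_def sg_has_tangential_deriv_def by (rule LIMSEQ_unique; assumption)+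

lemma sg_normal_deriv_diff:
  assumes "sg_has_normal_deriv u i d" "sg_has_normal_deriv v i e"
  shows "sg_has_normal_deriv (\<lambda>x. u x - v x) i (d - e)"
  using tendsto_diff[OF assms[unfolded sg_has_normal_deriv_def]]
  unfolding sg_has_normal_deriv_def by (simp add: algebra_simps)

lemma sg_tangential_deriv_diff:
  assumes "sg_has_tangential_deriv u i d" "sg_has_tangential_deriv v i e"
  shows "sg_has_tangential_deriv (\<lambda>x. u x - v x) i (d - e)"
  using tendsto_diff[OF assms[unfolded sg_has_tangential_deriv_def]]
  unfolding sg_has_tangential_deriv_def by (simp add: algebra_simps)

lemma sg_normal_deriv_refl:
  assumes "sg_has_normal_deriv u 0 d"
  shows "sg_has_normal_deriv (\<lambda>x. c * u (sg_refl x)) 0 (c * d)"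
  using tendsto_mult_left[OF assms[unfolded sg_has_normal_deriv_0], of c]
  unfolding sg_has_normal_deriv_0
  by (simp add: refl_sg_map_funpow refl_sg_vertex uminus_3 algebra_simps)

lemma sg_tangential_deriv_refl:
  assumes "sg_has_tangential_deriv u 0 d"
  shows "sg_has_tangential_deriv (\<lambda>x. c * u (sg_refl x)) 0 (- (c * d))"
  using tendsto_mult_left[OF assms[unfolded sg_has_tangential_deriv_0], of "- c"]
  unfolding sg_has_tangential_deriv_0
  by (simp add: refl_sg_map_funpow refl_sg_vertex uminus_3 algebra_simps)

text \<open>The functionals \<open>2 * a 0 - a 1 - a 2\<close> and \<open>a 1 - a 2\<close> are
  multiplied by 3/5 and 1/5 under \<open>harm_step\<close> in cell 0. The weights
  \<open>(5/3) ^ m\<close> and \<open>5 ^ m\<close> cancel this exactly, so both defining sequences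
  are constant.\<close>

lemma sg_harm_derivs:
  "sg_has_normal_deriv (sg_harm a) 0 (2 * a 0 - a 1 - a 2)"
  "sg_has_tangential_deriv (sg_harm a) 0 (a 1 - a 2)"
proof -
  let ?x = "\<lambda>m. (sg_map 0 ^^ m) (sg_vertex 1)" and ?y = "\<lambda>m. (sg_map 0 ^^ m) (sg_vertex 2)"
  have xy: "?x m \<in> SG" "?y m \<in> SG" for m by (auto intro: sg_map_funpow_in_SG)
  have step: "harm_step a 0 0 = a 0" "harm_step a 0 1 = (2 * a 0 + 2 * a 1 + a 2) / 5"
    "harm_step a 0 2 = (2 * a 0 + a 1 + 2 * a 2) / 5" for a
    by (simp_all add: harm_step_def)
  have "(5/3) ^ m * (2 * a 0 - sg_harm a (?x m) - sg_harm a (?y m)) = 2 * a 0 - a 1 - a 2" for m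
  proof (induction m arbitrary: a)
    case (Suc m)
    have "(5/3) ^ m * (2 * a 0 - sg_harm a (?x (Suc m)) - sg_harm a (?y (Suc m)))
        = 3/5 * (2 * a 0 - a 1 - a 2)"
      using Suc[of "harm_step a 0"] by (simp add: harm_sg_map xy step field_simps)
    note IH = this
    show ?case unfolding power_Suc[of _ m] mult.assoc IH by simp
  qed simp
  then show "sg_has_normal_deriv (sg_harm a) 0 (2 * a 0 - a 1 - a 2)"
    unfolding sg_has_normal_deriv_0 harm_vertex by (simp only: tendsto_const)
  have "5 ^ m * (sg_harm a (?x m) - sg_harm a (?y m)) = a 1 - a 2" for m
  proof (induction m arbitrary: a)
    case (Suc m)
    have "5 ^ m * (sg_harm a (?x (Suc m)) - sg_harm a (?y (Suc m))) = (a 1 - a 2) / 5"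
      using Suc[of "harm_step a 0"] by (simp add: harm_sg_map xy step field_simps)
    note IH = this
    show ?case unfolding power_Suc[of _ m] mult.assoc IH by simp
  qed simp
  then show "sg_has_tangential_deriv (sg_harm a) 0 (a 1 - a 2)"
    unfolding sg_has_tangential_deriv_0 by (simp only: tendsto_const)
qed

context sg_measure_space
begin

lemma cauchy_schwarz:
  assumes "continuous_on SG f" "continuous_on SG g"
  shows "(I (\<lambda>x. f x * g x))\<^sup>2 \<le> I (\<lambda>x. (f x)\<^sup>2) * I (\<lambda>x. (g x)\<^sup>2)"
proof -
  define A where "A = I (\<lambda>x. (f x)\<^sup>2)"
  define B where "B = I (\<lambda>x. (g x)\<^sup>2)"
  define C where "C = I (\<lambda>x. f x * g x)"
  have B0: "0 \<le> B" unfolding B_def by (rule I_nonneg) (auto intro!: continuous_intros assms)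
  have "C\<^sup>2 \<le> A * B"
  proof (cases "B = 0")
    case True
    then have "g x = 0" if "x \<in> SG" for x
      using I_eq_0_imp[of "\<lambda>x. (g x)\<^sup>2" x] that assms
      by (auto simp: B_def intro!: continuous_intros)
    then have "C = I (\<lambda>x. 0)" unfolding C_def by (intro I_cong) simp
    then show ?thesis using True I_const[of 0] by simp
  next
    case False
    have "0 \<le> I (\<lambda>x. (B * f x - C * g x)\<^sup>2)"
      by (rule I_nonneg) (auto intro!: continuous_intros assms)
    also have "\<dots> = I (\<lambda>x. (B\<^sup>2 * (f x)\<^sup>2 + C\<^sup>2 * (g x)\<^sup>2) - 2 * B * C * (f x * g x))"
      by (rule I_cong) (simp add: power2_eq_square algebra_simps)
    also have "\<dots> = B\<^sup>2 * A + C\<^sup>2 * B - 2 * B * C * C"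
      unfolding A_def B_def C_def
      by (subst I_diff, (intro continuous_intros assms)+, subst I_add, (intro continuous_intros assms)+)
        (simp only: I_scale)
    also have "\<dots> = B * (A * B - C\<^sup>2)" by (simp add: power2_eq_square algebra_simps)
    finally show ?thesis using B0 False by (simp add: zero_le_mult_iff)
  qed
  then show ?thesis by (simp add: A_def B_def C_def)
qed

end

subsection \<open>The Green operator\<close>

locale sg_green_space = sg_measure_space +
  fixes G :: "point \<Rightarrow> point \<Rightarrow> real"
  assumes green: "sg_green \<mu> G"
begin

definition Gop :: "(point \<Rightarrow> real) \<Rightarrow> point \<Rightarrow> real" where
  "Gop f x = I (\<lambda>y. G x y * f y)"

lemma green_iff:
  assumes "continuous_on SG f"
  shows "sg_has_laplacian \<mu> u (\<lambda>x. - f x) \<and> (\<forall>i. u (sg_vertex i) = 0) \<longleftrightarrow> (\<forall>x\<in>SG. u x = Gop f x)"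
  using green assms by (auto simp: sg_green_def sg_V0_def Gop_def I_def)

lemma has_laplacian_Gop: "continuous_on SG f \<Longrightarrow> sg_has_laplacian \<mu> (Gop f) (\<lambda>x. - f x)"
  and Gop_vertex: "continuous_on SG f \<Longrightarrow> Gop f (sg_vertex i) = 0"
  using green_iff[of f "Gop f"] by auto

lemma Gop_unique:
  assumes "sg_has_laplacian \<mu> u g" "\<And>i. u (sg_vertex i) = 0" "\<And>x. x \<in> SG \<Longrightarrow> g x = - f x" "x \<in> SG"
  shows "u x = Gop f x"
proof -
  have lap: "sg_has_laplacian \<mu> u (\<lambda>x. - f x)"
    by (rule has_laplacian_cong[OF assms(1)]) (auto simp: assms(3))
  have "continuous_on SG (\<lambda>x. - (- f x))"
    by (rule continuous_on_minus) (rule has_laplacianD(3)[OF lap])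
  then show ?thesis using green_iff[of f u] lap assms(2,4) by auto
qed

text \<open>Uniqueness for the Dirichlet problem is contained in the equivalence that defines
  \<open>sg_green\<close>, taken with right-hand side 0.\<close>

lemma harmonic_eq_0:
  assumes "sg_has_laplacian \<mu> u g" "\<And>x. x \<in> SG \<Longrightarrow> g x = 0" "\<And>i. u (sg_vertex i) = 0" "x \<in> SG"
  shows "u x = 0"
proof -
  have "u x = Gop (\<lambda>x. 0) x" by (rule Gop_unique[OF assms(1,3) _ assms(4)]) (simp add: assms(2))
  then show ?thesis using I_const[of 0] by (simp add: Gop_def)
qed

text \<open>Subtracting the explicit harmonic function leaves zero boundary values. Questions about
  harmonic functions thereby become linear algebra in three numbers.\<close>

lemma harmonic_eq_harm:
  assumes "sg_has_laplacian \<mu> u g" "\<And>x. x \<in> SG \<Longrightarrow> g x = 0" "x \<in> SG"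
  shows "u x = sg_harm (\<lambda>i. u (sg_vertex i)) x"
proof -
  have "u x - sg_harm (\<lambda>i. u (sg_vertex i)) x = 0"
    by (rule harmonic_eq_0[OF has_laplacian_diff[OF assms(1) has_laplacian_harm] _ _ assms(3)])
      (simp_all add: assms(2))
  then show ?thesis by simp
qed

text \<open>The data at the vertex 0 are the linear functionals \<open>a 0\<close>,
  \<open>2 * a 0 - a 1 - a 2\<close> and \<open>a 1 - a 2\<close> of the boundary values, and these
  three are independent.\<close>

lemma harmonic_cauchy_zero:
  assumes lap: "sg_has_laplacian \<mu> u g" "\<And>x. x \<in> SG \<Longrightarrow> g x = 0"
    and "u (sg_vertex 0) = 0" "sg_has_normal_deriv u 0 0" "sg_has_tangential_deriv u 0 0" "x \<in> SG"
  shows "u x = 0"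
proof (rule harmonic_eq_0[OF lap _ \<open>x \<in> SG\<close>])
  define a where "a = (\<lambda>i. u (sg_vertex i))"
  have eq: "u x = sg_harm a x" if "x \<in> SG" for x
    unfolding a_def by (rule harmonic_eq_harm[OF lap that])
  have "sg_has_normal_deriv (sg_harm a) 0 0" "sg_has_tangential_deriv (sg_harm a) 0 0"
    using assms(4,5) sg_deriv_cong[of u "sg_harm a"] eq by simp_all
  then have "2 * a 0 - a 1 - a 2 = 0" "a 1 - a 2 = 0"
    using sg_deriv_unique(1)[OF sg_harm_derivs(1)] sg_deriv_unique(2)[OF sg_harm_derivs(2)] by auto
  moreover have "a 0 = 0" using assms(3) by (simp add: a_def)
  ultimately have "\<forall>i. a i = 0" unfolding forall_3_from_0 by simp
  then show "u (sg_vertex i) = 0" for i by (simp add: a_def)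
qed

subsection \<open>Monomials\<close>

lemma sg_monomialE:
  assumes "sg_monomial \<mu> j k u"
  obtains D where "D 0 = u" "\<And>n. n \<le> j \<Longrightarrow> sg_has_laplacian \<mu> (D n) (D (Suc n))"
    "\<And>x. x \<in> SG \<Longrightarrow> D (Suc j) x = 0"
    "\<And>n. n \<le> j \<Longrightarrow> D n (sg_vertex 0) = (if n = j \<and> k = 1 then 1 else 0)"
    "\<And>n. n \<le> j \<Longrightarrow> sg_has_normal_deriv (D n) 0 (if n = j \<and> k = 2 then 1 else 0)"
    "\<And>n. n \<le> j \<Longrightarrow> sg_has_tangential_deriv (D n) 0 (if n = j \<and> k = 3 then 1 else 0)"
  using assms unfolding sg_monomial_def by (elim exE conjE) (rule that; blast)

lemma monomial_unique:
  assumes "sg_monomial \<mu> j k u" "sg_monomial \<mu> j k v" "x \<in> SG"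
  shows "u x = v x"
proof -
  obtain D where D: "D 0 = u" "\<And>n. n \<le> j \<Longrightarrow> sg_has_laplacian \<mu> (D n) (D (Suc n))"
    "\<And>x. x \<in> SG \<Longrightarrow> D (Suc j) x = 0"
    "\<And>n. n \<le> j \<Longrightarrow> D n (sg_vertex 0) = (if n = j \<and> k = 1 then 1 else 0)"
    "\<And>n. n \<le> j \<Longrightarrow> sg_has_normal_deriv (D n) 0 (if n = j \<and> k = 2 then 1 else 0)"
    "\<And>n. n \<le> j \<Longrightarrow> sg_has_tangential_deriv (D n) 0 (if n = j \<and> k = 3 then 1 else 0)"
    using assms(1) by (rule sg_monomialE) (rule that; blast)
  obtain D' where D': "D' 0 = v" "\<And>n. n \<le> j \<Longrightarrow> sg_has_laplacian \<mu> (D' n) (D' (Suc n))"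
    "\<And>x. x \<in> SG \<Longrightarrow> D' (Suc j) x = 0"
    "\<And>n. n \<le> j \<Longrightarrow> D' n (sg_vertex 0) = (if n = j \<and> k = 1 then 1 else 0)"
    "\<And>n. n \<le> j \<Longrightarrow> sg_has_normal_deriv (D' n) 0 (if n = j \<and> k = 2 then 1 else 0)"
    "\<And>n. n \<le> j \<Longrightarrow> sg_has_tangential_deriv (D' n) 0 (if n = j \<and> k = 3 then 1 else 0)"
    using assms(2) by (rule sg_monomialE) (rule that; blast)
  have "\<forall>x\<in>SG. D 0 x - D' 0 x = 0"
  \<comment> \<open>Downward induction: once the Laplacians agree, \<open>D n\<close> and
    \<open>D' n\<close> differ by a harmonic function with zero Cauchy data. It starts from the
    vanishing of both chains at \<open>Suc j\<close>.\<close>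
  proof (rule inc_induct[of 0 "Suc j"])
    fix n assume n: "n < Suc j" and IH: "\<forall>x\<in>SG. D (Suc n) x - D' (Suc n) x = 0"
    then have n': "n \<le> j" by simp
    show "\<forall>x\<in>SG. D n x - D' n x = 0"
    proof
      fix x assume x: "x \<in> SG"
      show "D n x - D' n x = 0"
      proof (rule harmonic_cauchy_zero[OF has_laplacian_diff[OF D(2)[OF n'] D'(2)[OF n']] _ _ _ _ x])
        show "D n (sg_vertex 0) - D' n (sg_vertex 0) = 0" unfolding D(4)[OF n'] D'(4)[OF n'] by simp
        show "sg_has_normal_deriv (\<lambda>x. D n x - D' n x) 0 0"
          using sg_normal_deriv_diff[OF D(5)[OF n'] D'(5)[OF n']] unfolding diff_self .
        show "sg_has_tangential_deriv (\<lambda>x. D n x - D' n x) 0 0"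
          using sg_tangential_deriv_diff[OF D(6)[OF n'] D'(6)[OF n']] unfolding diff_self .
      qed (use IH in blast)
    qed
  qed (use D(3) D'(3) in auto)
  then show ?thesis using assms(3) by (simp add: D D')
qed

lemma monomial_laplacian_0:
  assumes "sg_monomial \<mu> 0 k u" shows "sg_has_laplacian \<mu> u (\<lambda>x. 0)"
proof -
  obtain D where D: "D 0 = u" "\<And>n. n \<le> 0 \<Longrightarrow> sg_has_laplacian \<mu> (D n) (D (Suc n))"
    "\<And>x. x \<in> SG \<Longrightarrow> D (Suc 0) x = 0"
    "\<And>n. n \<le> 0 \<Longrightarrow> D n (sg_vertex 0) = (if n = 0 \<and> k = 1 then 1 else 0)"
    "\<And>n. n \<le> 0 \<Longrightarrow> sg_has_normal_deriv (D n) 0 (if n = 0 \<and> k = 2 then 1 else 0)"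
    "\<And>n. n \<le> 0 \<Longrightarrow> sg_has_tangential_deriv (D n) 0 (if n = 0 \<and> k = 3 then 1 else 0)"
    using assms by (rule sg_monomialE) (rule that; blast)
  show ?thesis by (rule has_laplacian_cong[OF D(2)[OF le0]]) (simp_all add: D(1,3))
qed

text \<open>Dropping the first entry of the chain for \<open>u\<close> leaves the chain of a
  monomial of degree \<open>j\<close>; uniqueness identifies its head with \<open>v\<close> on
  \<open>SG\<close>.\<close>

lemma monomial_laplacian_Suc:
  assumes "sg_monomial \<mu> (Suc j) k u" "sg_monomial \<mu> j k v"
  shows "sg_has_laplacian \<mu> u v"
proof -
  obtain D where D: "D 0 = u" "\<And>n. n \<le> Suc j \<Longrightarrow> sg_has_laplacian \<mu> (D n) (D (Suc n))"
    "\<And>x. x \<in> SG \<Longrightarrow> D (Suc (Suc j)) x = 0"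
    "\<And>n. n \<le> Suc j \<Longrightarrow> D n (sg_vertex 0) = (if n = Suc j \<and> k = 1 then 1 else 0)"
    "\<And>n. n \<le> Suc j \<Longrightarrow> sg_has_normal_deriv (D n) 0 (if n = Suc j \<and> k = 2 then 1 else 0)"
    "\<And>n. n \<le> Suc j \<Longrightarrow> sg_has_tangential_deriv (D n) 0 (if n = Suc j \<and> k = 3 then 1 else 0)"
    using assms(1) by (rule sg_monomialE) (rule that; blast)
  have "sg_monomial \<mu> j k (D (Suc 0))"
    unfolding sg_monomial_def
  proof (intro exI[of _ "\<lambda>n. D (Suc n)"] conjI allI impI ballI)
    fix n assume "n \<le> j"
    then have "Suc n \<le> Suc j" by simp
    from D(2)[OF this] D(4-6)[OF this] show
      "sg_has_laplacian \<mu> (D (Suc n)) (D (Suc (Suc n)))"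
      "D (Suc n) (sg_vertex 0) = (if n = j \<and> k = 1 then 1 else 0)"
      "sg_has_normal_deriv (D (Suc n)) 0 (if n = j \<and> k = 2 then 1 else 0)"
      "sg_has_tangential_deriv (D (Suc n)) 0 (if n = j \<and> k = 3 then 1 else 0)"
      by simp_all
  qed (use D(3) in auto)
  then have "D (Suc 0) x = v x" if "x \<in> SG" for x using monomial_unique assms(2) that by blast
  then show ?thesis using has_laplacian_cong[OF D(2)[of 0], of u v] by (simp add: D(1))
qed

lemma monomial_props:
  assumes "sg_monomial \<mu> j k u"
  shows monomial_continuous: "continuous_on SG u"
    and monomial_at_0: "u (sg_vertex 0) = (if j = 0 \<and> k = 1 then 1 else 0)"
    and monomial_normal: "sg_has_normal_deriv u 0 (if j = 0 \<and> k = 2 then 1 else 0)"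
    and monomial_tangential: "sg_has_tangential_deriv u 0 (if j = 0 \<and> k = 3 then 1 else 0)"
proof -
  obtain D where D: "D 0 = u" "\<And>n. n \<le> j \<Longrightarrow> sg_has_laplacian \<mu> (D n) (D (Suc n))"
    "\<And>x. x \<in> SG \<Longrightarrow> D (Suc j) x = 0"
    "\<And>n. n \<le> j \<Longrightarrow> D n (sg_vertex 0) = (if n = j \<and> k = 1 then 1 else 0)"
    "\<And>n. n \<le> j \<Longrightarrow> sg_has_normal_deriv (D n) 0 (if n = j \<and> k = 2 then 1 else 0)"
    "\<And>n. n \<le> j \<Longrightarrow> sg_has_tangential_deriv (D n) 0 (if n = j \<and> k = 3 then 1 else 0)"
    using assms by (rule sg_monomialE) (rule that; blast)
  show "continuous_on SG u" using D(1) D(2)[of 0] has_laplacianD(2)[of "D 0"] by simp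
  show "u (sg_vertex 0) = (if j = 0 \<and> k = 1 then 1 else 0)"
    "sg_has_normal_deriv u 0 (if j = 0 \<and> k = 2 then 1 else 0)"
    "sg_has_tangential_deriv u 0 (if j = 0 \<and> k = 3 then 1 else 0)"
    using D(4-6)[OF le0] unfolding D(1) eq_commute[of 0 j] .
qed

definition parity :: "nat \<Rightarrow> real" where
  "parity k = (if k = 2 then 1 else - 1)"

text \<open>Reflection keeps normal derivatives at the vertex 0 and reverses tangential ones; the
  sign \<open>parity k\<close> restores the defining data, and uniqueness applies.\<close>

lemma monomial_refl:
  assumes "k = 2 \<or> k = 3" "sg_monomial \<mu> j k u" "x \<in> SG"
  shows "parity k * u (sg_refl x) = u x"
proof (rule monomial_unique[OF _ assms(2,3)])
  obtain D where D: "D 0 = u" "\<And>n. n \<le> j \<Longrightarrow> sg_has_laplacian \<mu> (D n) (D (Suc n))"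
    "\<And>x. x \<in> SG \<Longrightarrow> D (Suc j) x = 0"
    "\<And>n. n \<le> j \<Longrightarrow> D n (sg_vertex 0) = (if n = j \<and> k = 1 then 1 else 0)"
    "\<And>n. n \<le> j \<Longrightarrow> sg_has_normal_deriv (D n) 0 (if n = j \<and> k = 2 then 1 else 0)"
    "\<And>n. n \<le> j \<Longrightarrow> sg_has_tangential_deriv (D n) 0 (if n = j \<and> k = 3 then 1 else 0)"
    using assms(2) by (rule sg_monomialE) (rule that; blast)
  show "sg_monomial \<mu> j k (\<lambda>x. parity k * u (sg_refl x))"
    unfolding sg_monomial_def
  proof (intro exI[of _ "\<lambda>n x. parity k * D n (sg_refl x)"] conjI allI impI ballI)
    fix n assume n: "n \<le> j"
    show "sg_has_laplacian \<mu> (\<lambda>x. parity k * D n (sg_refl x)) (\<lambda>x. parity k * D (Suc n) (sg_refl x))"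
      by (intro has_laplacian_scale has_laplacian_refl D(2) n)
    show "parity k * D n (sg_refl (sg_vertex 0)) = (if n = j \<and> k = 1 then 1 else 0)"
      using D(4)[OF n] assms(1) by (auto simp: refl_sg_vertex)
    show "sg_has_normal_deriv (\<lambda>x. parity k * D n (sg_refl x)) 0 (if n = j \<and> k = 2 then 1 else 0)"
    proof -
      have "parity k * (if n = j \<and> k = 2 then 1 else 0) = (if n = j \<and> k = 2 then 1 else 0)"
        by (simp add: parity_def)
      then show ?thesis using sg_normal_deriv_refl[OF D(5)[OF n], of "parity k"] by (simp only:)
    qed
    show "sg_has_tangential_deriv (\<lambda>x. parity k * D n (sg_refl x)) 0 (if n = j \<and> k = 3 then 1 else 0)"
    proof -
      have "- (parity k * (if n = j \<and> k = 3 then 1 else 0)) = (if n = j \<and> k = 3 then 1 else 0)"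
        by (simp add: parity_def)
      then show ?thesis using sg_tangential_deriv_refl[OF D(6)[OF n], of "parity k"] by (simp only:)
    qed
  qed (use D(1,3) refl_in_SG in auto)
qed

lemma Gop_refl:
  assumes "continuous_on SG f" "\<And>x. x \<in> SG \<Longrightarrow> c * f (sg_refl x) = f x" "x \<in> SG"
  shows "c * Gop f (sg_refl x) = Gop f x"
proof (rule Gop_unique[OF _ _ _ assms(3)])
  show "sg_has_laplacian \<mu> (\<lambda>x. c * Gop f (sg_refl x)) (\<lambda>x. c * - f (sg_refl x))"
    by (intro has_laplacian_scale has_laplacian_refl has_laplacian_Gop assms)
qed (use assms Gop_vertex in \<open>auto simp: refl_sg_vertex\<close>)

text \<open>If \<open>u\<close> vanished at the vertices 0 and 1, both derivatives would equal minus
  its value at the vertex 2, yet one of them is 1 and the other 0. So the value at the vertex 1 can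
  fix a coefficient of \<open>P 0\<close>.\<close>

lemma harmonic_monomial:
  assumes k: "k = 2 \<or> k = 3" and u: "sg_monomial \<mu> 0 k u"
  shows "u (sg_vertex 1) \<noteq> 0"
proof
  assume 0: "u (sg_vertex 1) = 0"
  define a where "a = (\<lambda>i. u (sg_vertex i))"
  have eq: "u x = sg_harm a x" if "x \<in> SG" for x
    unfolding a_def by (rule harmonic_eq_harm[OF monomial_laplacian_0[OF u] _ that]) simp
  have "a 0 = 0" using monomial_at_0[OF u] k by (auto simp: a_def)
  moreover have "2 * a 0 - a 1 - a 2 = (if k = 2 then 1 else 0)"
    using monomial_normal[OF u] sg_harm_derivs(1)[of a] sg_deriv_unique(1) sg_deriv_cong(1)[OF eq] by auto
  moreover have "a 1 - a 2 = (if k = 3 then 1 else 0)"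
    using monomial_tangential[OF u] sg_harm_derivs(2)[of a] sg_deriv_unique(2) sg_deriv_cong(2)[OF eq]
    by auto
  moreover have "a 1 = 0" using 0 by (simp add: a_def)
  ultimately show False using k by auto
qed

lemma Gop_monomial:
  assumes k: "k = 2 \<or> k = 3"
    and u: "sg_monomial \<mu> j k u" and v: "sg_monomial \<mu> (Suc j) k v" and w: "sg_monomial \<mu> 0 k w"
  shows "\<exists>c. \<forall>x\<in>SG. - Gop u x = v x + c * w x"
proof -
  note cu = monomial_continuous[OF u]
  define h where "h x = - 1 * Gop u x - v x" for x
  have lap_h: "sg_has_laplacian \<mu> h (\<lambda>x. - 1 * - u x - u x)"
    unfolding h_def[abs_def]
    by (intro has_laplacian_diff has_laplacian_scale has_laplacian_Gop cu monomial_laplacian_Suc[OF v u])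
  have h_refl: "parity k * h (sg_refl x) = h x" if "x \<in> SG" for x
    using Gop_refl[OF cu monomial_refl[OF k u] that] monomial_refl[OF k v that]
    unfolding h_def right_diff_distrib by (simp add: mult.left_commute)
  \<comment> \<open>Matches the values at the vertex 1; parity carries the match to the vertex 2,
    and at the vertex 0 everything vanishes because \<open>k\<close> is not 1.\<close>
  define c where "c = h (sg_vertex 1) / w (sg_vertex 1)"
  have c1: "h (sg_vertex 1) = c * w (sg_vertex 1)"
    using harmonic_monomial[OF k w] by (simp add: c_def)
  have "h x - c * w x = 0" if "x \<in> SG" for x
  proof (rule harmonic_eq_0[OF has_laplacian_diff[OF lap_h has_laplacian_scale[OF monomial_laplacian_0[OF w]]] _ _ that])
    have "h (sg_vertex 0) - c * w (sg_vertex 0) = 0"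
      using monomial_at_0[OF v] monomial_at_0[OF w] k by (auto simp: h_def Gop_vertex cu)
    moreover have "h (sg_vertex 2) - c * w (sg_vertex 2) = 0"
      using h_refl[of "sg_vertex 2"] monomial_refl[OF k w, of "sg_vertex 2"] c1
      by (auto simp: refl_sg_vertex uminus_3 mult.left_commute)
    ultimately show "h (sg_vertex i) - c * w (sg_vertex i) = 0" for i
      using forall_3_from_0[of "\<lambda>i. h (sg_vertex i) - c * w (sg_vertex i) = 0"] c1 by auto
  qed simp
  then show ?thesis by (intro exI[of _ c]) (force simp: h_def)
qed

subsection \<open>Bounds for the Green operator\<close>

lemma Gop_continuous: "continuous_on SG f \<Longrightarrow> continuous_on SG (Gop f)"
  using has_laplacian_Gop has_laplacianD(2) by blast

lemma energy_Gop:
  assumes "continuous_on SG f" "continuous_on SG g"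
  shows "sg_energy (Gop f) (Gop g) = I (\<lambda>x. f x * Gop g x)"
proof -
  have "sg_energy (Gop f) (Gop g) = - I (\<lambda>x. - f x * Gop g x)"
    using has_laplacianD(4)[OF has_laplacian_Gop[OF assms(1)]] has_laplacianD(1)[OF has_laplacian_Gop[OF assms(2)]]
      Gop_vertex[OF assms(2)] by blast
  then show ?thesis using I_scale[of "-1" "\<lambda>x. f x * Gop g x"] by simp
qed

text \<open>\<open>Gop f\<close> and \<open>Gop g\<close> are admissible test functions for each
  other, so both sides are their mutual energy, which is symmetric.\<close>

lemma Gop_self_adjoint:
  assumes "continuous_on SG f" "continuous_on SG g"
  shows "I (\<lambda>x. Gop f x * g x) = I (\<lambda>x. f x * Gop g x)"
  using energy_Gop[OF assms] energy_Gop[OF assms(2,1)] sg_energy_commute[of "Gop f" "Gop g"]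
  by (simp add: mult.commute)

text \<open>Poincare bounds the squared norm \<open>X\<close> by the energy of \<open>Gop f\<close>,
  which is the pairing of \<open>f\<close> with \<open>Gop f\<close>; Cauchy-Schwarz gives back a
  factor \<open>sqrt X\<close>, which cancels.\<close>

lemma Gop_contraction:
  assumes "continuous_on SG f"
  shows "I (\<lambda>x. (Gop f x)\<^sup>2) \<le> I (\<lambda>x. (f x)\<^sup>2)"
proof -
  define X where "X = I (\<lambda>x. (Gop f x)\<^sup>2)"
  note cont = assms Gop_continuous[OF assms]
  have X: "0 \<le> X" unfolding X_def by (rule I_nonneg) (auto intro!: continuous_intros cont)
  have "X \<le> I (\<lambda>x. f x * Gop f x)"
    unfolding X_def energy_Gop[OF assms assms, symmetric]
    by (rule poincare) (auto simp: has_laplacianD(1)[OF has_laplacian_Gop[OF assms]] Gop_vertex assms)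
  then have "X\<^sup>2 \<le> (I (\<lambda>x. f x * Gop f x))\<^sup>2" using X by (rule power_mono)
  also have "\<dots> \<le> I (\<lambda>x. (f x)\<^sup>2) * X" unfolding X_def by (rule cauchy_schwarz[OF cont])
  finally show ?thesis
    using X I_nonneg[of "\<lambda>x. (f x)\<^sup>2"] cont unfolding X_def[symmetric]
    by (cases "X = 0") (auto simp: power2_eq_square intro!: continuous_intros)
qed

text \<open>Cauchy-Schwarz in the second variable for each fixed \<open>x\<close>, then integration
  over \<open>x\<close>; Fubini turns the iterated integral into the Hilbert-Schmidt norm.\<close>

lemma Gop_hilbert_schmidt:
  assumes f: "continuous_on SG f"
  shows "I (\<lambda>x. (Gop f x)\<^sup>2) \<le> (sg_green_norm2 \<mu> G)\<^sup>2 * I (\<lambda>x. (f x)\<^sup>2)"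
proof -
  interpret P: pair_sigma_finite \<mu> \<mu> by unfold_locales
  have G: "continuous_on (SG \<times> SG) (\<lambda>z. G (fst z) (snd z))"
    using green by (simp add: sg_green_def case_prod_unfold)
  have Gx: "continuous_on SG (\<lambda>y. G x y)" if "x \<in> SG" for x
  proof -
    have "continuous_on SG (\<lambda>y. (x, y))" by (intro continuous_intros)
    from continuous_on_compose2[OF G this] show ?thesis using that by auto
  qed
  define K where "K z = indicat_real (SG \<times> SG) z * (G (fst z) (snd z))\<^sup>2" for z
  \<comment> \<open>The product of the Borel structures is the Borel structure of the product, so
    the truncated continuous kernel is measurable.\<close>
  have sets2: "sets (\<mu> \<Otimes>\<^sub>M \<mu>) = sets borel"
    using sets_pair_measure_cong[OF sets_mu sets_mu] unfolding borel_prod .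
  obtain B where B: "\<And>z. z \<in> SG \<times> SG \<Longrightarrow> \<bar>(G (fst z) (snd z))\<^sup>2\<bar> \<le> B"
  proof -
    have "compact ((\<lambda>z. (G (fst z) (snd z))\<^sup>2) ` (SG \<times> SG))"
      by (intro compact_continuous_image compact_Times compact_SG continuous_intros G)
    then obtain B where "\<forall>z\<in>SG \<times> SG. \<bar>(G (fst z) (snd z))\<^sup>2\<bar> \<le> B"
      by (auto dest!: compact_imp_bounded simp: bounded_iff)
    then show thesis by (intro that[of B]) blast
  qed
  have "(\<lambda>z. indicat_real (SG \<times> SG) z *\<^sub>R (G (fst z) (snd z))\<^sup>2) \<in> borel_measurable borel"
    by (rule borel_measurable_continuous_on_indicator)
      (auto intro!: continuous_intros G borel_compact compact_Times compact_SG)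
  then have "K \<in> borel_measurable (\<mu> \<Otimes>\<^sub>M \<mu>)"
    by (subst measurable_cong_sets[OF sets2 refl]) (simp add: K_def[abs_def])
  moreover have "norm (K z) \<le> \<bar>B\<bar>" for z
    using B[of z] by (cases "z \<in> SG \<times> SG") (auto simp: K_def)
  moreover have "finite_measure (\<mu> \<Otimes>\<^sub>M \<mu>)"
    by (intro finite_measure_pair_measure) unfold_locales
  ultimately have K: "integrable (\<mu> \<Otimes>\<^sub>M \<mu>) K"
    by (intro finite_measure.integrable_const_bound[where B = "\<bar>B\<bar>"] AE_I2)
  have N2: "(sg_green_norm2 \<mu> G)\<^sup>2 = integral\<^sup>L (\<mu> \<Otimes>\<^sub>M \<mu>) K"
    unfolding sg_green_norm2_def set_lebesgue_integral_def
    by (subst real_sqrt_pow2) (auto simp: K_def[abs_def] intro!: integral_nonneg_AE)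
  also have "\<dots> = (LINT x|\<mu>. LINT y|\<mu>. K (x, y))"
    using P.integral_fst'[OF K] by simp
  finally have N: "(sg_green_norm2 \<mu> G)\<^sup>2 = (LINT x|\<mu>. LINT y|\<mu>. K (x, y))" .
  have intK: "integrable \<mu> (\<lambda>x. LINT y|\<mu>. K (x, y))"
    using P.integrable_fst'[OF K] by simp
  have inner: "(LINT y|\<mu>. K (x, y)) = indicat_real SG x * I (\<lambda>y. (G x y)\<^sup>2)" for x
    unfolding I_def set_lebesgue_integral_def
    by (cases "x \<in> SG") (auto simp: K_def indicator_times)
  have "I (\<lambda>x. (Gop f x)\<^sup>2) \<le> (LINT x|\<mu>. (LINT y|\<mu>. K (x, y)) * I (\<lambda>x. (f x)\<^sup>2))"
    unfolding I_def[of "\<lambda>x. (Gop f x)\<^sup>2"] set_lebesgue_integral_def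
  proof (rule integral_mono)
    show "integrable \<mu> (\<lambda>x. indicat_real SG x *\<^sub>R (Gop f x)\<^sup>2)"
      using set_integrable_SG[of "\<lambda>x. (Gop f x)\<^sup>2"] Gop_continuous[OF f]
      by (simp add: set_integrable_def continuous_on_power)
    show "integrable \<mu> (\<lambda>x. (LINT y|\<mu>. K (x, y)) * I (\<lambda>x. (f x)\<^sup>2))"
      using intK by simp
    fix x
    show "indicat_real SG x *\<^sub>R (Gop f x)\<^sup>2 \<le> (LINT y|\<mu>. K (x, y)) * I (\<lambda>x. (f x)\<^sup>2)"
      unfolding inner using cauchy_schwarz[OF Gx f, of x] by (cases "x \<in> SG") (auto simp: Gop_def)
  qed
  then show ?thesis by (simp add: N)
qed

end

subsection \<open>Orthogonal polynomials for an abstract inner product\<close>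

text \<open>Degree below \<open>n\<close>, phrased by coefficients so that \<open>n = 0\<close>
  singles out the zero polynomial, whose \<open>degree\<close> is 0.\<close>

definition low_degree :: "nat \<Rightarrow> real poly \<Rightarrow> bool" where
  "low_degree n q \<longleftrightarrow> (\<forall>i\<ge>n. coeff q i = 0)"

definition monic_degree :: "nat \<Rightarrow> real poly \<Rightarrow> bool" where
  "monic_degree n q \<longleftrightarrow> coeff q n = 1 \<and> low_degree (Suc n) q"

fun gs_poly :: "(real poly \<Rightarrow> real poly \<Rightarrow> real) \<Rightarrow> nat \<Rightarrow> real poly" where
  "gs_poly B n = monom 1 n - (\<Sum>i<n. smult (B (monom 1 n) (gs_poly B i) / B (gs_poly B i) (gs_poly B i)) (gs_poly B i))"

declare gs_poly.simps [simp del]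

lemma low_degree_mono: "low_degree m q \<Longrightarrow> m \<le> n \<Longrightarrow> low_degree n q"
  by (auto simp: low_degree_def)

lemma monic_degree_nonzero: "monic_degree n q \<Longrightarrow> q \<noteq> 0"
  by (auto simp: monic_degree_def)

lemma monic_degree_diff: "monic_degree n q \<Longrightarrow> monic_degree n r \<Longrightarrow> low_degree n (q - r)"
  unfolding monic_degree_def low_degree_def by (metis Suc_leI coeff_diff diff_self le_neq_implies_less)

lemma monic_degree_low: "monic_degree m q \<Longrightarrow> m < n \<Longrightarrow> low_degree n q"
  unfolding monic_degree_def by (auto intro: low_degree_mono)

lemma monic_degree_gs_poly: "monic_degree n (gs_poly B n)"
proof (induction n rule: less_induct)
  case (less n)
  have "coeff (gs_poly B i) k = 0" if "i < n" "n \<le> k" for i k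
    using less[OF that(1)] that by (auto simp: monic_degree_def low_degree_def)
  then show ?case
    by (subst gs_poly.simps) (auto simp: monic_degree_def low_degree_def coeff_sum)
qed

locale poly_form =
  fixes B :: "real poly \<Rightarrow> real poly \<Rightarrow> real"
  assumes commute: "B q r = B r q"
    and add_left: "B (q + r) t = B q t + B r t"
    and smult_left: "B (smult c q) r = c * B q r"
    and pos: "q \<noteq> 0 \<Longrightarrow> 0 < B q q"
begin

lemma add_right: "B t (q + r) = B t q + B t r"
  using add_left commute by metis

lemma smult_right: "B r (smult c q) = c * B r q"
  using smult_left commute by metis

lemma diff_left: "B (q - r) t = B q t - B r t"
  using add_left[of q "smult (-1) r" t] smult_left[of "-1" r t] by simp

lemma diff_right: "B t (q - r) = B t q - B t r"
  using diff_left commute by metis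

lemma zero_left: "B 0 t = 0"
  using smult_left[of 0 0 t] by simp

lemma sum_left: "B (\<Sum>i\<in>A. g i) t = (\<Sum>i\<in>A. B (g i) t)"
  by (induction A rule: infinite_finite_induct) (auto simp: zero_left add_left)

lemma nonneg: "0 \<le> B q q"
  using pos[of q] zero_left[of 0] by (cases "q = 0") auto

lemma cauchy_schwarz_form: "(B q r)\<^sup>2 \<le> B q q * B r r"
proof (cases "r = 0")
  case True
  then show ?thesis using zero_left commute[of q r] by simp
next
  case False
  define b where "b = B r r"
  define c where "c = B q r"
  have b: "0 < b" using pos[OF False] by (simp add: b_def)
  have "0 \<le> B (smult b q - smult c r) (smult b q - smult c r)" by (rule nonneg)
  also have "\<dots> = (b * (b * B q q) - c * (b * c)) - (b * (c * c) - c * (c * b))"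
  proof -
    have "B q r = c" "B r q = c" "B r r = b" by (simp_all add: b_def c_def commute)
    then show ?thesis by (simp add: diff_left diff_right smult_left smult_right algebra_simps)
  qed
  also have "\<dots> = b * (b * B q q - c\<^sup>2)" by (simp add: power2_eq_square algebra_simps)
  finally have "0 \<le> b * B q q - c\<^sup>2" using b by (simp add: zero_le_mult_iff)
  then show ?thesis by (simp add: b_def c_def mult.commute)
qed

lemma gs_poly_orthogonal: "m < n \<Longrightarrow> B (gs_poly B n) (gs_poly B m) = 0"
proof (induction n arbitrary: m rule: less_induct)
  case (less n)
  let ?g = "gs_poly B"
  have orth: "B (?g i) (?g m) = 0" if "i < n" "i \<noteq> m" for i
    using less.IH[of i m] less.IH[of m i] less.prems that commute[of "?g i" "?g m"]
    by (cases "i < m") auto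
  have "B (?g n) (?g m) = B (monom 1 n) (?g m) -
      (\<Sum>i<n. B (monom 1 n) (?g i) / B (?g i) (?g i) * B (?g i) (?g m))"
    by (subst gs_poly.simps) (simp add: diff_left sum_left smult_left)
  also have "(\<Sum>i<n. B (monom 1 n) (?g i) / B (?g i) (?g i) * B (?g i) (?g m)) =
      (\<Sum>i\<in>{m}. B (monom 1 n) (?g i) / B (?g i) (?g i) * B (?g i) (?g m))"
    by (rule sum.mono_neutral_right) (use less.prems orth in auto)
  also have "\<dots> = B (monom 1 n) (?g m)"
    using pos[OF monic_degree_nonzero[OF monic_degree_gs_poly[of m B]]] by simp
  finally show ?case by simp
qed

text \<open>A multiple of \<open>gs_poly B m\<close> removes the coefficient with index
  \<open>m\<close>, so induction on the degree bound ends at the zero polynomial.\<close>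

lemma gs_poly_orthogonal_low:
  assumes "low_degree n q" shows "B (gs_poly B n) q = 0"
proof -
  have "m \<le> n \<Longrightarrow> low_degree m q \<Longrightarrow> B (gs_poly B n) q = 0" for m
  proof (induction m arbitrary: q)
    case 0
    then have "q = 0" by (simp add: low_degree_def poly_eq_iff)
    then show ?case using zero_left commute by metis
  next
    case (Suc m)
    define r where "r = q - smult (coeff q m) (gs_poly B m)"
    have "low_degree m r"
      unfolding low_degree_def
    proof (intro allI impI)
      fix i assume "m \<le> i"
      then consider "i = m" | "Suc m \<le> i" by linarith
      then show "coeff r i = 0"
        using Suc.prems(2) monic_degree_gs_poly[of m B]
        by cases (auto simp: r_def monic_degree_def low_degree_def)
    qed
    with Suc.IH[of r] Suc.prems(1) have "B (gs_poly B n) r = 0" by simp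
    then show ?case
      using gs_poly_orthogonal[of m n] Suc.prems(1) by (simp add: r_def diff_right smult_right)
  qed
  with assms show ?thesis by blast
qed

lemma gs_poly_monic:
  assumes "monic_degree n q" shows "B (gs_poly B n) q = B (gs_poly B n) (gs_poly B n)"
  using gs_poly_orthogonal_low[OF monic_degree_diff[OF assms monic_degree_gs_poly[of n B]]]
  by (simp add: diff_right)

text \<open>Pythagoras, since two monic polynomials differ by one of lower degree. The exact defect
  later controls the distance of \<open>s\<close> from its competitor.\<close>

lemma gs_poly_minimal_diff:
  assumes "monic_degree n q"
  shows "B q q = B (gs_poly B n) (gs_poly B n) + B (gs_poly B n - q) (gs_poly B n - q)"
  using gs_poly_monic[OF assms] by (simp add: diff_left diff_right commute[of q "gs_poly B n"])

lemma gs_poly_minimal: "monic_degree n q \<Longrightarrow> B (gs_poly B n) (gs_poly B n) \<le> B q q"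
  using gs_poly_minimal_diff[of n q] nonneg[of "gs_poly B n - q"] by simp

lemma gs_poly_pos: "0 < B (gs_poly B n) (gs_poly B n)"
  by (rule pos[OF monic_degree_nonzero[OF monic_degree_gs_poly]])

end

definition poly_tail :: "real poly \<Rightarrow> real poly" where
  "poly_tail = poly_shift 1"

lemma coeff_tail: "coeff (poly_tail q) i = coeff q (Suc i)"
  by (simp add: poly_tail_def coeff_poly_shift)

lemma poly_tail_simps [simp]:
  "poly_tail (pCons c q) = q" "poly_tail (q + r) = poly_tail q + poly_tail r" "poly_tail (q - r) = poly_tail q - poly_tail r"
  "poly_tail (smult c q) = smult c (poly_tail q)" "poly_tail 0 = 0"
  by (auto simp: poly_eq_iff coeff_tail)

lemma pCons_tail: "pCons (coeff q 0) (poly_tail q) = q"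
  by (simp add: poly_eq_iff coeff_tail coeff_pCons split: nat.split)

lemma monic_degree_tail: "monic_degree (Suc n) q \<Longrightarrow> monic_degree n (poly_tail q)"
  by (simp add: monic_degree_def low_degree_def coeff_tail)

lemma monic_degree_pCons: "monic_degree n q \<Longrightarrow> monic_degree (Suc n) (pCons c q)"
  by (auto simp: monic_degree_def low_degree_def coeff_pCons split: nat.split)

lemma low_degree_tail: "low_degree (Suc n) q \<Longrightarrow> low_degree n (poly_tail q)"
  by (simp add: low_degree_def coeff_tail)

subsection \<open>Sobolev orthogonal polynomials\<close>

text \<open>\<open>poly_tail\<close> plays the role of the Laplacian, \<open>K\<close> that of minus the Green operator and \<open>N\<close>
  that of the Hilbert--Schmidt norm of the latter.\<close>

locale sobolev_form = poly_form +
  fixes K :: "real poly \<Rightarrow> real poly" and N :: real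
  assumes K_pCons: "\<exists>c. K q = pCons c q"
    and K_adjoint: "B (K q) r = B q (K r)"
    and K_bound: "B (K q) (K q) \<le> N\<^sup>2 * B q q"
    and K_contraction: "B (K q) (K q) \<le> B q q"
    and N_nonneg: "0 \<le> N"
begin

definition S :: "real \<Rightarrow> real poly \<Rightarrow> real poly \<Rightarrow> real" where
  "S chi q r = B q r + chi * B (poly_tail q) (poly_tail r)"

lemma S_poly_form:
  assumes "0 \<le> chi" shows "poly_form (S chi)"
proof
  show "q \<noteq> 0 \<Longrightarrow> 0 < S chi q q" for q
    using pos[of q] nonneg[of "poly_tail q"] assms by (simp add: S_def add_pos_nonneg)
qed (simp_all add: S_def commute[of q r for q r] add_left add_right smult_left smult_right
    distrib_left mult.left_commute)

abbreviation p :: "nat \<Rightarrow> real poly" where "p \<equiv> gs_poly B"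

abbreviation s :: "real \<Rightarrow> nat \<Rightarrow> real poly" where "s chi \<equiv> gs_poly (S chi)"

lemma tail_K [simp]: "poly_tail (K q) = q"
  using K_pCons[of q] by auto

lemma K_monic: "monic_degree n q \<Longrightarrow> monic_degree (Suc n) (K q)"
  using K_pCons[of q] monic_degree_pCons by metis

section \<open>Comparison of the minimizers of the two norms\<close>

lemma p_Suc_le: "B (p (Suc m)) (p (Suc m)) \<le> N\<^sup>2 * B (p m) (p m)"
  using gs_poly_minimal[OF K_monic[OF monic_degree_gs_poly[of m B]]] K_bound[of "p m"] by linarith

lemma p_Suc_decreasing: "B (p (Suc m)) (p (Suc m)) \<le> B (p m) (p m)"
  using gs_poly_minimal[OF K_monic[OF monic_degree_gs_poly[of m B]]] K_contraction[of "p m"] by linarith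

lemma p_le_p_0: "B (p m) (p m) \<le> B (p 0) (p 0)"
  by (induction m) (use p_Suc_decreasing order_trans in blast)+

text \<open>\<open>N = 0\<close> would give \<open>p 1\<close> norm 0. Positivity permits the
  division by \<open>N\<^sup>2\<close> in the lower Sobolev bound.\<close>

lemma N_pos: "0 < N"
proof -
  have "0 < N\<^sup>2 * B (p 0) (p 0)" using p_Suc_le[of 0] gs_poly_pos[of "Suc 0"] by linarith
  then show ?thesis using N_nonneg by (cases "N = 0") auto
qed

context
  fixes chi :: real
  assumes chi: "0 < chi"
begin

interpretation Sf: poly_form "S chi" using S_poly_form chi by simp

lemma p_le_s: "B (p n) (p n) \<le> B (s chi n) (s chi n)"
  by (rule gs_poly_minimal[OF monic_degree_gs_poly])

text \<open>The tail of a monic polynomial is monic of one degree less. With \<open>p_le_s\<close>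
  this bounds both parts of the Sobolev norm from below.\<close>

lemma p_le_tail_s: "B (p m) (p m) \<le> B (poly_tail (s chi (Suc m))) (poly_tail (s chi (Suc m)))"
  by (rule gs_poly_minimal[OF monic_degree_tail[OF monic_degree_gs_poly]])

lemma S_K_eq: "S chi (K (p m)) (K (p m)) = B (K (p m)) (K (p m)) + chi * B (p m) (p m)"
  by (simp add: S_def)

lemma S_s_le_K: "S chi (s chi (Suc m)) (s chi (Suc m)) \<le> B (K (p m)) (K (p m)) + chi * B (p m) (p m)"
  using Sf.gs_poly_minimal[OF K_monic[OF monic_degree_gs_poly[of m B]]] by (simp add: S_K_eq)

lemma S_s_le: "S chi (s chi (Suc m)) (s chi (Suc m)) \<le> (N\<^sup>2 + chi) * B (p m) (p m)"
  using S_s_le_K[of m] K_bound[of "p m"] by (simp add: algebra_simps)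

lemma S_s_ge_s: "B (s chi n) (s chi n) \<le> S chi (s chi n) (s chi n)"
  using chi nonneg[of "poly_tail (s chi n)"] by (simp add: S_def)

lemma S_s_ge: "B (p (Suc m)) (p (Suc m)) + chi * B (p m) (p m) \<le> S chi (s chi (Suc m)) (s chi (Suc m))"
  using p_le_s[of "Suc m"] mult_left_mono[OF p_le_tail_s[of m] less_imp_le[OF chi]]
  unfolding S_def by linarith

lemma S_s_ge_chi: "chi * B (p m) (p m) \<le> S chi (s chi (Suc m)) (s chi (Suc m))"
  using S_s_ge[of m] gs_poly_pos[of "Suc m"] by linarith

text \<open>In the upper bound \<open>(N\<^sup>2 + chi) * B (p m) (p m)\<close> the share of
  \<open>chi\<close> is already consumed by the Laplacian term, by
  \<open>p_le_tail_s\<close>.\<close>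

lemma s_le: "B (s chi (Suc m)) (s chi (Suc m)) \<le> N\<^sup>2 * B (p m) (p m)"
  using S_s_le[of m] mult_left_mono[OF p_le_tail_s[of m] less_imp_le[OF chi]]
  unfolding S_def distrib_right by linarith

lemma tail_s_le:
  "chi * B (poly_tail (s chi (Suc m))) (poly_tail (s chi (Suc m))) \<le> (N\<^sup>2 + chi) * B (p m) (p m)"
  using S_s_le[of m] nonneg[of "s chi (Suc m)"] by (simp add: S_def)

lemma S_s_lower:
  "(1 + chi * inverse (N\<^sup>2)) * B (p (Suc m)) (p (Suc m)) \<le> S chi (s chi (Suc m)) (s chi (Suc m))"
proof -
  have "B (p (Suc m)) (p (Suc m)) / N\<^sup>2 \<le> B (p m) (p m)"
    using p_Suc_le[of m] N_pos by (simp add: divide_le_eq mult.commute)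
  then have "chi * (B (p (Suc m)) (p (Suc m)) / N\<^sup>2) \<le> chi * B (p m) (p m)"
    using chi by (intro mult_left_mono) auto
  then show ?thesis using S_s_ge[of m] by (simp add: field_simps)
qed

lemma S_s_pos: "0 < S chi (s chi n) (s chi n)"
  by (rule Sf.gs_poly_pos)

text \<open>The Laplacian term pairs \<open>p (Suc m)\<close> with a polynomial of degree
  \<open>m\<close>, hence drops out.\<close>

lemma a_numerator: "S chi (K (p (Suc m))) (s chi (Suc m)) = B (K (p (Suc m))) (s chi (Suc m))"
  using gs_poly_orthogonal_low[OF monic_degree_low[OF monic_degree_tail[OF monic_degree_gs_poly]], of m "Suc m"]
  by (simp add: S_def)

text \<open>Both norms are measured in one unit \<open>M\<close>, which cancels against later
  denominators; \<open>L\<close> will be 1, \<open>N\<close> and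
  \<open>N\<^sup>2 / sqrt chi\<close>.\<close>

lemma abs_K_le:
  assumes "B q q \<le> M" "B r r \<le> L\<^sup>2 * M" "0 \<le> L" "0 \<le> M"
  shows "\<bar>B (K q) r\<bar> \<le> N * L * M"
proof (rule power2_le_imp_le)
  have "\<bar>B (K q) r\<bar>\<^sup>2 \<le> B (K q) (K q) * B r r" using cauchy_schwarz_form by simp
  also have "\<dots> \<le> (N\<^sup>2 * M) * (L\<^sup>2 * M)"
    using K_bound[of q] assms nonneg mult_left_mono[OF assms(1), of "N\<^sup>2"]
    by (intro mult_mono) auto
  finally show "\<bar>B (K q) r\<bar>\<^sup>2 \<le> (N * L * M)\<^sup>2"
    by (simp add: power2_eq_square mult_ac)
qed (use N_nonneg assms in auto)

lemma a_numerator_le: "\<bar>S chi (K (p (Suc m))) (s chi (Suc m))\<bar> \<le> N * B (s chi (Suc m)) (s chi (Suc m))"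
  using abs_K_le[of "p (Suc m)" "B (s chi (Suc m)) (s chi (Suc m))" "s chi (Suc m)" 1]
    p_le_s[of "Suc m"] nonneg by (simp add: a_numerator)

text \<open>The numerator is at most \<open>N\<close> times the squared norm of \<open>s\<close>.
  Comparing that with the whole Sobolev norm gives \<open>N\<close>; using \<open>s_le\<close> and
  only the Laplacian share of the denominator gives the bound with
  \<open>inverse chi\<close>.\<close>

lemma a_bound:
  "\<bar>S chi (K (p (Suc m))) (s chi (Suc m)) / S chi (s chi (Suc m)) (s chi (Suc m))\<bar> \<le> min N (inverse chi * N ^ 3)"
proof -
  define T where "T = S chi (s chi (Suc m)) (s chi (Suc m))"
  define A where "A = \<bar>S chi (K (p (Suc m))) (s chi (Suc m))\<bar>"
  have T: "0 < T" unfolding T_def by (rule S_s_pos)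
  have A: "A \<le> N * B (s chi (Suc m)) (s chi (Suc m))" unfolding A_def by (rule a_numerator_le)
  also have "\<dots> \<le> N * T" unfolding T_def by (intro mult_left_mono S_s_ge_s N_nonneg)
  finally have "A / T \<le> N" using T by (simp add: divide_le_eq)
  moreover have "A / T \<le> inverse chi * N ^ 3"
  proof -
    have "A \<le> N * (N\<^sup>2 * B (p m) (p m))"
      using A mult_left_mono[OF s_le[of m] N_nonneg] by linarith
    also have "\<dots> = inverse chi * N ^ 3 * (chi * B (p m) (p m))"
      using chi by (simp add: power3_eq_cube power2_eq_square)
    also have "\<dots> \<le> inverse chi * N ^ 3 * T"
      unfolding T_def using chi N_nonneg by (intro mult_left_mono S_s_ge_chi) auto
    finally show ?thesis using T by (simp add: divide_le_eq)
  qed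
  ultimately show ?thesis using T by (simp add: A_def T_def abs_divide)
qed

text \<open>Orthogonality kills the Laplacian term; in the other one \<open>K\<close> moves over to
  \<open>s chi m\<close>, making it monic of degree \<open>Suc m\<close>, and only the leading
  coefficient counts. So the value is positive and free of \<open>chi\<close>.\<close>

lemma b_numerator: "S chi (K (p (Suc m))) (s chi m) = B (p (Suc m)) (p (Suc m))"
proof -
  have "B (p (Suc m)) (poly_tail (s chi m)) = 0"
    by (intro gs_poly_orthogonal_low low_degree_tail low_degree_mono[OF monic_degree_low[OF monic_degree_gs_poly]])
      auto
  moreover have "B (K (p (Suc m))) (s chi m) = B (p (Suc m)) (p (Suc m))"
    unfolding K_adjoint by (rule gs_poly_monic[OF K_monic[OF monic_degree_gs_poly]])
  ultimately show ?thesis by (simp add: S_def)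
qed

lemma b_pos: "0 < S chi (K (p (Suc m))) (s chi m) / S chi (s chi m) (s chi m)"
  using S_s_pos gs_poly_pos by (simp add: b_numerator)

lemma b_le: "S chi (K (p (Suc m))) (s chi m) / S chi (s chi m) (s chi m) \<le> N\<^sup>2"
proof -
  have "B (p (Suc m)) (p (Suc m)) \<le> N\<^sup>2 * B (p m) (p m)" by (rule p_Suc_le)
  also have "\<dots> \<le> N\<^sup>2 * S chi (s chi m) (s chi m)"
    using p_le_s[of m] S_s_ge_s[of m] by (intro mult_left_mono) auto
  finally show ?thesis using S_s_pos[of m] by (simp add: b_numerator divide_le_eq)
qed

lemma p_Suc_Suc_le: "B (p (Suc (Suc m))) (p (Suc (Suc m))) \<le> N ^ 4 * B (p m) (p m)"
proof -
  have "B (p (Suc (Suc m))) (p (Suc (Suc m))) \<le> N\<^sup>2 * (N\<^sup>2 * B (p m) (p m))"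
    using p_Suc_le[of "Suc m"] mult_left_mono[OF p_Suc_le[of m], of "N\<^sup>2"] by simp
  then show ?thesis by (simp add: power2_eq_square numeral_eq_Suc mult_ac)
qed

text \<open>The index in the denominator is at least 1 because its growth in \<open>chi\<close>
  comes from the Laplacian of \<open>s\<close>, and that of \<open>s chi 0\<close> is 0.\<close>

lemma b_le_chi:
  "S chi (K (p (Suc (Suc m)))) (s chi (Suc m)) / S chi (s chi (Suc m)) (s chi (Suc m)) \<le> inverse chi * N ^ 4"
proof -
  have "B (p (Suc (Suc m))) (p (Suc (Suc m))) \<le> N ^ 4 * B (p m) (p m)" by (rule p_Suc_Suc_le)
  also have "\<dots> = inverse chi * N ^ 4 * (chi * B (p m) (p m))" using chi by simp
  also have "\<dots> \<le> inverse chi * N ^ 4 * S chi (s chi (Suc m)) (s chi (Suc m))"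
    using chi N_nonneg by (intro mult_left_mono S_s_ge_chi) auto
  finally show ?thesis using S_s_pos[of "Suc m"] by (simp add: b_numerator divide_le_eq)
qed

text \<open>The denominator lies between \<open>chi\<close> and \<open>N\<^sup>2 + chi\<close> times
  \<open>B (p m) (p m)\<close>, a relative error of \<open>N\<^sup>2 / chi\<close>. The factor
  \<open>\<bar>X\<bar> / B (p m) (p m)\<close> is kept because its bound by a power of
  \<open>N\<close> is what makes the limits uniform.\<close>

lemma quotient_limit:
  "\<bar>chi * X / S chi (s chi (Suc m)) (s chi (Suc m)) - X / B (p m) (p m)\<bar> \<le> \<bar>X\<bar> / B (p m) (p m) * N\<^sup>2 / chi"
proof -
  define T where "T = S chi (s chi (Suc m)) (s chi (Suc m))"
  define P where "P = B (p m) (p m)"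
  have P: "0 < P" unfolding P_def by (rule gs_poly_pos)
  have T: "chi * P \<le> T" "T \<le> (N\<^sup>2 + chi) * P" "0 < T"
    unfolding T_def P_def by (rule S_s_ge_chi S_s_le S_s_pos)+
  have "chi * X / T - X / P = - (X / P * ((T - chi * P) / T))" using P T by (simp add: field_simps)
  then have "\<bar>chi * X / T - X / P\<bar> = \<bar>X\<bar> / P * ((T - chi * P) / T)"
    using P T by (simp add: abs_mult)
  also have "\<dots> \<le> \<bar>X\<bar> / P * (N\<^sup>2 * P / (chi * P))"
    using P T chi by (intro mult_left_mono frac_le) (auto simp: algebra_simps)
  also have "\<dots> = \<bar>X\<bar> / P * N\<^sup>2 / chi" using P by simp
  finally show ?thesis by (simp only: T_def P_def)
qed

lemma b_limit:
  "\<bar>chi * (S chi (K (p (Suc (Suc m)))) (s chi (Suc m)) / S chi (s chi (Suc m)) (s chi (Suc m)))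
     - B (p (Suc (Suc m))) (p (Suc (Suc m))) / B (p m) (p m)\<bar> \<le> N ^ 6 / chi"
proof -
  define X where "X = B (p (Suc (Suc m))) (p (Suc (Suc m)))"
  have X: "\<bar>X\<bar> / B (p m) (p m) \<le> N ^ 4"
    using p_Suc_Suc_le[of m] gs_poly_pos[of m] gs_poly_pos[of "Suc (Suc m)"] by (simp add: X_def divide_le_eq)
  have "\<bar>chi * X / S chi (s chi (Suc m)) (s chi (Suc m)) - X / B (p m) (p m)\<bar> \<le> \<bar>X\<bar> / B (p m) (p m) * N\<^sup>2 / chi"
    by (rule quotient_limit)
  also have "\<dots> \<le> N ^ 4 * N\<^sup>2 / chi"
    using chi by (intro divide_right_mono mult_right_mono X) auto
  finally show ?thesis by (simp add: b_numerator X_def flip: power_add)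
qed

text \<open>For \<open>n \<ge> 2\<close> the function \<open>K (p n)\<close> is orthogonal to the constants, so only the
  tail of \<open>s n - K (p (n - 1))\<close>, which is small by minimality of \<open>s n\<close>, contributes.\<close>

lemma a_numerator_diff:
  "\<bar>B (K (p (Suc (Suc m)))) (s chi (Suc (Suc m))) - B (K (p (Suc (Suc m)))) (K (p (Suc m)))\<bar>
     \<le> N ^ 3 / sqrt chi * B (p (Suc m)) (p (Suc m))"
proof -
  define n where "n = Suc m"
  define P where "P = B (p n) (p n)"
  define r where "r = s chi (Suc n) - K (p n)"
  have P: "0 < P" unfolding P_def by (rule gs_poly_pos)
  \<comment> \<open>By Pythagoras the Sobolev norm of \<open>r\<close> is the excess of the
    competitor over the minimum, at most \<open>N\<^sup>2 * P\<close>; so the tail of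
    \<open>r\<close> is of order \<open>1 / chi\<close> in squared norm, which produces
    \<open>1 / sqrt chi\<close> below.\<close>
  have "S chi (K (p n)) (K (p n)) = S chi (s chi (Suc n)) (s chi (Suc n)) + S chi r r"
    unfolding r_def by (rule Sf.gs_poly_minimal_diff[OF K_monic[OF monic_degree_gs_poly]])
  moreover have "chi * B (poly_tail r) (poly_tail r) \<le> S chi r r" using nonneg by (simp add: S_def)
  ultimately have "chi * B (poly_tail r) (poly_tail r) \<le> N\<^sup>2 * P"
    using S_s_ge_chi[of n] K_bound[of "p n"] by (simp add: S_K_eq P_def)
  then have sr: "B (poly_tail r) (poly_tail r) \<le> N\<^sup>2 * P / chi" using chi by (simp add: field_simps)
  obtain c where c: "K (poly_tail r) = pCons c (poly_tail r)" using K_pCons by blast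
  have r: "r = K (poly_tail r) + [:coeff r 0 - c:]"
    unfolding c using pCons_tail[of r] by simp
  \<comment> \<open>Constant polynomials stand for multiples of \<open>P 0\<close>. Moving
    \<open>K\<close> over yields degree at most 1, below \<open>Suc n = m + 2\<close>; this is where
    the index has to be at least 2.\<close>
  have const: "B (K (p (Suc n))) [:d:] = 0" for d
  proof -
    obtain e where "K [:d:] = pCons e [:d:]" using K_pCons by blast
    then have "low_degree (Suc n) (K [:d:])"
      by (auto simp: low_degree_def coeff_pCons n_def split: nat.split)
    then show ?thesis unfolding K_adjoint by (rule gs_poly_orthogonal_low)
  qed
  have "\<bar>B (K (p (Suc n))) r\<bar> = \<bar>B (K (p (Suc n))) (K (poly_tail r))\<bar>"
    by (subst r) (simp add: add_right const)
  also have "\<dots> \<le> N * (N\<^sup>2 / sqrt chi) * P"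
  proof (rule abs_K_le)
    show "B (p (Suc n)) (p (Suc n)) \<le> P" unfolding P_def by (rule p_Suc_decreasing)
    have "B (K (poly_tail r)) (K (poly_tail r)) \<le> N\<^sup>2 * (N\<^sup>2 * P / chi)"
      using K_bound[of "poly_tail r"] mult_left_mono[OF sr, of "N\<^sup>2"] by simp
    also have "\<dots> = (N\<^sup>2 / sqrt chi)\<^sup>2 * P"
      using chi by (simp add: power2_eq_square)
    finally show "B (K (poly_tail r)) (K (poly_tail r)) \<le> (N\<^sup>2 / sqrt chi)\<^sup>2 * P" .
  qed (use P chi in auto)
  finally show ?thesis
    by (simp add: r_def n_def P_def diff_right power3_eq_cube power2_eq_square)
qed

lemma a_limit:
  "\<bar>chi * (S chi (K (p (Suc (Suc m)))) (s chi (Suc (Suc m))) / S chi (s chi (Suc (Suc m))) (s chi (Suc (Suc m))))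
     - B (K (p (Suc (Suc m)))) (K (p (Suc m))) / B (p (Suc m)) (p (Suc m))\<bar> \<le> N ^ 3 / sqrt chi + N ^ 4 / chi"
proof -
  define n where "n = Suc m"
  define P where "P = B (p n) (p n)"
  define A where "A = B (K (p (Suc n))) (s chi (Suc n))"
  define X where "X = B (K (p (Suc n))) (K (p n))"
  define T where "T = S chi (s chi (Suc n)) (s chi (Suc n))"
  have P: "0 < P" unfolding P_def by (rule gs_poly_pos)
  have T: "chi * P \<le> T" "0 < T" unfolding T_def P_def by (rule S_s_ge_chi S_s_pos)+
  have AX: "\<bar>A - X\<bar> \<le> N ^ 3 / sqrt chi * P"
    unfolding A_def X_def P_def n_def by (rule a_numerator_diff)
  have "\<bar>X\<bar> \<le> N * N * P" unfolding X_def
    by (rule abs_K_le) (use p_Suc_decreasing[of n] K_bound[of "p n"] N_nonneg P in \<open>auto simp: P_def\<close>)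
  then have X: "\<bar>X\<bar> / P \<le> N\<^sup>2" using P by (simp add: divide_le_eq power2_eq_square)
  have "\<bar>chi * (A - X) / T\<bar> = chi * \<bar>A - X\<bar> / T" using chi T by (simp add: abs_mult)
  also have "\<dots> \<le> chi * \<bar>A - X\<bar> / (chi * P)" using chi P T by (intro divide_left_mono) auto
  also have "\<dots> = \<bar>A - X\<bar> / P" using chi by simp
  also have "\<dots> \<le> N ^ 3 / sqrt chi" using AX P by (simp add: divide_le_eq)
  finally have 1: "\<bar>chi * (A - X) / T\<bar> \<le> N ^ 3 / sqrt chi" .
  have "\<bar>chi * X / T - X / P\<bar> \<le> \<bar>X\<bar> / P * N\<^sup>2 / chi" unfolding T_def P_def by (rule quotient_limit)
  also have "\<dots> \<le> N\<^sup>2 * N\<^sup>2 / chi" using chi by (intro divide_right_mono mult_right_mono X) auto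
  finally have 2: "\<bar>chi * X / T - X / P\<bar> \<le> N ^ 4 / chi" by (simp flip: power_add)
  \<comment> \<open>One summand replaces \<open>s\<close> by \<open>K (p n)\<close> in the
    numerator, the other replaces the denominator by \<open>chi * P\<close>.\<close>
  have "chi * (A / T) - X / P = chi * (A - X) / T + (chi * X / T - X / P)"
    by (simp add: right_diff_distrib diff_divide_distrib)
  then have "\<bar>chi * (A / T) - X / P\<bar> \<le> N ^ 3 / sqrt chi + N ^ 4 / chi"
    by (simp only: order_trans[OF abs_triangle_ineq add_mono[OF 1 2]])
  then show ?thesis by (simp add: a_numerator A_def X_def T_def P_def n_def)
qed

text \<open>The squared norm of the tail exceeds that of \<open>p m\<close> by at most the fraction
  \<open>N\<^sup>2 / chi\<close>. Subadditivity of the square root gives a relative error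
  \<open>N / sqrt chi\<close>, and \<open>p_le_p_0\<close> makes it absolute.\<close>

lemma tail_s_limit:
  "\<bar>sqrt (B (poly_tail (s chi (Suc m))) (poly_tail (s chi (Suc m)))) - sqrt (B (p m) (p m))\<bar>
     \<le> N * sqrt (B (p 0) (p 0)) / sqrt chi"
proof -
  define D where "D = B (poly_tail (s chi (Suc m))) (poly_tail (s chi (Suc m)))"
  define P where "P = B (p m) (p m)"
  have P: "0 < P" unfolding P_def by (rule gs_poly_pos)
  have "P \<le> D" unfolding P_def D_def by (rule p_le_tail_s)
  then have 1: "sqrt P \<le> sqrt D" by simp
  have "D \<le> P + N\<^sup>2 * P / chi"
    using tail_s_le[of m] chi by (simp add: P_def D_def field_simps)
  then have "sqrt D \<le> sqrt (P + N\<^sup>2 * P / chi)" by simp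
  also have "\<dots> \<le> sqrt P + sqrt (N\<^sup>2 * P / chi)"
    using P chi by (intro sqrt_add_le_add_sqrt) auto
  also have "sqrt (N\<^sup>2 * P / chi) = N * sqrt P / sqrt chi"
    using N_nonneg by (simp add: real_sqrt_mult real_sqrt_divide)
  also have "\<dots> \<le> N * sqrt (B (p 0) (p 0)) / sqrt chi"
    using N_nonneg chi p_le_p_0[of m] by (intro divide_right_mono mult_left_mono) (auto simp: P_def)
  finally have "sqrt D \<le> sqrt P + N * sqrt (B (p 0) (p 0)) / sqrt chi" by simp
  with 1 show ?thesis by (simp add: P_def D_def)
qed

end

end

subsection \<open>The span of the monomials\<close>

locale sg_monomial_family = sg_green_space +
  fixes P :: "nat \<Rightarrow> point \<Rightarrow> real" and k :: nat
  assumes k: "k = 2 \<or> k = 3"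
    and monomials: "sg_monomial \<mu> j k (P j)"
begin

lemma P_continuous: "continuous_on SG (P j)"
  by (rule monomial_continuous[OF monomials])

definition Phi :: "real poly \<Rightarrow> point \<Rightarrow> real" where
  "Phi q x = (\<Sum>i\<le>degree q. coeff q i * P i x)"

lemma Phi_eq: "degree q \<le> n \<Longrightarrow> Phi q x = (\<Sum>i\<le>n. coeff q i * P i x)"
  unfolding Phi_def by (rule sum.mono_neutral_left) (auto simp: coeff_eq_0)

lemma Phi_add: "Phi (q + r) x = Phi q x + Phi r x"
proof -
  define n where "n = max (degree q) (degree r)"
  have "degree (q + r) \<le> n" "degree q \<le> n" "degree r \<le> n"
    using degree_add_le_max[of q r] by (auto simp: n_def)
  then show ?thesis by (simp add: Phi_eq sum.distrib distrib_right)
qed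

lemma Phi_smult: "Phi (smult c q) x = c * Phi q x"
  by (simp add: Phi_eq[OF degree_smult_le[of c q]] Phi_def sum_distrib_left mult.assoc)

lemma Phi_0: "Phi 0 x = 0"
  by (simp add: Phi_def)

lemma Phi_diff: "Phi (q - r) x = Phi q x - Phi r x"
  using Phi_add[of q "smult (-1) r" x] Phi_smult[of "-1" r x] by simp

lemma Phi_sum: "Phi (\<Sum>i\<in>A. g i) x = (\<Sum>i\<in>A. Phi (g i) x)"
  by (induction A rule: infinite_finite_induct) (auto simp: Phi_0 Phi_add)

lemma Phi_monom: "Phi (monom 1 n) = P n"
proof
  fix x
  have "Phi (monom 1 n) x = (\<Sum>i\<le>n. coeff (monom 1 n) i * P i x)"
    by (rule Phi_eq) (rule degree_monom_le)
  also have "\<dots> = (\<Sum>i\<in>{n}. coeff (monom 1 n) i * P i x)"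
    by (rule sum.mono_neutral_right) auto
  finally show "Phi (monom 1 n) x = P n x" by simp
qed

lemma Phi_pCons: "Phi (pCons c q) x = c * P 0 x + (\<Sum>i\<le>degree q. coeff q i * P (Suc i) x)"
  by (subst Phi_eq[OF degree_pCons_le]) (simp add: sum.atMost_Suc_shift del: sum.atMost_Suc)

lemma has_laplacian_P_sum:
  "sg_has_laplacian \<mu> (\<lambda>x. \<Sum>i\<le>n. c i * P i x) (\<lambda>x. \<Sum>i<n. c (Suc i) * P i x)"
proof (induction n)
  case 0
  show ?case using has_laplacian_scale[OF monomial_laplacian_0[OF monomials], of "c 0"] by simp
next
  case (Suc n)
  show ?case
    using has_laplacian_add[OF Suc has_laplacian_scale[OF monomial_laplacian_Suc[OF monomials monomials], of "c (Suc n)"]]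
    by simp
qed

lemma has_laplacian_Phi: "sg_has_laplacian \<mu> (Phi q) (Phi (poly_tail q))"
proof -
  have "Phi q = (\<lambda>x. \<Sum>i\<le>Suc (degree q). coeff q i * P i x)"
    by (rule ext, rule Phi_eq) simp
  moreover have "degree (poly_tail q) \<le> degree q"
    by (rule degree_le) (simp add: coeff_tail coeff_eq_0)
  then have "Phi (poly_tail q) = (\<lambda>x. \<Sum>i<Suc (degree q). coeff q (Suc i) * P i x)"
    unfolding lessThan_Suc_atMost by (intro ext) (simp add: Phi_eq coeff_tail)
  ultimately show ?thesis using has_laplacian_P_sum[of "coeff q" "Suc (degree q)"] by simp
qed

lemma Phi_continuous: "continuous_on SG (Phi q)"
  by (rule has_laplacianD(2)[OF has_laplacian_Phi])

text \<open>The Laplacian strips the constant coefficient, so induction leaves a multiple of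
  \<open>P 0\<close>, which is nonzero at the vertex 1. Definiteness of \<open>B\<close> rests on
  this independence of the monomials.\<close>

lemma Phi_eq_0_imp: "(\<And>x. x \<in> SG \<Longrightarrow> Phi q x = 0) \<Longrightarrow> q = 0"
proof (induction q)
  case (pCons c q)
  have zero: "sg_has_laplacian \<mu> (\<lambda>x. 0) (\<lambda>x. 0)"
    using has_laplacian_scale[OF has_laplacian_Phi[of 0], of 0] by simp
  have "sg_has_laplacian \<mu> (\<lambda>x. 0) (Phi q)"
    using has_laplacian_cong[OF has_laplacian_Phi[of "pCons c q"], of "\<lambda>x. 0" "Phi q"] pCons.prems
    by simp
  then have q: "q = 0" using pCons.IH has_laplacian_unique[OF _ zero] by blast
  have "c * P 0 (sg_vertex 1) = 0"
    using pCons.prems[of "sg_vertex 1"] by (simp add: q Phi_pCons)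
  then show ?case using harmonic_monomial[OF k monomials] q by simp
qed simp

lemma Gop_add:
  assumes "continuous_on SG f" "continuous_on SG g" "x \<in> SG"
  shows "Gop (\<lambda>y. f y + g y) x = Gop f x + Gop g x"
  by (rule Gop_unique[OF has_laplacian_add[OF has_laplacian_Gop has_laplacian_Gop], symmetric])
    (auto simp: assms Gop_vertex)

lemma Gop_scale: "Gop (\<lambda>y. c * f y) x = c * Gop f x"
  unfolding Gop_def using I_scale[of c "\<lambda>y. G x y * f y"] by (simp add: mult.left_commute)

lemma Gop_P_sum:
  "\<exists>d. \<forall>x\<in>SG. - Gop (\<lambda>y. \<Sum>i\<le>n. c i * P i y) x = d * P 0 x + (\<Sum>i\<le>n. c i * P (Suc i) x)"
proof (induction n)
  case 0
  obtain e where e: "\<And>x. x \<in> SG \<Longrightarrow> - Gop (P 0) x = P (Suc 0) x + e * P 0 x"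
    using Gop_monomial[OF k monomials monomials monomials] by blast
  have "- Gop (\<lambda>y. \<Sum>i\<le>0. c i * P i y) x = (c 0 * e) * P 0 x + (\<Sum>i\<le>0. c i * P (Suc i) x)"
    if x: "x \<in> SG" for x
  proof -
    have "- Gop (\<lambda>y. \<Sum>i\<le>0. c i * P i y) x = c 0 * (- Gop (P 0) x)" by (simp add: Gop_scale)
    then show ?thesis unfolding e[OF x] by (simp add: algebra_simps)
  qed
  then show ?case by blast
next
  case (Suc n)
  then obtain d where d: "\<And>x. x \<in> SG \<Longrightarrow>
      - Gop (\<lambda>y. \<Sum>i\<le>n. c i * P i y) x = d * P 0 x + (\<Sum>i\<le>n. c i * P (Suc i) x)" by blast
  obtain e where e: "\<And>x. x \<in> SG \<Longrightarrow> - Gop (P (Suc n)) x = P (Suc (Suc n)) x + e * P 0 x"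
    using Gop_monomial[OF k monomials monomials monomials] by blast
  have "- Gop (\<lambda>y. \<Sum>i\<le>Suc n. c i * P i y) x =
      (d + c (Suc n) * e) * P 0 x + (\<Sum>i\<le>Suc n. c i * P (Suc i) x)" if x: "x \<in> SG" for x
  proof -
    have "Gop (\<lambda>y. \<Sum>i\<le>Suc n. c i * P i y) x =
        Gop (\<lambda>y. \<Sum>i\<le>n. c i * P i y) x + Gop (\<lambda>y. c (Suc n) * P (Suc n) y) x"
      unfolding sum.atMost_Suc by (rule Gop_add) (intro continuous_intros P_continuous x)+
    also have "\<dots> = - (- Gop (\<lambda>y. \<Sum>i\<le>n. c i * P i y) x) - c (Suc n) * (- Gop (P (Suc n)) x)"
      by (simp add: Gop_scale)
    finally show ?thesis unfolding d[OF x] e[OF x] by (simp add: algebra_simps)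
  qed
  then show ?case by blast
qed

text \<open>Only the constant coefficient is chosen; it collects the harmonic corrections of
  \<open>Gop_monomial\<close> and exists by \<open>Gop_P_sum\<close>.\<close>

definition K :: "real poly \<Rightarrow> real poly" where
  "K q = pCons (SOME c. \<forall>x\<in>SG. - Gop (Phi q) x = Phi (pCons c q) x) q"

lemma Phi_K:
  assumes "x \<in> SG" shows "Phi (K q) x = - Gop (Phi q) x"
proof -
  have "Phi q = (\<lambda>x. \<Sum>i\<le>degree q. coeff q i * P i x)" by (rule ext) (rule Phi_def)
  then have "\<exists>c. \<forall>x\<in>SG. - Gop (Phi q) x = Phi (pCons c q) x"
    unfolding Phi_pCons using Gop_P_sum[where n = "degree q" and c = "coeff q"] by simp
  from someI_ex[OF this] assms show ?thesis unfolding K_def by simp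
qed

definition B :: "real poly \<Rightarrow> real poly \<Rightarrow> real" where
  "B q r = I (\<lambda>x. Phi q x * Phi r x)"

sublocale sobolev_form B K "sg_green_norm2 \<mu> G"
proof
  fix q r t :: "real poly" and c :: real
  note cont = Phi_continuous
  show "B q r = B r q" by (simp add: B_def mult.commute)
  show "B (q + r) t = B q t + B r t"
    unfolding B_def Phi_add distrib_right by (rule I_add) (intro continuous_intros cont)+
  show "B (smult c q) r = c * B q r"
    unfolding B_def Phi_smult mult.assoc by (rule I_scale)
  show "0 < B q q" if "q \<noteq> 0"
  proof -
    have c: "continuous_on SG (\<lambda>x. Phi q x * Phi q x)" by (intro continuous_intros cont)
    have "0 \<le> B q q" unfolding B_def by (rule I_nonneg[OF c]) simp
    moreover have "B q q \<noteq> 0"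
      using I_eq_0_imp[OF c] Phi_eq_0_imp[of q] that unfolding B_def by force
    ultimately show ?thesis by simp
  qed
  show "\<exists>c. K q = pCons c q" by (simp add: K_def)
  have K_eq: "B (K q) r = - I (\<lambda>x. Gop (Phi q) x * Phi r x)" for q r
  proof -
    have "B (K q) r = I (\<lambda>x. - 1 * (Gop (Phi q) x * Phi r x))"
      unfolding B_def by (rule I_cong) (simp add: Phi_K)
    then show ?thesis unfolding I_scale by simp
  qed
  have "B q (K r) = B (K r) q" by (simp add: B_def mult.commute)
  then show "B (K q) r = B q (K r)"
    using Gop_self_adjoint[OF cont cont, of q r] by (simp add: K_eq mult.commute)
  have BK: "B (K q) (K q) = I (\<lambda>x. (Gop (Phi q) x)\<^sup>2)"
    unfolding B_def by (rule I_cong) (simp add: Phi_K power2_eq_square)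
  have Bq: "B q q = I (\<lambda>x. (Phi q x)\<^sup>2)" by (simp add: B_def power2_eq_square)
  show "B (K q) (K q) \<le> (sg_green_norm2 \<mu> G)\<^sup>2 * B q q"
    unfolding BK Bq by (rule Gop_hilbert_schmidt[OF cont])
  show "B (K q) (K q) \<le> B q q"
    unfolding BK Bq by (rule Gop_contraction[OF cont])
  show "0 \<le> sg_green_norm2 \<mu> G"
    unfolding sg_green_norm2_def set_lebesgue_integral_def by (intro real_sqrt_ge_zero integral_nonneg_AE) auto
qed

lemma sg_inner2_Phi:
  assumes "\<And>x. x \<in> SG \<Longrightarrow> u x = Phi q x" "\<And>x. x \<in> SG \<Longrightarrow> v x = Phi r x"
  shows "sg_inner2 \<mu> u v = B q r"
  unfolding sg_inner2_def B_def I_def[symmetric] by (rule I_cong) (simp add: assms)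

lemma sg_norm2_Phi:
  assumes "\<And>x. x \<in> SG \<Longrightarrow> u x = Phi q x"
  shows "sg_norm2 \<mu> u = sqrt (B q q)"
  using sg_inner2_Phi[OF assms assms] by (simp add: sg_norm2_def)

lemma sg_laplacian_Phi:
  assumes "\<And>x. x \<in> SG \<Longrightarrow> u x = Phi q x" "x \<in> SG"
  shows "sg_laplacian \<mu> u x = Phi (poly_tail q) x"
  by (rule sg_laplacian_eq[OF has_laplacian_cong[OF has_laplacian_Phi] assms(2)]) (simp_all add: assms(1))

lemma sg_innerS_Phi:
  assumes "\<And>x. x \<in> SG \<Longrightarrow> u x = Phi q x" "\<And>x. x \<in> SG \<Longrightarrow> v x = Phi r x"
  shows "sg_innerS \<mu> chi u v = S chi q r"
  using sg_inner2_Phi[OF assms]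
    sg_inner2_Phi[OF sg_laplacian_Phi[of u q] sg_laplacian_Phi[of v r]] assms
  by (simp add: sg_innerS_def sg_inner2_def S_def)

text \<open>Both recursions have the same shape and \<open>Phi\<close> is linear at every point, so
  the functions agree on the whole plane and not just on \<open>SG\<close>.\<close>

lemma gram_schmidt_Phi:
  assumes "\<And>q r. ip (Phi q) (Phi r) = F q r"
  shows "gram_schmidt ip P n = Phi (gs_poly F n)"
proof (induction n rule: less_induct)
  case (less n)
  have IH: "gram_schmidt ip P i = Phi (gs_poly F i)" if "i < n" for i by (rule less[OF that])
  have "gram_schmidt ip P n x = Phi (gs_poly F n) x" for x
    by (subst gram_schmidt.simps, subst gs_poly.simps)
      (simp add: IH Phi_diff Phi_sum Phi_smult Phi_monom flip: assms)
  then show ?case by blast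
qed

lemma sg_legendre_eq: "sg_legendre \<mu> P n = Phi (p n)"
  unfolding sg_legendre_def by (rule gram_schmidt_Phi) (rule sg_inner2_Phi; rule refl)

lemma sg_sobolev_legendre_eq: "sg_sobolev_legendre \<mu> chi P n = Phi (s chi n)"
  unfolding sg_sobolev_legendre_def by (rule gram_schmidt_Phi) (rule sg_innerS_Phi; rule refl)

lemma sg_green_legendre_eq: "x \<in> SG \<Longrightarrow> sg_green_legendre \<mu> G P (Suc n) x = Phi (K (p n)) x"
  by (simp add: sg_green_legendre_def sg_legendre_eq Phi_K Gop_def I_def)

end

section \<open>From explicit error bounds to uniform limits\<close>

lemma uniform_limit_of_bound:
  fixes F :: "real \<Rightarrow> 'a \<Rightarrow> real"
  assumes "\<And>chi n. chi > 0 \<Longrightarrow> n \<in> A \<Longrightarrow> \<bar>F chi n - L n\<bar> \<le> g chi" "(g \<longlongrightarrow> 0) at_top"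
  shows "uniform_limit A F L at_top"
proof (rule uniform_limitI)
  fix e :: real assume "e > 0"
  then have "\<forall>\<^sub>F chi in at_top. g chi < e" using assms(2) order_tendstoD(2) by blast
  then show "\<forall>\<^sub>F chi in at_top. \<forall>n\<in>A. dist (F chi n) (L n) < e"
    using eventually_gt_at_top[of 0]
    by eventually_elim (use assms(1) in \<open>force simp: dist_real_def\<close>)
qed

lemma const_over_at_top_tendsto_0:
  fixes c :: real
  shows "((\<lambda>chi. c / chi) \<longlongrightarrow> 0) at_top" "((\<lambda>chi. c / sqrt chi) \<longlongrightarrow> 0) at_top"
  by (rule tendsto_divide_0[OF tendsto_const],
      rule filterlim_at_top_imp_at_infinity, rule filterlim_ident sqrt_at_top)+

theorem proposition3p1:
  fixes \<mu> :: "point measure"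
    and G :: "point \<Rightarrow> point \<Rightarrow> real"
    and P :: "nat \<Rightarrow> point \<Rightarrow> real"
    and k :: nat
  assumes measure: "sg_measure \<mu>"
    and green: "sg_green \<mu> G"
    and k: "k = 2 \<or> k = 3"
    and monomials: "\<And>j. sg_monomial \<mu> j k (P j)"
  defines "N \<equiv> sg_green_norm2 \<mu> G"
    and "p \<equiv> sg_legendre \<mu> P"
    and "s \<equiv> \<lambda>chi. sg_sobolev_legendre \<mu> chi P"
    and "f \<equiv> sg_green_legendre \<mu> G P"
  defines "a \<equiv> \<lambda>chi n. sg_innerS \<mu> chi (f (n + 1)) (s chi n) / (sg_normS \<mu> chi (s chi n))\<^sup>2"
    and "b \<equiv> \<lambda>chi n. sg_innerS \<mu> chi (f (n + 1)) (s chi (n - 1)) / (sg_normS \<mu> chi (s chi (n - 1)))\<^sup>2"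
  shows
    "(\<forall>chi>0. \<forall>n\<ge>1.
        sg_norm2 \<mu> (p n) \<le> sg_norm2 \<mu> (s chi n) \<and>
        sg_norm2 \<mu> (s chi n) \<le> N * sg_norm2 \<mu> (p (n - 1)) \<and>
        (1 + chi * inverse (N\<^sup>2)) * (sg_norm2 \<mu> (p n))\<^sup>2 \<le> (sg_normS \<mu> chi (s chi n))\<^sup>2 \<and>
        (sg_normS \<mu> chi (s chi n))\<^sup>2 \<le> (N\<^sup>2 + chi) * (sg_norm2 \<mu> (p (n - 1)))\<^sup>2 \<and>
        \<bar>a chi n\<bar> \<le> min N (inverse chi * N ^ 3) \<and>
        0 < b chi n \<and>
        b chi n \<le> N\<^sup>2 \<and>
        (n \<ge> 2 \<longrightarrow> b chi n \<le> min (N\<^sup>2) (inverse chi * N ^ 4)))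
     \<and> (\<forall>n\<ge>1. (\<lambda>chi. (sg_normS \<mu> chi (s chi n))\<^sup>2) \<in> O[at_top](\<lambda>chi. chi))
     \<and> (\<forall>n\<ge>1. (\<lambda>chi. a chi n) \<in> O[at_top](\<lambda>chi. inverse chi))
     \<and> (\<forall>n\<ge>2. (\<lambda>chi. b chi n) \<in> O[at_top](\<lambda>chi. inverse chi))
     \<and> uniform_limit {2..} (\<lambda>chi n. chi * b chi n)
         (\<lambda>n. (sg_norm2 \<mu> (p n))\<^sup>2 / (sg_norm2 \<mu> (p (n - 2)))\<^sup>2) at_top
     \<and> uniform_limit {2..} (\<lambda>chi n. chi * a chi n)
         (\<lambda>n. sg_inner2 \<mu> (f (n + 1)) (f n) / (sg_norm2 \<mu> (p (n - 1)))\<^sup>2) at_top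
     \<and> uniform_limit {1..} (\<lambda>chi n. sg_norm2 \<mu> (sg_laplacian \<mu> (s chi n)))
         (\<lambda>n. sg_norm2 \<mu> (p (n - 1))) at_top"
proof -
  interpret M: sg_monomial_family \<mu> G P k
    by unfold_locales (fact measure green k monomials)+
  have p_eq: "p n = M.Phi (M.p n)" for n unfolding p_def by (rule M.sg_legendre_eq)
  have s_eq: "s chi n = M.Phi (M.s chi n)" for chi n unfolding s_def by (rule M.sg_sobolev_legendre_eq)
  have f_eq: "f (Suc n) x = M.Phi (M.K (M.p n)) x" if "x \<in> SG" for n x
    unfolding f_def by (rule M.sg_green_legendre_eq[OF that])
  have np: "sg_norm2 \<mu> (p n) = sqrt (M.B (M.p n) (M.p n))" for n
    by (rule M.sg_norm2_Phi) (simp add: p_eq)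
  have ns: "sg_norm2 \<mu> (s chi n) = sqrt (M.B (M.s chi n) (M.s chi n))" for chi n
    by (rule M.sg_norm2_Phi) (simp add: s_eq)
  have np2: "(sg_norm2 \<mu> (p n))\<^sup>2 = M.B (M.p n) (M.p n)" for n
    unfolding np by (rule real_sqrt_pow2[OF M.nonneg])
  have nS: "(sg_normS \<mu> chi (s chi n))\<^sup>2 = M.S chi (M.s chi n) (M.s chi n)" if "chi > 0" for chi n
  proof -
    have "sg_innerS \<mu> chi (s chi n) (s chi n) = M.S chi (M.s chi n) (M.s chi n)"
      by (rule M.sg_innerS_Phi) (simp_all add: s_eq)
    then show ?thesis
      unfolding sg_normS_def using M.S_s_pos[OF that, of n] by simp
  qed
  have innerS_f: "sg_innerS \<mu> chi (f (Suc n)) (s chi m) = M.S chi (M.K (M.p n)) (M.s chi m)" for chi m n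
    by (rule M.sg_innerS_Phi[OF f_eq]) (simp_all add: s_eq)
  have a_eq: "a chi n = M.S chi (M.K (M.p n)) (M.s chi n) / M.S chi (M.s chi n) (M.s chi n)"
    if "chi > 0" for chi n
    unfolding a_def nS[OF that] Suc_eq_plus1[symmetric] innerS_f ..
  have b_eq: "b chi (Suc n) = M.S chi (M.K (M.p (Suc n))) (M.s chi n) / M.S chi (M.s chi n) (M.s chi n)"
    if "chi > 0" for chi n
    unfolding b_def diff_Suc_1 nS[OF that] Suc_eq_plus1[symmetric] innerS_f ..
  have inner_f: "sg_inner2 \<mu> (f (Suc n)) (f (Suc m)) = M.B (M.K (M.p n)) (M.K (M.p m))" for m n
    by (rule M.sg_inner2_Phi[OF f_eq f_eq])
  have lap: "sg_norm2 \<mu> (sg_laplacian \<mu> (s chi n)) = sqrt (M.B (poly_tail (M.s chi n)) (poly_tail (M.s chi n)))"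
    for chi n
    by (rule M.sg_norm2_Phi, rule M.sg_laplacian_Phi) (simp_all add: s_eq)
  have N: "0 < N" "0 \<le> N" unfolding N_def using M.N_pos by simp_all

  have estimates: "sg_norm2 \<mu> (p n) \<le> sg_norm2 \<mu> (s chi n) \<and>
        sg_norm2 \<mu> (s chi n) \<le> N * sg_norm2 \<mu> (p (n - 1)) \<and>
        (1 + chi * inverse (N\<^sup>2)) * (sg_norm2 \<mu> (p n))\<^sup>2 \<le> (sg_normS \<mu> chi (s chi n))\<^sup>2 \<and>
        (sg_normS \<mu> chi (s chi n))\<^sup>2 \<le> (N\<^sup>2 + chi) * (sg_norm2 \<mu> (p (n - 1)))\<^sup>2 \<and>
        \<bar>a chi n\<bar> \<le> min N (inverse chi * N ^ 3) \<and>
        0 < b chi n \<and>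
        b chi n \<le> N\<^sup>2 \<and>
        (n \<ge> 2 \<longrightarrow> b chi n \<le> min (N\<^sup>2) (inverse chi * N ^ 4))"
    if chi: "chi > 0" and n: "n \<ge> 1" for chi n
  proof (intro conjI impI)
    \<comment> \<open>The polynomial estimates are indexed by the predecessor of \<open>n\<close>,
      which avoids truncated subtraction.\<close>
    obtain m where m: "n = Suc m" using n by (cases n) auto
    show "sg_norm2 \<mu> (p n) \<le> sg_norm2 \<mu> (s chi n)"
      unfolding np ns by (intro real_sqrt_le_mono M.p_le_s chi)
    have "sqrt (M.B (M.s chi n) (M.s chi n)) \<le> sqrt (N\<^sup>2 * M.B (M.p m) (M.p m))"
      unfolding m N_def by (intro real_sqrt_le_mono M.s_le chi)
    then show "sg_norm2 \<mu> (s chi n) \<le> N * sg_norm2 \<mu> (p (n - 1))"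
      using N by (simp add: ns np m real_sqrt_mult)
    show "(1 + chi * inverse (N\<^sup>2)) * (sg_norm2 \<mu> (p n))\<^sup>2 \<le> (sg_normS \<mu> chi (s chi n))\<^sup>2"
      unfolding np2 nS[OF chi] m N_def by (rule M.S_s_lower[OF chi])
    show "(sg_normS \<mu> chi (s chi n))\<^sup>2 \<le> (N\<^sup>2 + chi) * (sg_norm2 \<mu> (p (n - 1)))\<^sup>2"
      unfolding np2 nS[OF chi] m N_def diff_Suc_1 by (rule M.S_s_le[OF chi])
    show "\<bar>a chi n\<bar> \<le> min N (inverse chi * N ^ 3)"
      unfolding a_eq[OF chi] m N_def by (rule M.a_bound[OF chi])
    show "0 < b chi n" unfolding m b_eq[OF chi] by (rule M.b_pos[OF chi])
    show le: "b chi n \<le> N\<^sup>2" unfolding m b_eq[OF chi] N_def by (rule M.b_le[OF chi])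
    assume "n \<ge> 2"
    then obtain l where "m = Suc l" using m by (cases m) auto
    then have "b chi n \<le> inverse chi * N ^ 4"
      unfolding m by (simp only: b_eq[OF chi] N_def M.b_le_chi[OF chi])
    with le show "b chi n \<le> min (N\<^sup>2) (inverse chi * N ^ 4)" by simp
  qed

  have O_norm: "(\<lambda>chi. (sg_normS \<mu> chi (s chi n))\<^sup>2) \<in> O[at_top](\<lambda>chi. chi)" if "n \<ge> 1" for n
  proof (rule bigoI)
    show "\<forall>\<^sub>F chi in at_top. norm ((sg_normS \<mu> chi (s chi n))\<^sup>2) \<le>
        ((N\<^sup>2 + 1) * (sg_norm2 \<mu> (p (n - 1)))\<^sup>2) * norm (chi :: real)"
      \<comment> \<open>From \<open>chi = 1\<close> on, \<open>N\<^sup>2\<close> is absorbed into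
        \<open>N\<^sup>2 * chi\<close>, whence the constant \<open>N\<^sup>2 + 1\<close>.\<close>
      using eventually_ge_at_top[of 1]
    proof eventually_elim
      fix chi :: real assume chi: "1 \<le> chi"
      have "(sg_normS \<mu> chi (s chi n))\<^sup>2 \<le> (N\<^sup>2 + chi) * (sg_norm2 \<mu> (p (n - 1)))\<^sup>2"
        using estimates[of chi n] chi that by simp
      also have "\<dots> \<le> ((N\<^sup>2 + 1) * chi) * (sg_norm2 \<mu> (p (n - 1)))\<^sup>2"
        using mult_left_mono[OF chi, of "N\<^sup>2"] by (intro mult_right_mono) (simp_all add: algebra_simps)
      finally show "norm ((sg_normS \<mu> chi (s chi n))\<^sup>2) \<le>
          ((N\<^sup>2 + 1) * (sg_norm2 \<mu> (p (n - 1)))\<^sup>2) * norm chi"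
        using chi by (simp add: mult_ac)
    qed
  qed
  have O_a: "(\<lambda>chi. a chi n) \<in> O[at_top](\<lambda>chi. inverse chi)" if "n \<ge> 1" for n
  proof (rule bigoI)
    show "\<forall>\<^sub>F chi in at_top. norm (a chi n) \<le> N ^ 3 * norm (inverse chi)"
      using eventually_gt_at_top[of 0]
      by eventually_elim (use estimates that in \<open>simp add: mult.commute\<close>)
  qed
  have O_b: "(\<lambda>chi. b chi n) \<in> O[at_top](\<lambda>chi. inverse chi)" if "n \<ge> 2" for n
  proof (rule bigoI)
    show "\<forall>\<^sub>F chi in at_top. norm (b chi n) \<le> N ^ 4 * norm (inverse chi)"
      using eventually_gt_at_top[of 0]
    proof eventually_elim
      fix chi :: real assume "0 < chi"
      then have "0 < b chi n" "b chi n \<le> inverse chi * N ^ 4" using estimates[of chi n] that by simp_all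
      with \<open>0 < chi\<close> show "norm (b chi n) \<le> N ^ 4 * norm (inverse chi)" by (simp add: mult.commute)
    qed
  qed

  have lim_b: "uniform_limit {2..} (\<lambda>chi n. chi * b chi n)
         (\<lambda>n. (sg_norm2 \<mu> (p n))\<^sup>2 / (sg_norm2 \<mu> (p (n - 2)))\<^sup>2) at_top"
  proof (rule uniform_limit_of_bound)
    show "((\<lambda>chi. N ^ 6 / chi) \<longlongrightarrow> 0) at_top" by (rule const_over_at_top_tendsto_0)
    fix chi :: real and n :: nat assume chi: "chi > 0" and n: "n \<in> {2..}"
    obtain m where m: "n = Suc (Suc m)" using n by (metis atLeast_iff add_2_eq_Suc le_Suc_ex)
    have m2: "n - 2 = m" by (simp add: m)
    show "\<bar>chi * b chi n - (sg_norm2 \<mu> (p n))\<^sup>2 / (sg_norm2 \<mu> (p (n - 2)))\<^sup>2\<bar> \<le> N ^ 6 / chi"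
      unfolding np2 m2 unfolding m b_eq[OF chi] N_def by (rule M.b_limit[OF chi])
  qed
  have lim_a: "uniform_limit {2..} (\<lambda>chi n. chi * a chi n)
         (\<lambda>n. sg_inner2 \<mu> (f (n + 1)) (f n) / (sg_norm2 \<mu> (p (n - 1)))\<^sup>2) at_top"
  proof (rule uniform_limit_of_bound)
    show "((\<lambda>chi. N ^ 3 / sqrt chi + N ^ 4 / chi) \<longlongrightarrow> 0) at_top"
      using tendsto_add[OF const_over_at_top_tendsto_0(2) const_over_at_top_tendsto_0(1)] by simp
    fix chi :: real and n :: nat assume chi: "chi > 0" and n: "n \<in> {2..}"
    obtain m where m: "n = Suc (Suc m)" using n by (metis atLeast_iff add_2_eq_Suc le_Suc_ex)
    show "\<bar>chi * a chi n - sg_inner2 \<mu> (f (n + 1)) (f n) / (sg_norm2 \<mu> (p (n - 1)))\<^sup>2\<bar>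
        \<le> N ^ 3 / sqrt chi + N ^ 4 / chi"
      unfolding np2 a_eq[OF chi] m Suc_eq_plus1[symmetric] diff_Suc_1 inner_f N_def
      by (rule M.a_limit[OF chi])
  qed
  have lim_lap: "uniform_limit {1..} (\<lambda>chi n. sg_norm2 \<mu> (sg_laplacian \<mu> (s chi n)))
         (\<lambda>n. sg_norm2 \<mu> (p (n - 1))) at_top"
  proof (rule uniform_limit_of_bound)
    show "((\<lambda>chi. N * sqrt (M.B (M.p 0) (M.p 0)) / sqrt chi) \<longlongrightarrow> 0) at_top"
      by (rule const_over_at_top_tendsto_0)
    fix chi :: real and n :: nat assume chi: "chi > 0" and n: "n \<in> {1..}"
    obtain m where m: "n = Suc m" using n by (cases n) auto
    show "\<bar>sg_norm2 \<mu> (sg_laplacian \<mu> (s chi n)) - sg_norm2 \<mu> (p (n - 1))\<bar>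
        \<le> N * sqrt (M.B (M.p 0) (M.p 0)) / sqrt chi"
      unfolding lap np m diff_Suc_1 N_def by (rule M.tail_s_limit[OF chi])
  qed
  show ?thesis
    using estimates O_norm O_a O_b lim_b lim_a lim_lap by blast
qed

end
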